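(* Let $F:\Omega^X\to\mathbb R$ and let $K:X\to\mathbb R_+$ be a non-negative function such that $$D_yF(\omega)\le K(y),\qquad y\in X,\ \omega\in\Omega^X.$$ Then $$P(F-E[F]\ge x)\le\exp\Big(\min_{t>0}\Big(\int_0^t h(s)\,ds-tx\Big)\Big),\qquad x>0,$$ where $$h(t)=\sup_{\omega\in\Omega^X}\int_X\frac{e^{tK(y)}-1}{K(y)}\,|D_yF(\omega)|^2\,\nu(dy),\qquad t>0.$$ If moreover $h$ is finite on $[0,t_0)$, then $$P(F-E[F]\ge x)\le\exp\left(-\int_0^x h^{-1}(s)\,ds\right),\qquad 0<x<h(t_0^-).$$ If $K(y)=0$ for all $y\in X$, then $$P(F-E[F]\ge x)\le\exp\left(-\frac{x^2}{2\tilde\alpha^2}\right),\quad x>0,\qquad\text{with}\quad \tilde\alpha^2=\sup_{\omega\in\Omega^X}\int_X|D_yF(\omega)|^2\,\nu(dy).$$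
   Context: $X$ is a $\sigma$-compact metric space, $\nu$ a diffuse Radon measure on $X$, $\Omega^X$ is the space of configurations $\omega=\sum_{i=1}^N\epsilon_{t_i}$ (Radon measures that are sums of Dirac masses at pairwise distinct points of $X$, $N\in\mathbb N\cup\{\infty\}$), identified with their supports, and $P$ is the Poisson measure on $\Omega^X$ with intensity $\nu$; $E$ is expectation under $P$. $D_yF(\omega)=F(\omega\cup\{y\})-F(\omega)$. $F$ and $K$ are measurable. Suprema over $\Omega^X$ may be taken as essential suprema with respect to $P$. When $K(y)=0$, the ratio $(e^{tK(y)}-1)/K(y)$ is read as $t$; $h(0)=0$. The minimum over $t$ is understood as an infimum. $h^{-1}(x)=\inf\{t>0:h(t)\ge x\}$ is the left-continuous inverse of $h$, and $h(t_0^-)$ is the left limit of $h$ at $t_0$. *)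

theory Defs
  imports "HOL-Probability.Probability"
begin

definition radon_measure :: "'a::metric_space measure \<Rightarrow> bool" where
  "radon_measure M \<longleftrightarrow>
     sets M = sets borel \<and>
     (\<forall>C. compact C \<longrightarrow> emeasure M C < \<infinity>) \<and>
     (\<forall>B\<in>sets borel. emeasure M B = (SUP C\<in>{C. compact C \<and> C \<subseteq> B}. emeasure M C))"

definition diffuse_measure :: "'a measure \<Rightarrow> bool" where
  "diffuse_measure M \<longleftrightarrow> (\<forall>x. emeasure M {x} = 0)"

text \<open>
  A configuration is represented by its support, a set of points. The associated measure, the sum
  of the Dirac masses at the points of the set, is the counting measure of the set pushed forward
  to the Borel sets.
\<close>

definition dirac_sum :: "'a::metric_space set \<Rightarrow> 'a measure" where
  "dirac_sum \<omega> = distr (count_space \<omega>) borel (\<lambda>x. x)"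

definition configurations :: "'a::metric_space set set" where
  "configurations = {\<omega>. countable \<omega> \<and> radon_measure (dirac_sum \<omega>)}"

text \<open>The \<open>\<sigma>\<close>-algebra on the configurations is generated by the maps \<open>\<omega> \<mapsto> \<omega>(B)\<close>, \<open>B\<close> Borel.\<close>

definition config_space :: "'a::metric_space set measure" where
  "config_space = sigma configurations
     {{\<omega>\<in>configurations. emeasure (dirac_sum \<omega>) B \<in> A} | A B. A \<in> sets borel \<and> B \<in> sets borel}"

definition poisson_measure :: "'a::metric_space measure \<Rightarrow> 'a set measure \<Rightarrow> bool" where
  "poisson_measure \<nu> P \<longleftrightarrow>
     sets P = sets config_space \<and> prob_space P \<and>
     (\<forall>B\<in>sets borel. emeasure \<nu> B < \<infinity> \<longrightarrow>
        (\<forall>k. measure P {\<omega>\<in>space P. emeasure (dirac_sum \<omega>) B = of_nat k}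
               = exp (- measure \<nu> B) * measure \<nu> B ^ k / fact k)) \<and>
     (\<forall>(n::nat) B. (\<forall>i<n. B i \<in> sets borel) \<and> disjoint_family_on B {..<n} \<longrightarrow>
        prob_space.indep_vars P (\<lambda>_. borel) (\<lambda>i \<omega>. emeasure (dirac_sum \<omega>) (B i)) {..<n})"

definition diff_op :: "('a set \<Rightarrow> real) \<Rightarrow> 'a \<Rightarrow> 'a set \<Rightarrow> real" where
  "diff_op F y \<omega> = F (\<omega> \<union> {y}) - F \<omega>"

text \<open>\<open>(exp (t k) - 1) / k\<close>, extended by continuity to \<open>k = 0\<close>.\<close>

definition exp_ratio :: "real \<Rightarrow> real \<Rightarrow> real" where
  "exp_ratio t k = (if k = 0 then t else (exp (t * k) - 1) / k)"

text \<open>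
  The first argument \<open>S\<close> is the supremum over configurations, so that the function can be
  used with the pointwise as well as with the essential supremum. At \<open>t = 0\<close> the integrand
  vanishes; only arguments \<open>t \<ge> 0\<close> are meaningful.
\<close>

definition dev_fun ::
  "(('a set \<Rightarrow> ennreal) \<Rightarrow> ennreal) \<Rightarrow> 'a measure \<Rightarrow> ('a \<Rightarrow> real) \<Rightarrow> ('a set \<Rightarrow> real) \<Rightarrow> real \<Rightarrow> ennreal"
  where
  "dev_fun S \<nu> K F t =
     S (\<lambda>\<omega>. \<integral>\<^sup>+ y. ennreal (exp_ratio t (K y) * \<bar>diff_op F y \<omega>\<bar>\<^sup>2) \<partial>\<nu>)"

text \<open>The left-continuous inverse, \<open>\<infinity>\<close> where \<open>h\<close> does not reach the level \<open>x\<close>.\<close>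

definition left_inv :: "(real \<Rightarrow> ennreal) \<Rightarrow> real \<Rightarrow> ennreal" where
  "left_inv h x = (INF t\<in>{t. 0 < t \<and> ennreal x \<le> h t}. ennreal t)"

text \<open>The argument is extended real so that \<open>t\<^sub>0 = \<infinity>\<close> is allowed.\<close>

definition left_lim :: "(real \<Rightarrow> ennreal) \<Rightarrow> ereal \<Rightarrow> ennreal" where
  "left_lim h t0 = Lim (at_left t0) (\<lambda>s. h (real_of_ereal s))"

text \<open>The exponential with \<open>exp (-\<infinity>) = 0\<close> and \<open>exp \<infinity> = \<infinity>\<close>.\<close>

definition exp_ereal :: "ereal \<Rightarrow> ennreal" where
  "exp_ereal z = (case z of ereal r \<Rightarrow> ennreal (exp r) | PInfty \<Rightarrow> \<infinity> | MInfty \<Rightarrow> 0)"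

end

theory Submission
  imports Defs
begin

text \<open>
  Only the void probabilities \<open>P(\<omega> \<inter> B = {}) = exp(- \<nu>(B))\<close> of the Poisson process enter: by an
  observation of Renyi they determine its law. For \<open>u \<in> [0, 1]\<close> let two copies \<open>\<omega>\<close>, \<open>\<omega>'\<close> of the
  process share a thinned part of intensity \<open>u \<nu>\<close> and be independent otherwise. Then
  \<open>d/du E[F(\<omega>) G(\<omega>')] = E \<integral> D\<^sub>yF(\<omega>) D\<^sub>yG(\<omega>') \<nu>(dy)\<close>, and integrating over \<open>u\<close> represents the
  covariance of \<open>F\<close> and \<open>G\<close>. For \<open>G = exp(s F)\<close> the bound \<open>D\<^sub>yF \<le> K(y)\<close> gives
  \<open>\<bar>D\<^sub>yG\<bar> \<le> (exp(s K(y)) - 1) / K(y) * \<bar>D\<^sub>yF\<bar> * G\<close>; since the coupling does not depend on \<open>y\<close>,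
  AM-GM and the supremum over configurations yield \<open>Cov(F, exp(s F)) \<le> h(s) E[exp(s F)]\<close>. This is a
  differential inequality for the logarithm of the Laplace transform of \<open>F - E[F]\<close>, and the deviation
  bounds follow by Chernoff's method. The case \<open>F = G\<close> is the Poincare inequality, which shows that
  \<open>F\<close> is integrable as soon as \<open>h\<close> is finite somewhere.
\<close>

section \<open>Configurations and void events\<close>

text \<open>The obstacle is that the law of the process is accessible only through its void
  probabilities, while the covariance argument needs two dependent copies. The pair is the one
  behind Mehler's formula: given the first copy, the second is its Ornstein-Uhlenbeck evolution at
  the time with \<open>exp (- time) = u\<close>. It is assembled by hand from a Poisson number of
  points on a compact set, with \<open>P\<close> itself supplying everything outside. At u = 1 the
  copies therefore agree only on that compact set, which has to be enlarged at the end. Growing u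
  exchanges private points for common ones at equal rates, and this balance is what leaves a product
  of two increments in the derivative. Differentiation is carried out for bounded functionals, hence
  the truncations: being monotone and contracting, they preserve both the one-sided bound by
  \<open>K\<close> and the size of the gradient. The bound on D_yF may be one-sided because the
  slope of the exponential increases: negative increments, however large, only contribute slopes of
  at most s.\<close>

lemma emeasure_dirac_sum:
  "B \<in> sets borel \<Longrightarrow> emeasure (dirac_sum \<omega>) B = emeasure (count_space \<omega>) (\<omega> \<inter> B)"
  unfolding dirac_sum_def by (subst emeasure_distr) (auto simp: Int_commute)

lemma emeasure_dirac_sum_finite_iff:
  "B \<in> sets borel \<Longrightarrow> emeasure (dirac_sum \<omega>) B < \<infinity> \<longleftrightarrow> finite (\<omega> \<inter> B)"
  by (simp add: emeasure_dirac_sum emeasure_count_space of_nat_less_top)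

lemma card_le_emeasure_count_space:
  assumes "finite S" "S \<subseteq> X" "X \<subseteq> \<Omega>"
  shows "of_nat (card S) \<le> emeasure (count_space \<Omega>) X"
proof -
  have "of_nat (card S) = emeasure (count_space \<Omega>) S"
    using assms by (subst emeasure_count_space_finite) auto
  also have "\<dots> \<le> emeasure (count_space \<Omega>) X"
    using assms by (intro emeasure_mono) auto
  finally show ?thesis .
qed

lemma emeasure_count_space_leI:
  assumes X: "X \<subseteq> \<Omega>" and le: "\<And>S. finite S \<Longrightarrow> S \<subseteq> X \<Longrightarrow> of_nat (card S) \<le> b"
  shows "emeasure (count_space \<Omega>) X \<le> b"
proof (cases "finite X")
  case True
  then show ?thesis
    using le[of X] X by (simp add: emeasure_count_space)
next
  case False
  have "of_nat n \<le> b" for n :: nat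
    using infinite_arbitrarily_large[OF False, of n] le by auto
  then have "(SUP n. of_nat n :: ennreal) \<le> b"
    by (intro SUP_least)
  then show ?thesis
    by (simp add: ennreal_SUP_of_nat_eq_top top_unique)
qed

text \<open>Finite sets are compact and the count of a set is the supremum of the counts of its
  finite subsets, which gives inner regularity. What remains of the Radon property is local
  finiteness.\<close>

lemma configurations_iff:
  "\<omega> \<in> configurations \<longleftrightarrow> countable \<omega> \<and> (\<forall>C. compact C \<longrightarrow> finite (\<omega> \<inter> C))"
proof
  assume *: "\<omega> \<in> configurations"
  have "finite (\<omega> \<inter> C)" if "compact C" for C
  proof -
    have "emeasure (dirac_sum \<omega>) C < \<infinity>"
      using * that by (auto simp: configurations_def radon_measure_def)
    then show ?thesis
      using that by (subst (asm) emeasure_dirac_sum_finite_iff) (auto intro: borel_compact)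
  qed
  with * show "countable \<omega> \<and> (\<forall>C. compact C \<longrightarrow> finite (\<omega> \<inter> C))"
    by (auto simp: configurations_def)
next
  assume *: "countable \<omega> \<and> (\<forall>C. compact C \<longrightarrow> finite (\<omega> \<inter> C))"
  have "emeasure (dirac_sum \<omega>) B
      = (SUP C\<in>{C. compact C \<and> C \<subseteq> B}. emeasure (dirac_sum \<omega>) C)" (is "_ = ?s")
    if B: "B \<in> sets borel" for B
  proof (rule antisym)
    show "emeasure (dirac_sum \<omega>) B \<le> ?s"
      unfolding emeasure_dirac_sum[OF B]
    proof (rule emeasure_count_space_leI)
      fix S assume S: "finite S" "S \<subseteq> \<omega> \<inter> B"
      then have "of_nat (card S) \<le> emeasure (count_space \<omega>) (\<omega> \<inter> S)"
        by (intro card_le_emeasure_count_space) auto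
      also have "\<dots> = emeasure (dirac_sum \<omega>) S"
        using S by (subst emeasure_dirac_sum) (auto intro: borel_compact finite_imp_compact)
      also have "\<dots> \<le> ?s"
        using S by (intro SUP_upper) (auto intro: finite_imp_compact)
      finally show "of_nat (card S) \<le> ?s" .
    qed auto
    show "?s \<le> emeasure (dirac_sum \<omega>) B"
      using B by (intro SUP_least emeasure_mono) (auto simp: dirac_sum_def)
  qed
  moreover have "emeasure (dirac_sum \<omega>) C < \<infinity>" if "compact C" for C
    using * that by (subst emeasure_dirac_sum_finite_iff) (auto intro: borel_compact)
  ultimately show "\<omega> \<in> configurations"
    using * by (auto simp: configurations_def radon_measure_def dirac_sum_def)
qed

lemma configurations_empty: "{} \<in> configurations"
  by (simp add: configurations_iff)

lemma configurations_subset: "\<omega> \<in> configurations \<Longrightarrow> \<omega>' \<subseteq> \<omega> \<Longrightarrow> \<omega>' \<in> configurations"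
  by (auto simp: configurations_iff intro: countable_subset rev_finite_subset)

lemma configurations_union:
  "\<omega> \<in> configurations \<Longrightarrow> \<omega>' \<in> configurations \<Longrightarrow> \<omega> \<union> \<omega>' \<in> configurations"
  by (auto simp: configurations_iff Int_Un_distrib2)

lemma configurations_insert: "\<omega> \<in> configurations \<Longrightarrow> insert y \<omega> \<in> configurations"
  by (auto simp: configurations_iff Int_insert_left)

section \<open>Void events and the \<sigma>-algebra they generate\<close>

definition void :: "'a::metric_space set \<Rightarrow> 'a set set" where
  "void B = {\<omega>\<in>configurations. \<omega> \<inter> B = {}}"

lemma space_config_space: "space config_space = configurations"
  unfolding config_space_def by (subst space_measure_of) auto

lemma void_in_sets:
  assumes "B \<in> sets borel" shows "void B \<in> sets config_space"
proof -
  have "void B = {\<omega>\<in>configurations. emeasure (dirac_sum \<omega>) B \<in> {0}}"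
    using assms by (auto simp: void_def emeasure_dirac_sum emeasure_count_space_eq_0)
  then have "void B \<in> {{\<omega>\<in>configurations. emeasure (dirac_sum \<omega>) B \<in> A} | A B. A \<in> sets borel \<and> B \<in> sets borel}"
    using assms by (intro CollectI exI[of _ "{0}"] exI[of _ B]) simp
  then show ?thesis
    unfolding config_space_def by (subst sets_measure_of) auto
qed

text \<open>Sigma-compactness in increasing form. The sets supply regions of finite intensity that
  exhaust the space and, being totally bounded, countable nets at every scale.\<close>

locale compact_exhaustion =
  fixes A :: "nat \<Rightarrow> 'a::metric_space set"
  assumes A_compact: "compact (A n)"
    and A_incseq: "incseq A"
    and A_cover: "(\<Union>n. A n) = UNIV"
begin

lemma A_sets[measurable]: "A n \<in> sets borel"
  by (rule borel_compact[OF A_compact])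

lemma countable_net:
  assumes "0 < e"
  shows "\<exists>d::nat \<Rightarrow> 'a. (\<Union>i. ball (d i) e) = UNIV"
proof -
  have "\<exists>k. finite k \<and> k \<subseteq> A n \<and> A n \<subseteq> (\<Union>x\<in>k. ball x e)" for n
    using seq_compact_imp_totally_bounded[of "A n"] A_compact[of n] assms
    by (simp add: compact_eq_seq_compact_metric)
  then obtain k where k: "\<And>n. finite (k n)" "\<And>n. A n \<subseteq> (\<Union>x\<in>k n. ball x e)"
    by metis
  let ?D = "\<Union>n. k n"
  have cov: "(\<Union>x\<in>?D. ball x e) = UNIV"
  proof (intro set_eqI iffI UNIV_I)
    fix y :: 'a
    obtain n where "y \<in> A n" using A_cover by auto
    then show "y \<in> (\<Union>x\<in>?D. ball x e)" using k(2)[of n] by blast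
  qed
  have "countable ?D"
    by (intro countable_UN) (simp_all add: countable_finite k(1))
  moreover have "?D \<noteq> {}"
    using cov by (metis UN_empty UNIV_not_empty)
  ultimately have range: "range (from_nat_into ?D) = ?D"
    by (rule range_from_nat_into[rotated])
  have "(\<Union>i. ball (from_nat_into ?D i) e) = (\<Union>x\<in>range (from_nat_into ?D). ball x e)"
    by simp
  with cov have "(\<Union>i. ball (from_nat_into ?D i) e) = UNIV"
    unfolding range by simp
  then show ?thesis by blast
qed

text \<open>Balls of radius \<open>e/2\<close> have small diameter; disjointing them keeps the cells
  small and puts each point into exactly one of them.\<close>

lemma countable_small_partition:
  assumes "0 < e"
  shows "\<exists>c::nat \<Rightarrow> 'a set. (\<forall>i. c i \<in> sets borel) \<and> disjoint_family c \<and> (\<Union>i. c i) = UNIV \<and>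
    (\<forall>i. \<forall>x\<in>c i. \<forall>y\<in>c i. dist x y < e)"
proof -
  obtain d :: "nat \<Rightarrow> 'a" where d: "(\<Union>i. ball (d i) (e/2)) = UNIV"
    using countable_net[of "e/2"] assms by auto
  define c where "c = disjointed (\<lambda>i. ball (d i) (e/2))"
  have sub: "c i \<subseteq> ball (d i) (e/2)" for i
    unfolding c_def by (rule disjointed_subset)
  have "dist x y < e" if "x \<in> c i" "y \<in> c i" for i x y
  proof -
    have "dist (d i) x < e/2" "dist (d i) y < e/2"
      using subsetD[OF sub that(1)] subsetD[OF sub that(2)] by simp_all
    then show ?thesis
      by (metis dist_commute dist_triangle_half_r)
  qed
  moreover have "range c \<subseteq> sets borel"
    unfolding c_def by (rule sets.range_disjointed_sets) auto
  moreover have "disjoint_family c" "(\<Union>i. c i) = UNIV"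
    unfolding c_def by (auto simp: disjoint_family_disjointed UN_disjointed_eq d)
  ultimately show ?thesis by blast
qed

text \<open>Renyi's observation: counts are monotone limits of numbers of occupied cells, so the
  \<open>\<sigma>\<close>-algebra is already generated by the events that no point falls into \<open>B\<close>.\<close>

lemma sets_config_space_void:
  "sets config_space = sigma_sets configurations (void ` sets (borel :: 'a measure))"
proof
  let ?V = "sigma configurations (void ` sets (borel :: 'a measure))"
  have setsV: "sets ?V = sigma_sets configurations (void ` sets borel)"
    by (rule sets_measure_of) (auto simp: void_def)
  have spaceV: "space ?V = configurations"
    by (rule space_measure_of) (auto simp: void_def)
  show "sigma_sets configurations (void ` sets borel) \<subseteq> sets config_space"
    using void_in_sets sets.sigma_sets_subset[of "void ` sets borel" config_space]
    by (auto simp: space_config_space)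
  have "\<exists>c::nat \<Rightarrow> 'a set. (\<forall>i. c i \<in> sets borel) \<and> disjoint_family c \<and> (\<Union>i. c i) = UNIV \<and>
    (\<forall>i. \<forall>x\<in>c i. \<forall>y\<in>c i. dist x y < 1 / Suc n)" for n
    by (rule countable_small_partition) simp
  then obtain c :: "nat \<Rightarrow> nat \<Rightarrow> 'a set" where c: "\<And>n. (\<forall>i. c n i \<in> sets borel) \<and> disjoint_family (c n) \<and>
    (\<Union>i. c n i) = UNIV \<and> (\<forall>i. \<forall>x\<in>c n i. \<forall>y\<in>c n i. dist x y < 1 / Suc n)"
    by metis
  have c_sets: "\<And>n i. c n i \<in> sets borel" and c_disj: "\<And>n. disjoint_family (c n)"
    and c_cover: "\<And>n. (\<Union>i. c n i) = UNIV"
    and c_diam: "\<And>n i x y. x \<in> c n i \<Longrightarrow> y \<in> c n i \<Longrightarrow> dist x y < 1 / Suc n"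
    using c by simp_all
  have count_meas: "(\<lambda>\<omega>. emeasure (dirac_sum \<omega>) B) \<in> borel_measurable ?V"
    if B: "B \<in> sets borel" for B :: "'a set"
  proof -
    have hit[measurable]: "configurations - void (B \<inter> c n i) \<in> sets ?V" for n i
    proof -
      have "void (B \<inter> c n i) \<in> sets ?V"
        unfolding setsV using B c_sets by (intro sigma_sets.Basic imageI sets.Int)
      then show ?thesis
        using sets.compl_sets[of _ ?V] spaceV by metis
    qed
    \<comment> \<open>The partitions for different \<open>n\<close> are unrelated, so the number of
      occupied cells need not increase with \<open>n\<close>. The supremum is what counts: no level
      overcounts, and every finite set of points is separated by a fine enough level.\<close>
    have eq: "emeasure (dirac_sum \<omega>) B
        = (SUP n. \<Sum>i. indicator (configurations - void (B \<inter> c n i)) \<omega>)"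
      if \<omega>: "\<omega> \<in> configurations" for \<omega>
    proof -
      define f where "f n x = (THE i. x \<in> c n i)" for n x
      have f: "x \<in> c n i \<longleftrightarrow> f n x = i" for n x i
      proof -
        obtain j where j: "x \<in> c n j" using c_cover[of n] by (metis UNIV_I UN_E)
        have u: "k = j" if "x \<in> c n k" for k
        proof (rule ccontr)
          assume "k \<noteq> j"
          then have "c n k \<inter> c n j = {}"
            by (rule disjoint_family_onD[OF c_disj UNIV_I UNIV_I])
          with j that show False by (metis IntI empty_iff)
        qed
        have "f n x = j" unfolding f_def using j u by (rule the_equality)
        with j u show ?thesis by metis
      qed
      have "(\<Sum>i. indicator (configurations - void (B \<inter> c n i)) \<omega>)
          = emeasure (count_space UNIV) (f n ` (\<omega> \<inter> B))" for n
      proof -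
        have "indicator (configurations - void (B \<inter> c n i)) \<omega>
            = (indicator (f n ` (\<omega> \<inter> B)) i :: ennreal)" for i
          using \<omega> f by (auto simp: void_def indicator_def)
        then show ?thesis
          by (simp add: nn_integral_count_space_nat[symmetric])
      qed
      moreover have "emeasure (dirac_sum \<omega>) B = (SUP n. emeasure (count_space UNIV) (f n ` (\<omega> \<inter> B)))"
        unfolding emeasure_dirac_sum[OF B]
      proof (rule antisym)
        show "emeasure (count_space \<omega>) (\<omega> \<inter> B) \<le> (SUP n. emeasure (count_space UNIV) (f n ` (\<omega> \<inter> B)))"
        proof (rule emeasure_count_space_leI)
          fix S assume S: "finite S" "S \<subseteq> \<omega> \<inter> B"
          have "\<exists>n. inj_on (f n) S"
          proof -
            \<comment> \<open>The element 1 keeps the set of distances non-empty when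
              \<open>S\<close> has at most one point.\<close>
            let ?R = "insert 1 ((\<lambda>(x, y). dist x y) ` {p \<in> S \<times> S. fst p \<noteq> snd p})"
            have fin: "finite ?R" using S by auto
            have "0 < Min ?R" using fin by (subst Min_gr_iff) auto
            then obtain n where n: "1 / Suc n < Min ?R" by (rule nat_approx_posE)
            have "x = y" if "x \<in> S" "y \<in> S" "f n x = f n y" for x y
            proof (rule ccontr)
              assume "x \<noteq> y"
              then have "Min ?R \<le> dist x y" using fin that by (intro Min_le) (auto intro!: rev_image_eqI[of "(x, y)"])
              moreover have "dist x y < 1 / Suc n"
                using that f by (intro c_diam[of x n "f n x"]) auto
              ultimately show False using n by linarith
            qed
            then show ?thesis by (auto simp: inj_on_def)
          qed
          then obtain n where n: "inj_on (f n) S" ..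
          have "of_nat (card S) = (of_nat (card (f n ` S)) :: ennreal)"
            using n by (simp add: card_image)
          also have "\<dots> \<le> emeasure (count_space UNIV) (f n ` (\<omega> \<inter> B))"
            using S by (intro card_le_emeasure_count_space) auto
          also have "\<dots> \<le> (SUP n. emeasure (count_space UNIV) (f n ` (\<omega> \<inter> B)))"
            by (rule SUP_upper) simp
          finally show "of_nat (card S) \<le> (SUP n. emeasure (count_space UNIV) (f n ` (\<omega> \<inter> B)))" .
        qed simp
        show "(SUP n. emeasure (count_space UNIV) (f n ` (\<omega> \<inter> B))) \<le> emeasure (count_space \<omega>) (\<omega> \<inter> B)"
        proof (intro SUP_least emeasure_count_space_leI)
          fix n S assume "finite S" "S \<subseteq> f n ` (\<omega> \<inter> B)"
          then obtain T where "T \<subseteq> \<omega> \<inter> B" "finite T" "S = f n ` T"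
            by (meson finite_subset_image)
          then have "of_nat (card S) \<le> (of_nat (card T) :: ennreal)"
              "of_nat (card T) \<le> emeasure (count_space \<omega>) (\<omega> \<inter> B)"
            by (auto simp: card_image_le intro!: card_le_emeasure_count_space)
          then show "of_nat (card S) \<le> emeasure (count_space \<omega>) (\<omega> \<inter> B)"
            by (rule order_trans)
        qed simp
      qed
      ultimately show ?thesis by simp
    qed
    have "(\<lambda>\<omega>. SUP n. \<Sum>i. indicator (configurations - void (B \<inter> c n i)) \<omega> :: ennreal) \<in> borel_measurable ?V"
      by measurable
    then show ?thesis
      by (subst measurable_cong[OF eq]) (simp_all add: spaceV)
  qed
  have "{\<omega>\<in>configurations. emeasure (dirac_sum \<omega>) B \<in> D} \<in> sets ?V"
    if "D \<in> sets borel" "B \<in> sets borel" for D and B :: "'a set"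
    using measurable_sets[OF count_meas[OF that(2)] that(1)]
    by (simp add: spaceV vimage_def Int_def conj_commute)
  then have "sigma_sets (space ?V) {{\<omega>\<in>configurations. emeasure (dirac_sum \<omega>) B \<in> D} | D B. D \<in> sets borel \<and> B \<in> sets (borel :: 'a measure)} \<subseteq> sets ?V"
    by (intro sets.sigma_sets_subset) auto
  then show "sets config_space \<subseteq> sigma_sets configurations (void ` sets (borel :: 'a measure))"
    unfolding config_space_def spaceV setsV by (subst sets_measure_of) auto
qed

end

section \<open>Laws on the configuration space\<close>

lemma bounded_integrable:
  fixes f :: "'b \<Rightarrow> real"
  assumes "finite_measure M" "f \<in> borel_measurable M" "\<And>x. x \<in> space M \<Longrightarrow> \<bar>f x\<bar> \<le> c"
  shows "integrable M f"
proof -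
  interpret finite_measure M by fact
  show ?thesis using assms by (intro integrable_const_bound[of _ c]) auto
qed

lemma bounded_integral:
  fixes f :: "'b \<Rightarrow> real"
  assumes "prob_space M" "f \<in> borel_measurable M" "\<And>x. x \<in> space M \<Longrightarrow> \<bar>f x\<bar> \<le> c"
  shows "\<bar>\<integral>x. f x \<partial>M\<bar> \<le> c"
proof -
  interpret prob_space M by fact
  have i: "integrable M f" using assms by (intro bounded_integrable) (auto intro: finite_measure_axioms)
  have "\<bar>\<integral>x. f x \<partial>M\<bar> \<le> (\<integral>x. \<bar>f x\<bar> \<partial>M)" by (rule integral_abs_bound)
  also have "\<dots> \<le> (\<integral>x. c \<partial>M)" using i assms by (intro integral_mono) auto
  finally show ?thesis by (simp add: prob_space)
qed

section \<open>Measurable maps into the configurations, and laws determined by void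
  probabilities\<close>

context compact_exhaustion
begin

lemma measurable_config_spaceI:
  assumes "\<And>x. x \<in> space M \<Longrightarrow> f x \<in> configurations"
    and "\<And>B::'a set. B \<in> sets borel \<Longrightarrow> {x\<in>space M. f x \<inter> B = {}} \<in> sets M"
  shows "f \<in> measurable M config_space"
proof (rule measurable_sigma_sets[OF sets_config_space_void])
  show "void ` sets (borel :: 'a measure) \<subseteq> Pow configurations"
    by (auto simp: void_def)
  fix V assume "V \<in> void ` sets (borel :: 'a measure)"
  then obtain B :: "'a set" where B: "B \<in> sets borel" "V = void B" by auto
  have "f -` V \<inter> space M = {x\<in>space M. f x \<inter> B = {}}"
    using assms(1) by (auto simp: B void_def)
  then show "f -` V \<inter> space M \<in> sets M" using assms(2)[OF B(1)] by simp
qed (use assms in auto)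

lemma pred_void[measurable (raw)]:
  assumes f: "f \<in> measurable M config_space" and B: "(B :: 'a set) \<in> sets borel"
  shows "Measurable.pred M (\<lambda>x. f x \<inter> B = {})"
proof -
  have "f -` void B \<inter> space M = {x\<in>space M. f x \<inter> B = {}}"
    using measurable_space[OF f] by (auto simp: void_def space_config_space)
  then show ?thesis
    using measurable_sets[OF f void_in_sets[OF B]] by (simp add: pred_def)
qed

lemma measurable_union_config[measurable (raw)]:
  assumes f: "f \<in> measurable M config_space" and g: "g \<in> measurable M config_space"
  shows "(\<lambda>x. f x \<union> g x :: 'a set) \<in> measurable M config_space"
proof (rule measurable_config_spaceI)
  fix x assume "x \<in> space M"
  then show "f x \<union> g x \<in> configurations"
    using measurable_space[OF f] measurable_space[OF g]
    by (auto simp: space_config_space intro: configurations_union)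
next
  fix B :: "'a set" assume [measurable]: "B \<in> sets borel"
  note [measurable] = f g
  have "Measurable.pred M (\<lambda>x. f x \<inter> B = {} \<and> g x \<inter> B = {})" by measurable
  then show "{x\<in>space M. (f x \<union> g x) \<inter> B = {}} \<in> sets M"
    by (simp add: pred_def Int_Un_distrib2)
qed

lemma measurable_insert_config[measurable (raw)]:
  assumes f: "f \<in> measurable M config_space" and g: "g \<in> measurable M borel"
  shows "(\<lambda>x. insert (g x) (f x) :: 'a set) \<in> measurable M config_space"
proof (rule measurable_config_spaceI)
  fix x assume "x \<in> space M"
  then show "insert (g x) (f x) \<in> configurations"
    using measurable_space[OF f]
    by (auto simp: space_config_space intro: configurations_insert)
next
  fix B :: "'a set" assume [measurable]: "B \<in> sets borel"
  note [measurable] = f g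
  have "Measurable.pred M (\<lambda>x. f x \<inter> B = {} \<and> g x \<notin> B)" by measurable
  moreover have "insert (g x) (f x) \<inter> B = {} \<longleftrightarrow> f x \<inter> B = {} \<and> g x \<notin> B" for x by auto
  ultimately show "{x\<in>space M. insert (g x) (f x) \<inter> B = {}} \<in> sets M"
    by (simp add: pred_def)
qed

lemma measurable_diff_config:
  assumes A: "(D :: 'a set) \<in> sets borel"
  shows "(\<lambda>\<omega>. \<omega> - D) \<in> measurable config_space config_space"
proof (rule measurable_config_spaceI)
  fix x :: "'a set" assume "x \<in> space config_space"
  then show "x - D \<in> configurations"
    by (auto simp: space_config_space intro: configurations_subset)
next
  fix B :: "'a set" assume [measurable]: "B \<in> sets borel"
  note [measurable] = A
  have "Measurable.pred config_space (\<lambda>x. x \<inter> (B - D) = {})" by measurable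
  moreover have "x \<inter> (B - D) = {} \<longleftrightarrow> (x - D) \<inter> B = {}" for x by auto
  ultimately show "{x\<in>space config_space. (x - D) \<inter> B = {}} \<in> sets config_space"
    by (simp add: pred_def)
qed

text \<open>The Poisson law prescribes void probabilities where the intensity is finite, which is
  guaranteed inside some \<open>A n\<close>. Nothing is lost, since \<open>B\<close> is free of
  points exactly when every \<open>B \<inter> A n\<close> is.\<close>

lemma sets_config_bounded_void:
  "sets config_space = sigma_sets configurations (void ` {B. B \<in> sets borel \<and> (\<exists>n. B \<subseteq> A n)})"
    (is "_ = sigma_sets _ ?G")
proof
  have G: "?G \<subseteq> Pow configurations" by (auto simp: void_def)
  interpret sigma_algebra configurations "sigma_sets configurations ?G"
    by (rule sigma_algebra_sigma_sets[OF G])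
  have "void B \<in> sigma_sets configurations ?G" if B: "B \<in> sets borel" for B :: "'a set"
  proof -
    have "void B = (\<Inter>n. void (B \<inter> A n))"
    proof (intro set_eqI)
      fix \<omega> :: "'a set"
      have "(\<forall>n. \<omega> \<inter> (B \<inter> A n) = {}) \<longleftrightarrow> \<omega> \<inter> B \<inter> (\<Union>n. A n) = {}" by auto
      then show "\<omega> \<in> void B \<longleftrightarrow> \<omega> \<in> (\<Inter>n. void (B \<inter> A n))"
        by (simp add: A_cover void_def)
    qed
    moreover have "void (B \<inter> A n) \<in> sigma_sets configurations ?G" for n
      using B by (intro sigma_sets.Basic imageI) auto
    ultimately show ?thesis by auto
  qed
  then show "sets config_space \<subseteq> sigma_sets configurations ?G"
    unfolding sets_config_space_void by (intro sigma_sets_subset) auto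
  show "sigma_sets configurations ?G \<subseteq> sets config_space"
    unfolding space_config_space[symmetric]
    by (intro sets.sigma_sets_subset) (auto intro: void_in_sets)
qed

lemma void_int: "void (B::'a set) \<inter> void D = void (B \<union> D)"
  by (auto simp: void_def)

text \<open>Dynkin's pi-system argument:
  \<open>void B \<inter> void D = void (B \<union> D)\<close>, and since \<open>A\<close> increases,
  the union lies again in some \<open>A n\<close>. The whole space belongs to the generator as
  \<open>void {}\<close>.\<close>

lemma measure_eqI_void:
  assumes M: "prob_space M" "sets M = sets config_space"
    and N: "prob_space N" "sets N = sets config_space"
    and eq: "\<And>B n. B \<in> sets borel \<Longrightarrow> B \<subseteq> A n \<Longrightarrow> measure M (void B) = measure N (void B)"
  shows "M = N"
proof (rule measure_eqI_generator_eq)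
  let ?G = "void ` {B. B \<in> sets borel \<and> (\<exists>n. B \<subseteq> A n)}"
  interpret M: prob_space M by fact
  interpret N: prob_space N by fact
  show "Int_stable ?G"
  proof (rule Int_stableI)
    fix a b assume "a \<in> ?G" "b \<in> ?G"
    then obtain B D n m where *: "a = void B" "b = void D" "B \<in> sets borel" "D \<in> sets borel"
      "B \<subseteq> A n" "D \<subseteq> A m" by auto
    have "A n \<subseteq> A (max n m)" "A m \<subseteq> A (max n m)"
      by (intro incseqD[OF A_incseq]; simp)+
    with * have "B \<union> D \<subseteq> A (max n m)" by auto
    then show "a \<inter> b \<in> ?G"
      unfolding * void_int using * by (intro imageI CollectI) auto
  qed
  show "?G \<subseteq> Pow configurations" by (auto simp: void_def)
  show "sets M = sigma_sets configurations ?G" "sets N = sigma_sets configurations ?G"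
    using M N sets_config_bounded_void by simp_all
  show "range (\<lambda>_::nat. configurations) \<subseteq> ?G"
    by (auto simp: void_def intro!: image_eqI[of _ _ "{}"])
  show "emeasure M X = emeasure N X" if "X \<in> ?G" for X
    using that eq by (auto simp: M.emeasure_eq_measure N.emeasure_eq_measure)
qed (use assms in \<open>auto simp: prob_space.emeasure_space_1 prob_space_def finite_measure.emeasure_finite\<close>)

text \<open>Couplings of \<open>P\<close> with itself whose two components agree on larger and larger compact sets
  converge to the diagonal coupling.\<close>

lemma coupling_L1_limit:
  fixes R :: "nat \<Rightarrow> ('a set \<times> 'a set) measure" and G :: "'a set \<Rightarrow> real"
  assumes P: "prob_space P" "sets P = sets config_space"
    and sets_R: "\<And>n. sets (R n) = sets (config_space \<Otimes>\<^sub>M config_space)"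
    and fst: "\<And>n. distr (R n) config_space fst = P"
    and snd: "\<And>n. distr (R n) config_space snd = P"
    and agree: "\<And>m n B. m \<le> n \<Longrightarrow> B \<in> sets borel \<Longrightarrow> B \<subseteq> A m \<Longrightarrow> AE p in R n. fst p \<in> void B \<longleftrightarrow> snd p \<in> void B"
    and G: "G \<in> borel_measurable P" "\<And>\<omega>. 0 \<le> G \<omega>" "integrable P G"
  shows "(\<lambda>n. \<integral>p. \<bar>G (fst p) - G (snd p)\<bar> \<partial>R n) \<longlonglongrightarrow> 0"
proof -
  interpret P: prob_space P by fact
  note [measurable_cong] = sets_R P(2)
  have mfst[measurable]: "fst \<in> measurable (R n) config_space" "snd \<in> measurable (R n) config_space" for n
    by measurable
  have mP[measurable]: "measurable P N = measurable config_space N" for N :: "real measure"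
    by (rule measurable_cong_sets) (use P in auto)
  have prob_R: "prob_space (R n)" for n
    by (rule prob_space_distrD[of fst _ config_space]) (auto simp: fst P)
  have int_fst: "integrable (R n) (\<lambda>p. f (fst p)) \<longleftrightarrow> integrable P f"
    if "f \<in> borel_measurable P" for f :: "'a set \<Rightarrow> real" and n
    using that by (subst fst[of n, symmetric], subst integrable_distr_eq) (auto simp: mP)
  have int_snd: "integrable (R n) (\<lambda>p. f (snd p)) \<longleftrightarrow> integrable P f"
    if "f \<in> borel_measurable P" for f :: "'a set \<Rightarrow> real" and n
    using that by (subst snd[of n, symmetric], subst integrable_distr_eq) (auto simp: mP)
  have E_fst: "(\<integral>p. f (fst p) \<partial>R n) = (\<integral>\<omega>. f \<omega> \<partial>P)"
    if "f \<in> borel_measurable P" for f :: "'a set \<Rightarrow> real" and n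
    using that by (subst fst[of n, symmetric], subst integral_distr) (auto simp: mP)
  have E_snd: "(\<integral>p. f (snd p) \<partial>R n) = (\<integral>\<omega>. f \<omega> \<partial>P)"
    if "f \<in> borel_measurable P" for f :: "'a set \<Rightarrow> real" and n
    using that by (subst snd[of n, symmetric], subst integral_distr) (auto simp: mP)
  define d where "d n f = (\<integral>p. \<bar>f (fst p) - f (snd p)\<bar> \<partial>R n)" for n and f :: "'a set \<Rightarrow> real"
  have d_nonneg: "0 \<le> d n f" for n f unfolding d_def by simp
  have int_d: "integrable (R n) (\<lambda>p. \<bar>f (fst p) - f (snd p)\<bar>)"
    if "integrable P f" for n and f :: "'a set \<Rightarrow> real"
    using int_fst[of f n] int_snd[of f n] that by auto
  \<comment> \<open>Both marginals of \<open>R n\<close> are \<open>P\<close>, so replacing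
    \<open>f\<close> by \<open>g\<close> costs the \<open>P\<close>-distance once for each
    coordinate, whatever \<open>n\<close> is. This uniformity makes the class of functions with the
    claimed limit closed in L1.\<close>
  have d_tri: "d n f \<le> d n g + 2 * (\<integral>\<omega>. \<bar>f \<omega> - g \<omega>\<bar> \<partial>P)"
    if f: "integrable P f" and g: "integrable P g" for n and f g :: "'a set \<Rightarrow> real"
  proof -
    have fg: "integrable P (\<lambda>\<omega>. \<bar>f \<omega> - g \<omega>\<bar>)" using f g by auto
    have i1: "integrable (R n) (\<lambda>p. \<bar>f (fst p) - g (fst p)\<bar>)"
      using int_fst[of "\<lambda>\<omega>. \<bar>f \<omega> - g \<omega>\<bar>" n] fg by auto
    have i2: "integrable (R n) (\<lambda>p. \<bar>f (snd p) - g (snd p)\<bar>)"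
      using int_snd[of "\<lambda>\<omega>. \<bar>f \<omega> - g \<omega>\<bar>" n] fg by auto
    have "d n f \<le> (\<integral>p. \<bar>g (fst p) - g (snd p)\<bar> + (\<bar>f (fst p) - g (fst p)\<bar> + \<bar>f (snd p) - g (snd p)\<bar>) \<partial>R n)"
      unfolding d_def
    proof (rule integral_mono)
      show "integrable (R n) (\<lambda>p. \<bar>g (fst p) - g (snd p)\<bar> + (\<bar>f (fst p) - g (fst p)\<bar> + \<bar>f (snd p) - g (snd p)\<bar>))"
        by (rule Bochner_Integration.integrable_add[OF int_d[OF g] Bochner_Integration.integrable_add[OF i1 i2]])
    qed (use int_d[OF f] in auto)
    also have "\<dots> = d n g + ((\<integral>p. \<bar>f (fst p) - g (fst p)\<bar> \<partial>R n) + (\<integral>p. \<bar>f (snd p) - g (snd p)\<bar> \<partial>R n))"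
      unfolding d_def using int_d[OF g] i1 i2 by simp
    also have "(\<integral>p. \<bar>f (fst p) - g (fst p)\<bar> \<partial>R n) = (\<integral>\<omega>. \<bar>f \<omega> - g \<omega>\<bar> \<partial>P)"
      using E_fst[of "\<lambda>\<omega>. \<bar>f \<omega> - g \<omega>\<bar>" n] fg by auto
    also have "(\<integral>p. \<bar>f (snd p) - g (snd p)\<bar> \<partial>R n) = (\<integral>\<omega>. \<bar>f \<omega> - g \<omega>\<bar> \<partial>P)"
      using E_snd[of "\<lambda>\<omega>. \<bar>f \<omega> - g \<omega>\<bar>" n] fg by auto
    finally show ?thesis by simp
  qed
  have approx: "(\<lambda>n. d n f) \<longlonglongrightarrow> 0"
    if f: "integrable P f" and g: "\<And>i::nat. integrable P (g i)" "\<And>i. (\<lambda>n. d n (g i)) \<longlonglongrightarrow> 0"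
      and lim: "(\<lambda>i. \<integral>\<omega>. \<bar>f \<omega> - g i \<omega>\<bar> \<partial>P) \<longlonglongrightarrow> 0" for f and g :: "nat \<Rightarrow> 'a set \<Rightarrow> real"
  proof (rule LIMSEQ_I)
    fix e :: real assume e: "0 < e"
    obtain i where i: "\<bar>\<integral>\<omega>. \<bar>f \<omega> - g i \<omega>\<bar> \<partial>P\<bar> < e/4"
      using LIMSEQ_D[OF lim, of "e/4"] e by auto
    obtain N where N: "\<And>n. n \<ge> N \<Longrightarrow> \<bar>d n (g i)\<bar> < e/2"
      using LIMSEQ_D[OF g(2)[of i], of "e/2"] e by auto
    have "norm (d n f - 0) < e" if "n \<ge> N" for n
      using d_tri[OF f g(1)[of i], of n] N[OF that] i d_nonneg[of n f] by simp
    then show "\<exists>N. \<forall>n\<ge>N. norm (d n f - 0) < e" by blast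
  qed
  have ii: "integrable P (indicator E :: _ \<Rightarrow> real)" if "E \<in> sets config_space" for E
    using that P(2) by (intro P.integrable_const_bound[of _ 1]) auto
  have ind: "(\<lambda>n. d n (indicator E)) \<longlonglongrightarrow> 0" if "E \<in> sets config_space" for E
    using that unfolding sets_config_bounded_void
  proof induction
    case (Basic E)
    then obtain B m where B: "B \<in> sets borel" "B \<subseteq> A m" "E = void B" by auto
    have "d n (indicator E) = 0" if "n \<ge> m" for n
    proof -
      have "d n (indicator E) = (\<integral>p. 0 \<partial>R n)"
        unfolding d_def
      proof (rule integral_cong_AE)
        show "AE p in R n. \<bar>indicator E (fst p) - indicator E (snd p) :: real\<bar> = 0"
          using agree[OF that B(1,2)] by eventually_elim (auto simp: B(3) indicator_def)
        show "(\<lambda>p. \<bar>indicator E (fst p) - indicator E (snd p) :: real\<bar>) \<in> borel_measurable (R n)"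
          using void_in_sets[OF B(1)] unfolding B(3) by measurable
      qed simp
      then show ?thesis by simp
    qed
    then show ?case
      by (intro tendsto_eventually) (auto simp: eventually_sequentially)
  next
    case Empty
    then show ?case by (simp add: d_def)
  next
    case (Compl E)
    have "d n (indicator (configurations - E)) = d n (indicator E)" for n
      unfolding d_def
    proof (rule Bochner_Integration.integral_cong)
      fix p assume "p \<in> space (R n)"
      then have "fst p \<in> configurations" "snd p \<in> configurations"
        unfolding sets_eq_imp_space_eq[OF sets_R[of n]] space_pair_measure space_config_space
        by (simp_all add: mem_Times_iff)
      then show "\<bar>indicator (configurations - E) (fst p) - indicator (configurations - E) (snd p)\<bar>
          = \<bar>indicator E (fst p) - indicator E (snd p) :: real\<bar>"
        by (auto simp: indicator_def)
    qed simp
    with Compl show ?case by simp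
  next
    case (Union E)
    have E[measurable]: "E i \<in> sets config_space" for i
      using Union(1) unfolding sets_config_bounded_void .
    let ?U = "\<lambda>N. \<Union>i<N. E i"
    \<comment> \<open>\<open>sigma_sets\<close> gives no disjointness, so finite unions are treated
      by subadditivity before the countable union is reached as an L1 limit.\<close>
    have fin: "(\<lambda>n. d n (indicator (?U N))) \<longlonglongrightarrow> 0" for N
    proof (induction N)
      case 0
      then show ?case by (simp add: d_def)
    next
      case (Suc N)
      have iU: "integrable P (indicator (?U N) :: _ \<Rightarrow> real)" for N by (rule ii) measurable
      have iE: "integrable P (indicator (E N) :: _ \<Rightarrow> real)" by (rule ii) measurable
      have le: "d n (indicator (?U (Suc N))) \<le> d n (indicator (?U N)) + d n (indicator (E N))" for n
      proof -
        have "d n (indicator (?U (Suc N))) \<le>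
            (\<integral>p. \<bar>indicator (?U N) (fst p) - indicator (?U N) (snd p)\<bar>
              + \<bar>indicator (E N) (fst p) - indicator (E N) (snd p)\<bar> \<partial>R n)"
          unfolding d_def
        proof (rule integral_mono)
          show "integrable (R n) (\<lambda>p. \<bar>indicator (?U N) (fst p) - indicator (?U N) (snd p)\<bar>
              + \<bar>indicator (E N) (fst p) - indicator (E N) (snd p) :: real\<bar>)"
            by (rule Bochner_Integration.integrable_add[OF int_d[OF iU] int_d[OF iE]])
          show "\<bar>indicator (?U (Suc N)) (fst p) - indicator (?U (Suc N)) (snd p)\<bar>
            \<le> \<bar>indicator (?U N) (fst p) - indicator (?U N) (snd p)\<bar>
              + \<bar>indicator (E N) (fst p) - indicator (E N) (snd p) :: real\<bar>" for p
          proof -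
            have "indicator (?U (Suc N)) q = (if q \<in> E N then 1 else indicator (?U N) q :: real)" for q
              by (simp add: lessThan_Suc indicator_def)
            then show ?thesis by (simp add: indicator_def)
          qed
        qed (rule int_d[OF iU])
        also have "\<dots> = d n (indicator (?U N)) + d n (indicator (E N))"
          unfolding d_def
          by (rule Bochner_Integration.integral_add[OF int_d[OF iU] int_d[OF iE]])
        finally show ?thesis .
      qed
      have "(\<lambda>n. d n (indicator (?U N)) + d n (indicator (E N))) \<longlonglongrightarrow> 0 + 0"
        by (rule tendsto_add[OF Suc Union(2)])
      then have lim: "(\<lambda>n. d n (indicator (?U N)) + d n (indicator (E N))) \<longlonglongrightarrow> 0" by simp
      show ?case
        by (rule tendsto_sandwich[OF _ _ tendsto_const[of 0] lim]) (simp_all add: d_nonneg le)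
    qed
    show ?case
    proof (rule approx[OF _ _ fin])
      let ?E = "\<Union>i. E i"
      show "integrable P (indicator ?E :: _ \<Rightarrow> real)" "integrable P (indicator (?U i) :: _ \<Rightarrow> real)" for i
        by (rule ii, measurable)+
      have "(\<lambda>i. \<integral>\<omega>. \<bar>indicator ?E \<omega> - indicator (?U i) \<omega> :: real\<bar> \<partial>P) \<longlonglongrightarrow> (\<integral>\<omega>. 0 \<partial>P)"
      proof (rule integral_dominated_convergence[where w="\<lambda>_. 1"])
        show "AE \<omega> in P. (\<lambda>i. \<bar>indicator ?E \<omega> - indicator (?U i) \<omega> :: real\<bar>) \<longlonglongrightarrow> 0"
        proof (intro AE_I2)
          fix \<omega>
          show "(\<lambda>i. \<bar>indicator ?E \<omega> - indicator (?U i) \<omega> :: real\<bar>) \<longlonglongrightarrow> 0"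
          proof (cases "\<omega> \<in> ?E")
            case True
            then obtain j where "\<omega> \<in> E j" by auto
            then have "\<bar>indicator ?E \<omega> - indicator (?U i) \<omega> :: real\<bar> = 0" if "i \<ge> Suc j" for i
              using that by (auto simp: indicator_def)
            then show ?thesis
              by (intro tendsto_eventually) (auto simp only: eventually_sequentially)
          next
            case False
            then have "\<omega> \<notin> ?U i" for i by auto
            with False show ?thesis by (simp add: indicator_def)
          qed
        qed
      qed (auto simp: indicator_def)
      then show "(\<lambda>i. \<integral>\<omega>. \<bar>indicator ?E \<omega> - indicator (?U i) \<omega> :: real\<bar> \<partial>P) \<longlonglongrightarrow> 0" by simp
    qed
  qed
  \<comment> \<open>Integrability sits inside the induction claim: it is known for the final
    \<open>G\<close>, and the non-negative pieces inherit it by domination.\<close>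
  have "integrable P G \<longrightarrow> (\<lambda>n. d n G) \<longlonglongrightarrow> 0"
    using G(1,2)
  proof (induction rule: borel_measurable_induct_real)
    case (set E)
    then show ?case using ind P by auto
  next
    case (mult u c)
    have "d n (\<lambda>x. c * u x) = c * d n u" for n
      using \<open>0 \<le> c\<close> by (simp add: d_def right_diff_distrib[symmetric] abs_mult)
    moreover have "integrable P u" if "c \<noteq> 0" "integrable P (\<lambda>x. c * u x)"
      using that by simp
    ultimately show ?case
      using mult tendsto_mult_left[of "\<lambda>n. d n u" 0 sequentially c] by (cases "c = 0") auto
  next
    case (add u v)
    show ?case
    proof
      assume uv: "integrable P (\<lambda>x. v x + u x)"
      have u: "integrable P u"
        by (rule Bochner_Integration.integrable_bound[OF uv]) (use add in \<open>auto simp: add_increasing\<close>)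
      have v: "integrable P v"
        by (rule Bochner_Integration.integrable_bound[OF uv]) (use add in \<open>auto simp: add_increasing2\<close>)
      have le: "d n (\<lambda>x. v x + u x) \<le> d n v + d n u" for n
      proof -
        have "d n (\<lambda>x. v x + u x) \<le> (\<integral>p. \<bar>v (fst p) - v (snd p)\<bar> + \<bar>u (fst p) - u (snd p)\<bar> \<partial>R n)"
          unfolding d_def
        proof (rule integral_mono)
          show "integrable (R n) (\<lambda>p. \<bar>v (fst p) - v (snd p)\<bar> + \<bar>u (fst p) - u (snd p)\<bar>)"
            by (rule Bochner_Integration.integrable_add[OF int_d[OF v] int_d[OF u]])
        qed (use int_d[OF uv] in auto)
        also have "\<dots> = d n v + d n u"
          unfolding d_def by (intro Bochner_Integration.integral_add int_d u v)
        finally show ?thesis .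
      qed
      have "(\<lambda>n. d n v + d n u) \<longlonglongrightarrow> 0 + 0"
        using add u v by (intro tendsto_add) auto
      then have lim: "(\<lambda>n. d n v + d n u) \<longlonglongrightarrow> 0" by simp
      show "(\<lambda>n. d n (\<lambda>x. v x + u x)) \<longlonglongrightarrow> 0"
        by (rule tendsto_sandwich[OF _ _ tendsto_const[of 0] lim]) (simp_all add: d_nonneg le)
    qed
  next
    case (seq U)
    show ?case
    proof
      assume G_int: "integrable P G"
      have U_le: "U i x \<le> G x" if "x \<in> space P" for i x
        using seq(3) seq(4)[OF that] by (intro incseq_le) (auto simp: incseq_def le_fun_def)
      have U_int: "integrable P (U i)" for i
        by (rule Bochner_Integration.integrable_bound[OF G_int])
          (use seq(1,2) G(2) U_le in \<open>auto\<close>)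
      have "(\<lambda>i. \<integral>\<omega>. \<bar>G \<omega> - U i \<omega>\<bar> \<partial>P) \<longlonglongrightarrow> (\<integral>\<omega>. 0 \<partial>P)"
      proof (rule integral_dominated_convergence[where w=G])
        show "AE x in P. (\<lambda>i. \<bar>G x - U i x\<bar>) \<longlonglongrightarrow> 0"
        proof (rule AE_I2)
          fix x assume "x \<in> space P"
          from tendsto_diff[OF tendsto_const[of "G x"] seq(4)[OF this]]
          show "(\<lambda>i. \<bar>G x - U i x\<bar>) \<longlonglongrightarrow> 0"
            by (intro tendsto_rabs_zero) simp
        qed
        show "AE x in P. norm \<bar>G x - U i x\<bar> \<le> G x" for i
          using U_le seq(2) by (intro AE_I2) (auto simp: abs_le_iff add_increasing)
      qed (use G_int U_int in \<open>auto\<close>)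
      then show "(\<lambda>n. d n G) \<longlonglongrightarrow> 0"
        using seq(5) U_int G_int by (intro approx[of G U]) auto
    qed
  qed
  then show ?thesis using G(3) by (simp add: d_def)
qed

end

section \<open>Poisson averages\<close>

text \<open>The bound is required off the space of \<open>M\<close> as well.\<close>

definition bmeas :: "'b measure \<Rightarrow> ('b \<Rightarrow> real) \<Rightarrow> bool" where
  "bmeas M f \<longleftrightarrow> f \<in> borel_measurable M \<and> (\<exists>c. \<forall>x. \<bar>f x\<bar> \<le> c)"

lemma bmeasI: "f \<in> borel_measurable M \<Longrightarrow> (\<And>x. \<bar>f x\<bar> \<le> c) \<Longrightarrow> bmeas M f"
  by (auto simp: bmeas_def)

lemma bmeas_measurable[measurable_dest]: "bmeas M f \<Longrightarrow> f \<in> borel_measurable M"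
  by (simp add: bmeas_def)

lemma bmeasE:
  assumes "bmeas M f" obtains c where "0 \<le> c" "\<And>x. \<bar>f x\<bar> \<le> c"
proof -
  obtain c where c: "\<forall>x. \<bar>f x\<bar> \<le> c" using assms unfolding bmeas_def by metis
  then have c: "\<bar>f x\<bar> \<le> c" for x by simp
  have "0 \<le> c"
    by (rule order_trans[OF abs_ge_zero c])
  from this c show ?thesis by (rule that)
qed

lemma bmeas_cong_sets: "sets M = sets N \<Longrightarrow> bmeas M f \<longleftrightarrow> bmeas N f"
  using measurable_cong_sets[of M N borel "borel :: real measure"] by (simp add: bmeas_def)

lemma bmeas_integrable: "prob_space M \<Longrightarrow> bmeas M f \<Longrightarrow> integrable M f"
  by (auto simp: bmeas_def prob_space_def intro: bounded_integrable)

lemma bmeas_add: "bmeas M f \<Longrightarrow> bmeas M g \<Longrightarrow> bmeas M (\<lambda>x. f x + g x)"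
proof -
  assume f: "bmeas M f" and g: "bmeas M g"
  obtain c where c: "\<And>x. \<bar>f x\<bar> \<le> c" using f by (rule bmeasE) blast
  obtain d where d: "\<And>x. \<bar>g x\<bar> \<le> d" using g by (rule bmeasE) blast
  have "\<bar>f x + g x\<bar> \<le> c + d" for x
    using c[of x] d[of x] by linarith
  then show ?thesis
    using f g by (intro bmeasI[of _ _ "c + d"]) (auto simp: bmeas_def)
qed

lemma bmeas_mult: "bmeas M f \<Longrightarrow> bmeas M g \<Longrightarrow> bmeas M (\<lambda>x. f x * g x)"
proof -
  assume f: "bmeas M f" and g: "bmeas M g"
  obtain c where c: "0 \<le> c" "\<And>x. \<bar>f x\<bar> \<le> c" using f by (rule bmeasE) blast
  obtain d where d: "\<And>x. \<bar>g x\<bar> \<le> d" using g by (rule bmeasE) blast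
  have "\<bar>f x * g x\<bar> \<le> c * d" for x
    unfolding abs_mult using c d by (intro mult_mono) auto
  then show ?thesis
    using f g by (intro bmeasI[of _ _ "c * d"]) (auto simp: bmeas_def)
qed

lemma bmeas_const: "bmeas M (\<lambda>x. c)"
  by (rule bmeasI) auto

lemma bmeas_diff: "bmeas M f \<Longrightarrow> bmeas M g \<Longrightarrow> bmeas M (\<lambda>x. f x - g x)"
  using bmeas_add[of M f "\<lambda>x. (-1) * g x"] bmeas_mult[OF bmeas_const[of M "-1"]] by simp

lemma bmeas_compose: "bmeas N f \<Longrightarrow> g \<in> measurable M N \<Longrightarrow> bmeas M (\<lambda>x. f (g x))"
  by (auto simp: bmeas_def)

lemma bmeas_integral:
  assumes "prob_space N" "bmeas (M \<Otimes>\<^sub>M N) (\<lambda>p. f (fst p) (snd p))"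
  shows "bmeas M (\<lambda>x. \<integral>y. f x y \<partial>N)"
proof -
  interpret N: prob_space N by fact
  have [measurable]: "case_prod f \<in> borel_measurable (M \<Otimes>\<^sub>M N)"
    using bmeas_measurable[OF assms(2)] by (simp add: case_prod_beta')
  obtain c where c: "0 \<le> c" "\<And>p. \<bar>f (fst p) (snd p)\<bar> \<le> c" using assms(2) by (rule bmeasE) blast
  have c': "\<bar>f x y\<bar> \<le> c" for x y using c(2)[of "(x, y)"] by simp
  have "\<bar>\<integral>y. f x y \<partial>N\<bar> \<le> c" for x
  proof (cases "f x \<in> borel_measurable N")
    case True
    then show ?thesis using c' by (intro bounded_integral assms)
  next
    \<comment> \<open>Outside the space of \<open>M\<close> the section \<open>f x\<close> may fail
      to be measurable; its Bochner integral is then 0, which respects the bound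
      \<open>c\<close>.\<close>
    case False
    then have "\<not> integrable N (f x)" by (auto dest: borel_measurable_integrable)
    then show ?thesis using c by (simp add: not_integrable_integral_eq)
  qed
  then show ?thesis by (intro bmeasI) measurable
qed

lemma bmeas_Fubini:
  assumes "prob_space M" "prob_space N" "bmeas (M \<Otimes>\<^sub>M N) f"
  shows bmeas_integral_fst: "(\<integral>p. f p \<partial>(M \<Otimes>\<^sub>M N)) = (\<integral>x. \<integral>y. f (x, y) \<partial>N \<partial>M)"
    and bmeas_integral_snd: "(\<integral>p. f p \<partial>(M \<Otimes>\<^sub>M N)) = (\<integral>y. \<integral>x. f (x, y) \<partial>M \<partial>N)"
proof -
  interpret M: prob_space M by fact
  interpret N: prob_space N by fact
  interpret MN: pair_prob_space M N ..
  have i: "integrable (M \<Otimes>\<^sub>M N) f"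
    using assms(3) by (rule bmeas_integrable[rotated]) unfold_locales
  show "(\<integral>p. f p \<partial>(M \<Otimes>\<^sub>M N)) = (\<integral>x. \<integral>y. f (x, y) \<partial>N \<partial>M)"
    using MN.integral_fst'[OF i] by simp
  show "(\<integral>p. f p \<partial>(M \<Otimes>\<^sub>M N)) = (\<integral>y. \<integral>x. f (x, y) \<partial>M \<partial>N)"
    using MN.integral_snd[of "\<lambda>x y. f (x, y)"] i by (simp add: case_prod_beta')
qed

lemma prob_pair: "prob_space M \<Longrightarrow> prob_space N \<Longrightarrow> prob_space (M \<Otimes>\<^sub>M N)"
proof -
  assume "prob_space M" "prob_space N"
  then interpret M: prob_space M + N: prob_space N by auto
  interpret MN: pair_prob_space M N ..
  show ?thesis by unfold_locales
qed

section \<open>Poisson weights and the derivative of a Poisson average in its rate\<close>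

definition pois_weight :: "real \<Rightarrow> nat \<Rightarrow> real" where
  "pois_weight s k = exp (- s) * s ^ k / fact k"

lemma pois_weight_nonneg: "0 \<le> s \<Longrightarrow> 0 \<le> pois_weight s k"
  by (simp add: pois_weight_def)

text \<open>The probability generating function of the Poisson law. With \<open>z\<close> the chance
  that a single point misses a set, it produces the void probabilities.\<close>

lemma pois_weight_power_sums: "(\<lambda>k. pois_weight s k * z ^ k) sums exp (s * (z - 1))"
proof -
  have "(\<lambda>k. exp (- s) * ((s * z) ^ k /\<^sub>R fact k)) sums (exp (- s) * exp (s * z))"
    by (intro sums_mult exp_converges)
  moreover have "exp (- s) * exp (s * z) = exp (s * (z - 1))"
    by (simp add: exp_add[symmetric] algebra_simps)
  ultimately show ?thesis
    by (simp add: pois_weight_def power_mult_distrib field_simps)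
qed

lemma pois_weight_sums: "pois_weight s sums 1"
  using pois_weight_power_sums[of s 1] by simp

lemma pois_weight_le: "0 \<le> s \<Longrightarrow> s \<le> c \<Longrightarrow> pois_weight s k \<le> c ^ k / fact k"
proof -
  assume s: "0 \<le> s" "s \<le> c"
  have "exp (- s) * s ^ k \<le> 1 * c ^ k"
    using s by (intro mult_mono power_mono) auto
  then show ?thesis by (simp add: pois_weight_def divide_right_mono)
qed

lemma pois_weight_deriv:
  "((\<lambda>s. pois_weight s k) has_real_derivative ((if k = 0 then 0 else pois_weight s (k - 1)) - pois_weight s k)) (at s)"
proof (cases k)
  case 0
  then show ?thesis unfolding pois_weight_def by (auto intro!: derivative_eq_intros)
next
  case (Suc n)
  have "((\<lambda>s. pois_weight s k) has_real_derivative
      (exp (- s) * (Suc n * s ^ n) - exp (- s) * s ^ Suc n) / fact (Suc n)) (at s)"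
    unfolding pois_weight_def Suc
    by (auto intro!: derivative_eq_intros) (cases n; simp add: algebra_simps)
  moreover have "exp (- s) * (Suc n * s ^ n) / fact (Suc n) = exp (- s) * s ^ n / fact n"
    by (simp add: fact_Suc del: of_nat_Suc)
  ultimately show ?thesis
    by (simp add: Suc pois_weight_def diff_divide_distrib del: fact_Suc)
qed

text \<open>The Poisson weights satisfy \<open>d/ds w\<^sub>k = w\<^sub>k\<^sub>-\<^sub>1 - w\<^sub>k\<close>, so differentiating a Poisson
  average shifts the index of the averaged sequence.\<close>

lemma poisson_average_deriv:
  fixes g g' :: "nat \<Rightarrow> real \<Rightarrow> real" and s :: "real \<Rightarrow> real"
  assumes s: "\<And>u. s u = a + b * u" and s_range: "\<And>u. u \<in> {0..1} \<Longrightarrow> 0 \<le> s u"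
    and g: "\<And>k u. u \<in> {0..1} \<Longrightarrow> \<bar>g k u\<bar> \<le> M"
    and g': "\<And>k u. u \<in> {0..1} \<Longrightarrow> \<bar>g' k u\<bar> \<le> M'"
    and deriv: "\<And>k u. u \<in> {0..1} \<Longrightarrow> (g k has_real_derivative g' k u) (at u within {0..1})"
    and u: "u \<in> {0..1}"
  shows "((\<lambda>u. \<Sum>k. pois_weight (s u) k * g k u) has_real_derivative
      (\<Sum>k. pois_weight (s u) k * (b * (g (Suc k) u - g k u) + g' k u))) (at u within {0..1})"
proof -
  \<comment> \<open>\<open>c\<close> bounds the rate \<open>s u\<close> throughout [0, 1], so
    \<open>c ^ k / fact k\<close> majorises all weights at once. The M-test needs a summable
    majorant independent of \<open>u\<close>.\<close>
  define c where "c = \<bar>a\<bar> + \<bar>b\<bar>"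
  have sc: "s u \<le> c" if "u \<in> {0..1}" for u
  proof -
    have "b * u \<le> \<bar>b\<bar> * u" using that by (intro mult_right_mono) auto
    also have "\<dots> \<le> \<bar>b\<bar> * 1" using that by (intro mult_left_mono) auto
    finally show ?thesis by (simp add: s c_def)
  qed
  have M: "0 \<le> M" "0 \<le> M'" using g[of 0 0] g'[of 0 0] by auto
  have c0: "0 \<le> c" by (simp add: c_def)
  define sh where "sh u k = (if k = 0 then 0 else pois_weight (s u) (k - 1))" for u k
  define f where "f k u = pois_weight (s u) k * g k u" for k u
  define f' where "f' k u = b * (sh u k - pois_weight (s u) k) * g k u + pois_weight (s u) k * g' k u" for k u
  define shc where "shc k = (if k = 0 then 0 else c ^ (k - 1) / fact (k - 1))" for k :: nat
  define B where "B k = \<bar>b\<bar> * (shc k + c ^ k / fact k) * M + c ^ k / fact k * M'" for k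
  have sh_le: "\<bar>sh u k\<bar> \<le> shc k" and pw_abs: "\<bar>pois_weight (s u) k\<bar> \<le> c ^ k / fact k" if "u \<in> {0..1}" for u k
    using pois_weight_le[OF s_range sc, OF that that] pois_weight_nonneg[OF s_range, OF that] c0
    by (simp_all add: sh_def shc_def)
  have exp_summable: "summable (\<lambda>k. c ^ k / fact k)"
    using summable_exp[of c] by (simp add: field_simps)
  have shc_summable: "summable shc"
    by (subst summable_Suc_iff[symmetric]) (simp add: shc_def exp_summable)
  have B_summable: "summable B"
    unfolding B_def by (intro summable_add summable_mult2 summable_mult exp_summable shc_summable)
  have f_deriv: "(f k has_real_derivative f' k u) (at u within {0..1})" if "u \<in> {0..1}" for k u
  proof -
    have "((\<lambda>u. pois_weight (s u) k) has_real_derivative ((if k = 0 then 0 else pois_weight (s u) (k - 1)) - pois_weight (s u) k) * b) (at u within {0..1})"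
    proof (rule DERIV_chain2[OF pois_weight_deriv])
      show "(s has_real_derivative b) (at u within {0..1})"
        unfolding s[abs_def] by (auto intro!: derivative_eq_intros)
    qed
    from DERIV_mult[OF this deriv[OF that, of k]]
    show ?thesis unfolding f_def f'_def sh_def by (simp add: algebra_simps)
  qed
  have f'_le: "norm (f' k u) \<le> B k" if "u \<in> {0..1}" for k u
  proof -
    have "\<bar>f' k u\<bar> \<le> \<bar>b\<bar> * (\<bar>sh u k\<bar> + \<bar>pois_weight (s u) k\<bar>) * \<bar>g k u\<bar> + \<bar>pois_weight (s u) k\<bar> * \<bar>g' k u\<bar>"
      unfolding f'_def
      by (intro order_trans[OF abs_triangle_ineq] add_mono)
        (auto simp: abs_mult intro!: mult_right_mono mult_left_mono abs_triangle_ineq4)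
    also have "\<dots> \<le> B k"
      unfolding B_def using sh_le[OF that, of k] pw_abs[OF that, of k] g[OF that, of k] g'[OF that, of k] M
      by (intro add_mono mult_mono) auto
    finally show ?thesis by simp
  qed
  have unif: "uniform_limit {0..1} (\<lambda>n x. \<Sum>i<n. f' i x) (\<lambda>x. \<Sum>i. f' i x) sequentially"
    by (rule Weierstrass_m_test[OF f'_le B_summable])
  have f_summable: "summable (\<lambda>k. f k x)" if "x \<in> {0..1}" for x
  proof (rule summable_comparison_test'[where N=0])
    show "summable (\<lambda>k. c ^ k / fact k * M)" by (intro summable_mult2 exp_summable)
    show "norm (f k x) \<le> c ^ k / fact k * M" for k
      unfolding f_def real_norm_def abs_mult
      using pw_abs[OF that, of k] g[OF that, of k] by (intro mult_mono) auto
  qed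
  have "\<exists>G. \<forall>x\<in>{0..1}. (\<lambda>n. f n x) sums G x \<and> (G has_real_derivative (\<Sum>i. f' i x)) (at x within {0..1})"
    by (rule has_field_derivative_series[OF _ f_deriv unif u f_summable[OF u]]) simp_all
  then obtain G where "\<forall>x\<in>{0..1}. (\<lambda>n. f n x) sums G x \<and> (G has_real_derivative (\<Sum>i. f' i x)) (at x within {0..1})"
    ..
  then have G: "\<And>x. x \<in> {0..1} \<Longrightarrow> (\<lambda>n. f n x) sums G x"
      "\<And>x. x \<in> {0..1} \<Longrightarrow> (G has_real_derivative (\<Sum>i. f' i x)) (at x within {0..1})"
    by simp_all
  have "((\<lambda>u. \<Sum>k. f k u) has_real_derivative (\<Sum>i. f' i u)) (at u within {0..1})"
    by (rule has_field_derivative_transform_within[OF G(2)[OF u] zero_less_one u])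
      (use G(1) in \<open>simp add: sums_iff\<close>)
  \<comment> \<open>Index shift: the weight of index \<open>k - 1\<close> against \<open>g k\<close>
    is the weight of index \<open>k\<close> against \<open>g (Suc k)\<close>.\<close>
  moreover have "(\<Sum>i. f' i u) = (\<Sum>k. pois_weight (s u) k * (b * (g (Suc k) u - g k u) + g' k u))"
  proof -
    have wsum: "summable (\<lambda>k. pois_weight (s u) k * x k)" if x: "\<And>k. \<bar>x k\<bar> \<le> d" for x d
    proof (rule summable_comparison_test'[where N=0])
      show "summable (\<lambda>k. c ^ k / fact k * d)" by (rule summable_mult2[OF exp_summable])
      show "norm (pois_weight (s u) k * x k) \<le> c ^ k / fact k * d" for k
        unfolding real_norm_def abs_mult
        using pw_abs[OF u, of k] x[of k] c0 by (intro mult_mono) auto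
    qed
    have s1: "summable (\<lambda>k. pois_weight (s u) k * g' k u)" "summable (\<lambda>k. pois_weight (s u) k * g k u)"
        "summable (\<lambda>k. pois_weight (s u) k * g (Suc k) u)"
      by (rule wsum[OF g'[OF u]], rule wsum[OF g[OF u]], rule wsum[OF g[OF u]])
    have shsum: "(\<lambda>k. sh u k * g k u) sums (\<Sum>k. pois_weight (s u) k * g (Suc k) u)"
    proof -
      have "(\<lambda>k. sh u (Suc k) * g (Suc k) u) sums (\<Sum>k. pois_weight (s u) k * g (Suc k) u)"
        using summable_sums[OF s1(3)] by (simp add: sh_def)
      from sums_Suc[OF this] show ?thesis by (simp add: sh_def)
    qed
    have "(\<lambda>i. b * (sh u i * g i u - pois_weight (s u) i * g i u) + pois_weight (s u) i * g' i u) sums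
       (b * ((\<Sum>k. pois_weight (s u) k * g (Suc k) u) - (\<Sum>k. pois_weight (s u) k * g k u)) + (\<Sum>k. pois_weight (s u) k * g' k u))"
      by (intro sums_add sums_mult sums_diff shsum summable_sums s1)
    moreover have "(\<lambda>k. b * (pois_weight (s u) k * g (Suc k) u - pois_weight (s u) k * g k u) + pois_weight (s u) k * g' k u) sums
       (b * ((\<Sum>k. pois_weight (s u) k * g (Suc k) u) - (\<Sum>k. pois_weight (s u) k * g k u)) + (\<Sum>k. pois_weight (s u) k * g' k u))"
      by (intro sums_add sums_mult sums_diff summable_sums s1)
    ultimately show ?thesis
      by (simp add: sums_iff f'_def algebra_simps)
  qed
  ultimately show ?thesis by (simp add: f_def)
qed

text \<open>Stated through integrals, this property and the next one pass to product measures by Fubini's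
  theorem alone.\<close>

definition adds_pt :: "'a measure \<Rightarrow> ('b \<Rightarrow> 'a \<Rightarrow> 'b) \<Rightarrow> 'b measure \<Rightarrow> 'b measure \<Rightarrow> bool" where
  "adds_pt \<mu> \<phi> N' N \<longleftrightarrow> (\<lambda>p. \<phi> (fst p) (snd p)) \<in> measurable (N \<Otimes>\<^sub>M \<mu>) N \<and>
     (\<forall>f. bmeas N f \<longrightarrow> (\<integral>x. f x \<partial>N') = (\<integral>x. \<integral>y. f (\<phi> x y) \<partial>\<mu> \<partial>N))"

definition poisson_mix :: "real \<Rightarrow> 'b measure \<Rightarrow> (nat \<Rightarrow> 'b measure) \<Rightarrow> bool" where
  "poisson_mix s N q \<longleftrightarrow> (\<forall>f. bmeas N f \<longrightarrow> (\<lambda>k. pois_weight s k * (\<integral>x. f x \<partial>q k)) sums (\<integral>x. f x \<partial>N))"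

text \<open>Integrating out the untouched coordinate first reduces the claim to the given component;
  Fubini's theorem then exchanges that coordinate with the added point.\<close>

lemma adds_pt_pair_left:
  assumes p: "prob_space N'" "prob_space N" "prob_space M" "prob_space \<mu>" and sets: "sets N' = sets N"
    and adds_pt: "adds_pt \<mu> \<phi> N' N"
  shows "adds_pt \<mu> (\<lambda>p y. (\<phi> (fst p) y, snd p)) (N' \<Otimes>\<^sub>M M) (N \<Otimes>\<^sub>M M)"
  unfolding adds_pt_def
proof (intro conjI allI impI)
  have \<phi>[measurable]: "(\<lambda>p. \<phi> (fst p) (snd p)) \<in> measurable (N \<Otimes>\<^sub>M \<mu>) N"
    using adds_pt by (simp add: adds_pt_def)
  have comp: "(\<lambda>p. \<phi> (f p) (g p)) \<in> measurable L N"
    if "f \<in> measurable L N" "g \<in> measurable L \<mu>" for f g and L :: "'d measure"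
    using measurable_compose[OF measurable_Pair[OF that] \<phi>] by simp
  show "(\<lambda>p. (\<phi> (fst (fst p)) (snd p), snd (fst p))) \<in> (N \<Otimes>\<^sub>M M) \<Otimes>\<^sub>M \<mu> \<rightarrow>\<^sub>M N \<Otimes>\<^sub>M M"
    by (intro measurable_Pair comp) measurable
  fix f assume f: "bmeas (N \<Otimes>\<^sub>M M) f"
  have f': "bmeas (N' \<Otimes>\<^sub>M M) f"
    using f by (subst bmeas_cong_sets[OF sets_pair_measure_cong[OF sets refl]])
  have "(\<integral>x. f x \<partial>(N' \<Otimes>\<^sub>M M)) = (\<integral>x. \<integral>z. f (x, z) \<partial>M \<partial>N')"
    by (rule bmeas_integral_fst[OF p(1,3) f'])
  also have "\<dots> = (\<integral>x. \<integral>y. \<integral>z. f (\<phi> x y, z) \<partial>M \<partial>\<mu> \<partial>N)"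
  proof -
    have "bmeas N (\<lambda>x. \<integral>z. f (x, z) \<partial>M)"
      by (rule bmeas_integral[OF p(3)]) (simp add: f)
    then show ?thesis using adds_pt by (auto simp: adds_pt_def)
  qed
  also have "\<dots> = (\<integral>x. \<integral>z. \<integral>y. f (\<phi> x y, z) \<partial>\<mu> \<partial>M \<partial>N)"
  proof (intro Bochner_Integration.integral_cong refl)
    fix x assume x: "x \<in> space N"
    have "bmeas (\<mu> \<Otimes>\<^sub>M M) (\<lambda>p. f (\<phi> x (fst p), snd p))"
      by (rule bmeas_compose[OF f], intro measurable_Pair comp) (use x in measurable)
    from bmeas_Fubini[OF p(4,3) this]
    show "(\<integral>y. \<integral>z. f (\<phi> x y, z) \<partial>M \<partial>\<mu>) = (\<integral>z. \<integral>y. f (\<phi> x y, z) \<partial>\<mu> \<partial>M)"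
      by simp
  qed
  also have "\<dots> = (\<integral>p. \<integral>y. f (\<phi> (fst p) y, snd p) \<partial>\<mu> \<partial>(N \<Otimes>\<^sub>M M))"
  proof (subst bmeas_integral_fst[OF p(2,3)])
    show "bmeas (N \<Otimes>\<^sub>M M) (\<lambda>p. \<integral>y. f (\<phi> (fst p) y, snd p) \<partial>\<mu>)"
    proof (rule bmeas_integral[OF p(4)])
      show "bmeas ((N \<Otimes>\<^sub>M M) \<Otimes>\<^sub>M \<mu>) (\<lambda>p. f (\<phi> (fst (fst p)) (snd p), snd (fst p)))"
        by (rule bmeas_compose[OF f], intro measurable_Pair comp) measurable
    qed
  qed simp
  finally show "(\<integral>x. f x \<partial>(N' \<Otimes>\<^sub>M M)) = (\<integral>p. \<integral>y. f (\<phi> (fst p) y, snd p) \<partial>\<mu> \<partial>(N \<Otimes>\<^sub>M M))" .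
qed

lemma adds_pt_pair_right:
  assumes p: "prob_space N'" "prob_space N" "prob_space M" "prob_space \<mu>" and sets: "sets N' = sets N"
    and adds_pt: "adds_pt \<mu> \<phi> N' N"
  shows "adds_pt \<mu> (\<lambda>p y. (fst p, \<phi> (snd p) y)) (M \<Otimes>\<^sub>M N') (M \<Otimes>\<^sub>M N)"
  unfolding adds_pt_def
proof (intro conjI allI impI)
  have \<phi>[measurable]: "(\<lambda>p. \<phi> (fst p) (snd p)) \<in> measurable (N \<Otimes>\<^sub>M \<mu>) N"
    using adds_pt by (simp add: adds_pt_def)
  have comp: "(\<lambda>p. \<phi> (f p) (g p)) \<in> measurable L N"
    if "f \<in> measurable L N" "g \<in> measurable L \<mu>" for f g and L :: "'d measure"
    using measurable_compose[OF measurable_Pair[OF that] \<phi>] by simp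
  show "(\<lambda>p. (fst (fst p), \<phi> (snd (fst p)) (snd p))) \<in> (M \<Otimes>\<^sub>M N) \<Otimes>\<^sub>M \<mu> \<rightarrow>\<^sub>M M \<Otimes>\<^sub>M N"
    by (intro measurable_Pair comp) measurable
  fix f assume f: "bmeas (M \<Otimes>\<^sub>M N) f"
  have f': "bmeas (M \<Otimes>\<^sub>M N') f"
    using f by (subst bmeas_cong_sets[OF sets_pair_measure_cong[OF refl sets]])
  have "(\<integral>x. f x \<partial>(M \<Otimes>\<^sub>M N')) = (\<integral>x. \<integral>z. f (z, x) \<partial>M \<partial>N')"
    by (rule bmeas_integral_snd[OF p(3,1) f'])
  also have "\<dots> = (\<integral>x. \<integral>y. \<integral>z. f (z, \<phi> x y) \<partial>M \<partial>\<mu> \<partial>N)"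
  proof -
    have "bmeas N (\<lambda>x. \<integral>z. f (z, x) \<partial>M)"
      by (rule bmeas_integral[OF p(3)], rule bmeas_compose[OF f]) measurable
    then show ?thesis using adds_pt by (auto simp: adds_pt_def)
  qed
  also have "\<dots> = (\<integral>x. \<integral>z. \<integral>y. f (z, \<phi> x y) \<partial>\<mu> \<partial>M \<partial>N)"
  proof (intro Bochner_Integration.integral_cong refl)
    fix x assume x: "x \<in> space N"
    have "bmeas (\<mu> \<Otimes>\<^sub>M M) (\<lambda>p. f (snd p, \<phi> x (fst p)))"
      by (rule bmeas_compose[OF f], intro measurable_Pair comp) (use x in measurable)
    from bmeas_Fubini[OF p(4,3) this]
    show "(\<integral>y. \<integral>z. f (z, \<phi> x y) \<partial>M \<partial>\<mu>) = (\<integral>z. \<integral>y. f (z, \<phi> x y) \<partial>\<mu> \<partial>M)"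
      by simp
  qed
  also have "\<dots> = (\<integral>p. \<integral>y. f (fst p, \<phi> (snd p) y) \<partial>\<mu> \<partial>(M \<Otimes>\<^sub>M N))"
  proof (subst bmeas_integral_snd[OF p(3,2)])
    show "bmeas (M \<Otimes>\<^sub>M N) (\<lambda>p. \<integral>y. f (fst p, \<phi> (snd p) y) \<partial>\<mu>)"
    proof (rule bmeas_integral[OF p(4)])
      show "bmeas ((M \<Otimes>\<^sub>M N) \<Otimes>\<^sub>M \<mu>) (\<lambda>p. f (fst (fst p), \<phi> (snd (fst p)) (snd p)))"
        by (rule bmeas_compose[OF f], intro measurable_Pair comp) measurable
    qed
  qed simp
  finally show "(\<integral>x. f x \<partial>(M \<Otimes>\<^sub>M N')) = (\<integral>p. \<integral>y. f (fst p, \<phi> (snd p) y) \<partial>\<mu> \<partial>(M \<Otimes>\<^sub>M N))" .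
qed

lemma poisson_mix_pair_left:
  assumes p: "prob_space N" "\<And>k. prob_space (q k)" "prob_space M" and sets: "\<And>k. sets (q k) = sets N"
    and poisson_mix: "poisson_mix s N q"
  shows "poisson_mix s (N \<Otimes>\<^sub>M M) (\<lambda>k. q k \<Otimes>\<^sub>M M)"
  unfolding poisson_mix_def
proof (intro allI impI)
  fix f assume f: "bmeas (N \<Otimes>\<^sub>M M) f"
  have f': "bmeas (q k \<Otimes>\<^sub>M M) f" for k
    using f by (subst bmeas_cong_sets[OF sets_pair_measure_cong[OF sets refl]])
  have "bmeas N (\<lambda>x. \<integral>z. f (x, z) \<partial>M)"
    by (rule bmeas_integral[OF p(3)]) (simp add: f)
  then show "(\<lambda>k. pois_weight s k * (\<integral>x. f x \<partial>(q k \<Otimes>\<^sub>M M))) sums (\<integral>x. f x \<partial>(N \<Otimes>\<^sub>M M))"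
    using poisson_mix by (simp add: poisson_mix_def bmeas_integral_fst[OF p(1,3) f] bmeas_integral_fst[OF p(2,3) f'])
qed

lemma poisson_mix_pair_right:
  assumes p: "prob_space N" "\<And>k. prob_space (q k)" "prob_space M" and sets: "\<And>k. sets (q k) = sets N"
    and poisson_mix: "poisson_mix s N q"
  shows "poisson_mix s (M \<Otimes>\<^sub>M N) (\<lambda>k. M \<Otimes>\<^sub>M q k)"
  unfolding poisson_mix_def
proof (intro allI impI)
  fix f assume f: "bmeas (M \<Otimes>\<^sub>M N) f"
  have f': "bmeas (M \<Otimes>\<^sub>M q k) f" for k
    using f by (subst bmeas_cong_sets[OF sets_pair_measure_cong[OF refl sets]])
  have "bmeas N (\<lambda>x. \<integral>z. f (z, x) \<partial>M)"
    by (rule bmeas_integral[OF p(3)], rule bmeas_compose[OF f]) measurable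
  then show "(\<lambda>k. pois_weight s k * (\<integral>x. f x \<partial>(M \<Otimes>\<^sub>M q k))) sums (\<integral>x. f x \<partial>(M \<Otimes>\<^sub>M N))"
    using poisson_mix by (simp add: poisson_mix_def bmeas_integral_snd[OF p(3,1) f] bmeas_integral_snd[OF p(3,2) f'])
qed

text \<open>The generator of the flow: one Poisson component of rate \<open>s(u)\<close> of a family of laws \<open>N u\<close>
  contributes \<open>b\<close> times the effect of one additional point; the remaining components contribute \<open>D\<close>.\<close>

lemma poisson_mix_deriv:
  fixes q :: "nat \<Rightarrow> real \<Rightarrow> 'b measure" and N :: "real \<Rightarrow> 'b measure" and \<mu> :: "'a measure"
  assumes p: "\<And>u. u \<in> {0..1} \<Longrightarrow> prob_space (N u)" "\<And>k u. u \<in> {0..1} \<Longrightarrow> prob_space (q k u)" "prob_space \<mu>"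
    and sets: "\<And>u. sets (N u) = sets L" "\<And>k u. sets (q k u) = sets L"
    and adds_pt: "\<And>k u. u \<in> {0..1} \<Longrightarrow> adds_pt \<mu> \<phi> (q (Suc k) u) (q k u)"
    and poisson_mix: "\<And>u. u \<in> {0..1} \<Longrightarrow> poisson_mix (s u) (N u) (\<lambda>k. q k u)"
    and s: "\<And>u. s u = a + b * u" "\<And>u. u \<in> {0..1} \<Longrightarrow> 0 \<le> s u"
    and H: "bmeas L H" "bmeas L D"
    and deriv: "\<And>k u. u \<in> {0..1} \<Longrightarrow>
      ((\<lambda>u. \<integral>x. H x \<partial>q k u) has_real_derivative (\<integral>x. D x \<partial>q k u)) (at u within {0..1})"
    and u: "u \<in> {0..1}"
  shows "((\<lambda>u. \<integral>x. H x \<partial>N u) has_real_derivative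
    (\<integral>x. b * ((\<integral>y. H (\<phi> x y) \<partial>\<mu>) - H x) + D x \<partial>N u)) (at u within {0..1})"
proof -
  obtain M where M: "\<And>x. \<bar>H x\<bar> \<le> M" using H(1) by (rule bmeasE) blast
  obtain M' where M': "\<And>x. \<bar>D x\<bar> \<le> M'" using H(2) by (rule bmeasE) blast
  have HN: "bmeas (N u) H" and Hq: "bmeas (q k u) H" and Dq: "bmeas (q k u) D" for k u
    using H by (simp_all add: bmeas_cong_sets[OF sets(1)] bmeas_cong_sets[OF sets(2)])
  have \<phi>: "(\<lambda>p. \<phi> (fst p) (snd p)) \<in> measurable (L \<Otimes>\<^sub>M \<mu>) L"
  proof -
    have "(\<lambda>p. \<phi> (fst p) (snd p)) \<in> measurable (q 0 0 \<Otimes>\<^sub>M \<mu>) (q 0 0)"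
      using adds_pt[of 0 0] by (simp add: adds_pt_def)
    then show ?thesis
      unfolding measurable_cong_sets[OF sets_pair_measure_cong[OF sets(2)[of 0 0] refl] sets(2)[of 0 0]] .
  qed
  have T: "bmeas L (\<lambda>x. \<integral>y. H (\<phi> x y) \<partial>\<mu>)"
    by (rule bmeas_integral[OF p(3)], rule bmeas_compose[OF H(1) \<phi>])
  let ?E = "\<lambda>x. b * ((\<integral>y. H (\<phi> x y) \<partial>\<mu>) - H x) + D x"
  have E: "bmeas L ?E"
    by (intro bmeas_add bmeas_mult bmeas_const bmeas_diff T H)
  have "((\<lambda>u. \<Sum>k. pois_weight (s u) k * (\<integral>x. H x \<partial>q k u)) has_real_derivative
     (\<Sum>k. pois_weight (s u) k * (b * ((\<integral>x. H x \<partial>q (Suc k) u) - (\<integral>x. H x \<partial>q k u)) + (\<integral>x. D x \<partial>q k u)))) (at u within {0..1})"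
  proof (rule poisson_average_deriv[OF s _ _ deriv u])
    show "\<bar>\<integral>x. H x \<partial>q k u\<bar> \<le> M" if "u \<in> {0..1}" for k u
      using p(2)[OF that] Hq M by (intro bounded_integral) (auto dest: bmeas_measurable)
    show "\<bar>\<integral>x. D x \<partial>q k u\<bar> \<le> M'" if "u \<in> {0..1}" for k u
      using p(2)[OF that] Dq M' by (intro bounded_integral) (auto dest: bmeas_measurable)
  qed
  moreover have "(b * ((\<integral>x. H x \<partial>q (Suc k) u) - (\<integral>x. H x \<partial>q k u)) + (\<integral>x. D x \<partial>q k u)) = (\<integral>x. ?E x \<partial>q k u)" for k
  proof -
    have i: "integrable (q k u) H" "integrable (q k u) D" "integrable (q k u) (\<lambda>x. \<integral>y. H (\<phi> x y) \<partial>\<mu>)"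
      using H T p(2)[OF u] by (auto intro!: bmeas_integrable simp: bmeas_cong_sets[OF sets(2)])
    \<comment> \<open>Consecutive laws differ by one inserted \<open>\<mu>\<close>-distributed
      point, so the index shift of the weights turns into an average of \<open>H\<close> over an
      inserted point.\<close>
    have "(\<integral>x. H x \<partial>q (Suc k) u) = (\<integral>x. \<integral>y. H (\<phi> x y) \<partial>\<mu> \<partial>q k u)"
      using adds_pt[OF u] Hq by (simp add: adds_pt_def)
    then show ?thesis using i by simp
  qed
  moreover have "(\<Sum>k. pois_weight (s u) k * (\<integral>x. ?E x \<partial>q k u)) = (\<integral>x. ?E x \<partial>N u)"
    using poisson_mix[OF u] E bmeas_cong_sets[OF sets(1)] by (simp add: poisson_mix_def sums_iff)
  ultimately have "((\<lambda>u. \<Sum>k. pois_weight (s u) k * (\<integral>x. H x \<partial>q k u)) has_real_derivative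
      (\<integral>x. ?E x \<partial>N u)) (at u within {0..1})" by simp
  then show ?thesis
    by (rule has_field_derivative_transform_within[OF _ zero_less_one u])
      (use poisson_mix HN in \<open>simp add: poisson_mix_def sums_iff\<close>)
qed

section \<open>The interpolated coupling\<close>

text \<open>Configurations are sets, so coinciding points merge. Void events do not see
  multiplicities, hence the product formula for their probabilities is unaffected.\<close>

primrec add_points :: "'a::metric_space measure \<Rightarrow> 'a set measure \<Rightarrow> nat \<Rightarrow> 'a set measure" where
  "add_points \<mu> \<iota> 0 = \<iota>"
| "add_points \<mu> \<iota> (Suc n) = distr (add_points \<mu> \<iota> n \<Otimes>\<^sub>M \<mu>) config_space (\<lambda>p. insert (snd p) (fst p))"

definition poisson_counts :: "real \<Rightarrow> nat measure" where
  "poisson_counts s = density (count_space UNIV) (\<lambda>k. ennreal (pois_weight s k))"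

text \<open>The superposition of \<open>\<iota>\<close> with an independent Poisson process of
  intensity \<open>s \<mu>\<close>, written as a mixture over the number of added points. Here
  \<open>\<mu>\<close> is to be a probability measure, so \<open>s\<close> is the total
  mass.\<close>

definition add_poisson :: "'a::metric_space measure \<Rightarrow> 'a set measure \<Rightarrow> real \<Rightarrow> 'a set measure" where
  "add_poisson \<mu> \<iota> s = poisson_counts s \<bind> add_points \<mu> \<iota>"

lemma sets_poisson_counts[simp]: "sets (poisson_counts s) = UNIV"
  and space_poisson_counts[simp]: "space (poisson_counts s) = UNIV"
  by (simp_all add: poisson_counts_def)

lemma prob_poisson_counts: "0 \<le> s \<Longrightarrow> prob_space (poisson_counts s)"
  using pois_weight_sums[of s]
  by (intro prob_spaceI)
    (simp add: poisson_counts_def emeasure_density nn_integral_count_space_nat suminf_ennreal2 pois_weight_nonneg sums_iff)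

lemma poisson_counts_sums:
  fixes f :: "nat \<Rightarrow> real"
  assumes s: "0 \<le> s" and f: "\<And>k. \<bar>f k\<bar> \<le> c"
  shows "(\<lambda>k. pois_weight s k * f k) sums (\<integral>k. f k \<partial>poisson_counts s)"
proof -
  have "summable (\<lambda>k. norm (pois_weight s k * f k))"
  proof (rule summable_comparison_test'[where N=0])
    show "summable (\<lambda>k. pois_weight s k * c)" using pois_weight_sums[of s] by (intro summable_mult2) (simp add: sums_iff)
    show "norm (norm (pois_weight s k * f k)) \<le> pois_weight s k * c" for k
      using f[of k] pois_weight_nonneg[OF s, of k] by (simp add: abs_mult mult_left_mono)
  qed
  then have "integrable (count_space UNIV) (\<lambda>k. pois_weight s k * f k)"
    by (simp add: integrable_count_space_nat_iff)
  from sums_integral_count_space_nat[OF this] show ?thesis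
    by (simp add: poisson_counts_def integral_density pois_weight_nonneg[OF s])
qed

lemma measure_pair_Times:
  assumes "prob_space M" "prob_space N" "X \<in> sets M" "Y \<in> sets N"
  shows "measure (M \<Otimes>\<^sub>M N) (X \<times> Y) = measure M X * measure N Y"
proof -
  interpret N: prob_space N by fact
  show ?thesis
    using assms by (simp add: measure_def N.emeasure_pair_measure_Times enn2real_mult)
qed

context compact_exhaustion
begin

abbreviation "C \<equiv> (config_space :: 'a set measure)"

context
  fixes \<mu> :: "'a measure" and \<iota> :: "'a set measure"
  assumes \<mu>: "prob_space \<mu>" "sets \<mu> = sets borel"
    and \<iota>: "prob_space \<iota>" "sets \<iota> = sets C"
begin

lemma measurable_insert_pair:
  assumes "sets M = sets C"
  shows "(\<lambda>p. insert (snd p) (fst p)) \<in> measurable (M \<Otimes>\<^sub>M \<mu>) C"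
proof (rule measurable_insert_config)
  show "fst \<in> measurable (M \<Otimes>\<^sub>M \<mu>) C"
    using measurable_fst[of M \<mu>] measurable_cong_sets[OF refl assms, of "M \<Otimes>\<^sub>M \<mu>"] by simp
  show "snd \<in> measurable (M \<Otimes>\<^sub>M \<mu>) borel"
    using measurable_snd[of M \<mu>] measurable_cong_sets[OF refl \<mu>(2), of "M \<Otimes>\<^sub>M \<mu>"] by simp
qed

lemma sets_add_points[simp]: "sets (add_points \<mu> \<iota> n) = sets C"
  by (cases n) (simp_all add: \<iota>)

lemma prob_add_points: "prob_space (add_points \<mu> \<iota> n)"
proof (induction n)
  case 0
  then show ?case by (simp add: \<iota>)
next
  case (Suc n)
  show ?case
    unfolding add_points.simps
    by (intro prob_space.prob_space_distr prob_pair Suc \<mu> measurable_insert_pair sets_add_points)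
qed

lemma adds_add_points: "adds_pt \<mu> (\<lambda>\<omega> y. insert y \<omega>) (add_points \<mu> \<iota> (Suc n)) (add_points \<mu> \<iota> n)"
  unfolding adds_pt_def
proof (intro conjI allI impI)
  have m: "(\<lambda>p. insert (snd p) (fst p)) \<in> measurable (add_points \<mu> \<iota> n \<Otimes>\<^sub>M \<mu>) C"
    by (rule measurable_insert_pair) simp
  then show "(\<lambda>p. insert (snd p) (fst p)) \<in> measurable (add_points \<mu> \<iota> n \<Otimes>\<^sub>M \<mu>) (add_points \<mu> \<iota> n)"
    using measurable_cong_sets[OF refl sets_add_points[of n], of "add_points \<mu> \<iota> n \<Otimes>\<^sub>M \<mu>"] by simp
  fix f assume "bmeas (add_points \<mu> \<iota> n) f"
  then have f: "bmeas C f" using bmeas_cong_sets[OF sets_add_points] by blast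
  have "(\<integral>x. f x \<partial>add_points \<mu> \<iota> (Suc n)) = (\<integral>p. f (insert (snd p) (fst p)) \<partial>(add_points \<mu> \<iota> n \<Otimes>\<^sub>M \<mu>))"
    unfolding add_points.simps by (rule integral_distr[OF m bmeas_measurable[OF f]])
  also have "\<dots> = (\<integral>x. \<integral>y. f (insert y x) \<partial>\<mu> \<partial>add_points \<mu> \<iota> n)"
    using bmeas_integral_fst[OF prob_add_points \<mu>(1) bmeas_compose[OF f m]] by simp
  finally show "(\<integral>x. f x \<partial>add_points \<mu> \<iota> (Suc n)) = (\<integral>x. \<integral>y. f (insert y x) \<partial>\<mu> \<partial>add_points \<mu> \<iota> n)" .
qed

lemma add_points_kernel: "add_points \<mu> \<iota> \<in> measurable (poisson_counts s) (subprob_algebra C)"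
  by (rule measurableI)
    (auto simp: space_subprob_algebra intro!: prob_space_imp_subprob_space prob_add_points)

lemma sets_add_poisson[simp]: "sets (add_poisson \<mu> \<iota> s) = sets C"
  unfolding add_poisson_def by (rule sets_bind) simp_all

lemma prob_add_poisson: "0 \<le> s \<Longrightarrow> prob_space (add_poisson \<mu> \<iota> s)"
  unfolding add_poisson_def
  by (intro prob_space.prob_space_bind[OF prob_poisson_counts _ add_points_kernel] AE_I2 prob_add_points)

lemma poisson_mix_add_poisson:
  assumes s: "0 \<le> s"
  shows "poisson_mix s (add_poisson \<mu> \<iota> s) (add_points \<mu> \<iota>)"
  unfolding poisson_mix_def
proof (intro allI impI)
  fix f assume "bmeas (add_poisson \<mu> \<iota> s) f"
  then have f: "bmeas C f" using bmeas_cong_sets[OF sets_add_poisson] by blast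
  obtain c where c: "\<And>x. \<bar>f x\<bar> \<le> c" using f by (rule bmeasE) blast
  interpret pc: prob_space "poisson_counts s" by (rule prob_poisson_counts[OF s])
  have "(\<integral>x. f x \<partial>add_poisson \<mu> \<iota> s) = (\<integral>k. \<integral>x. f x \<partial>add_points \<mu> \<iota> k \<partial>poisson_counts s)"
    unfolding add_poisson_def
  proof (rule integral_bind[OF bmeas_measurable[OF f] c add_points_kernel])
    show "AE k in poisson_counts s. emeasure (add_points \<mu> \<iota> k) (space (add_points \<mu> \<iota> k)) \<le> ennreal 1"
      using prob_space.emeasure_space_1[OF prob_add_points] by (intro AE_I2) simp
  qed unfold_locales
  moreover have "\<bar>\<integral>x. f x \<partial>add_points \<mu> \<iota> k\<bar> \<le> c" for k
    using bmeas_cong_sets[OF sets_add_points[of k]] f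
    by (intro bounded_integral prob_add_points c) (auto dest: bmeas_measurable)
  ultimately show "(\<lambda>k. pois_weight s k * (\<integral>x. f x \<partial>add_points \<mu> \<iota> k)) sums (\<integral>x. f x \<partial>add_poisson \<mu> \<iota> s)"
    using poisson_counts_sums[OF s, of "\<lambda>k. \<integral>x. f x \<partial>add_points \<mu> \<iota> k" c] by simp
qed

lemma bmeas_indicator_void: "B \<in> sets borel \<Longrightarrow> bmeas C (indicator (void B))"
  by (rule bmeasI[of _ _ 1]) (auto simp: indicator_def intro!: borel_measurable_indicator void_in_sets)

text \<open>Each added point is drawn independently of the rest and misses \<open>B\<close> with
  probability \<open>1 - measure \<mu> B\<close>.\<close>

lemma measure_add_points_void:
  assumes B: "B \<in> sets borel"
  shows "measure (add_points \<mu> \<iota> n) (void B) = measure \<iota> (void B) * (1 - measure \<mu> B) ^ n"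
proof (induction n)
  case 0
  then show ?case by simp
next
  case (Suc n)
  interpret \<mu>: prob_space \<mu> by (rule \<mu>)
  have ind: "measure (add_points \<mu> \<iota> k) (void B) = (\<integral>\<omega>. indicator (void B) \<omega> \<partial>add_points \<mu> \<iota> k)" for k
    using void_in_sets[OF B] by (simp add: sets.Int_space_eq2)
  have sp: "space (add_points \<mu> \<iota> k) = configurations" for k
    using sets_eq_imp_space_eq[OF sets_add_points] by (simp add: space_config_space)
  have "measure (add_points \<mu> \<iota> (Suc n)) (void B) = (\<integral>\<omega>. \<integral>y. indicator (void B) (insert y \<omega>) \<partial>\<mu> \<partial>add_points \<mu> \<iota> n)"
    using adds_add_points[of n] bmeas_indicator_void[OF B]
    unfolding ind adds_pt_def bmeas_cong_sets[OF sets_add_points] by blast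
  also have "\<dots> = (\<integral>\<omega>. \<integral>y. indicator (void B) \<omega> * indicator (space \<mu> - B) y \<partial>\<mu> \<partial>add_points \<mu> \<iota> n)"
  proof (intro Bochner_Integration.integral_cong refl)
    fix \<omega> y assume "\<omega> \<in> space (add_points \<mu> \<iota> n)" "y \<in> space \<mu>"
    then show "indicator (void B) (insert y \<omega>) = (indicator (void B) \<omega> * indicator (space \<mu> - B) y :: real)"
      by (auto simp: void_def sp indicator_def configurations_insert)
  qed
  also have "\<dots> = measure (add_points \<mu> \<iota> n) (void B) * (1 - measure \<mu> B)"
  proof -
    have "(\<integral>y. indicator (space \<mu> - B) y \<partial>\<mu>) = 1 - measure \<mu> B"
      using B \<mu>(2) \<mu>.prob_compl[of B] by (simp add: Int_absorb2)
    moreover have "(\<integral>\<omega>. \<integral>y. indicator (void B) \<omega> * indicator (space \<mu> - B) y \<partial>\<mu> \<partial>add_points \<mu> \<iota> n)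
        = (\<integral>\<omega>. indicator (void B) \<omega> \<partial>add_points \<mu> \<iota> n) * (\<integral>y. indicator (space \<mu> - B) y \<partial>\<mu> :: real)"
      by (simp only: integral_mult_right_zero integral_mult_left_zero)
    ultimately show ?thesis unfolding ind by simp
  qed
  finally show ?case using Suc by simp
qed

lemma measure_add_poisson_void:
  assumes B: "B \<in> sets borel" and s: "0 \<le> s"
  shows "measure (add_poisson \<mu> \<iota> s) (void B) = measure \<iota> (void B) * exp (- s * measure \<mu> B)"
proof -
  have ind: "measure M (void B) = (\<integral>\<omega>. indicator (void B) \<omega> \<partial>M)" if "sets M = sets C" for M
    using void_in_sets[OF B] that by (simp add: sets.Int_space_eq2)
  have "(\<lambda>k. pois_weight s k * measure (add_points \<mu> \<iota> k) (void B)) sums measure (add_poisson \<mu> \<iota> s) (void B)"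
    using poisson_mix_add_poisson[OF s] bmeas_indicator_void[OF B]
    unfolding ind[OF sets_add_points] ind[OF sets_add_poisson] poisson_mix_def bmeas_cong_sets[OF sets_add_poisson] by blast
  moreover have "(\<lambda>k. measure \<iota> (void B) * (pois_weight s k * (1 - measure \<mu> B) ^ k)) sums (measure \<iota> (void B) * exp (s * ((1 - measure \<mu> B) - 1)))"
    by (intro sums_mult pois_weight_power_sums)
  ultimately show ?thesis
    by (simp add: measure_add_points_void[OF B] algebra_simps sums_iff)
qed

lemma add_poisson_0: "add_poisson \<mu> \<iota> 0 = \<iota>"
proof (rule measure_eqI_void)
  show "measure (add_poisson \<mu> \<iota> 0) (void B) = measure \<iota> (void B)" if "B \<in> sets borel" for B
    using measure_add_poisson_void[OF that] by simp
qed (simp_all add: prob_add_poisson \<iota>)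

end

end

section \<open>The interpolated pair of Poisson processes and the covariance inequality\<close>

locale poisson_process = compact_exhaustion A for A :: "nat \<Rightarrow> 'a::metric_space set" +
  fixes \<nu> :: "'a measure" and P :: "'a set measure"
  assumes sets_\<nu>: "sets \<nu> = sets borel"
    and finite_\<nu>: "emeasure \<nu> (A n) < \<infinity>"
    and prob_P: "prob_space P"
    and sets_P: "sets P = sets C"
    and void_P: "B \<in> sets borel \<Longrightarrow> emeasure \<nu> B < \<infinity> \<Longrightarrow> measure P (void B) = exp (- measure \<nu> B)"
begin

lemma space_\<nu>[simp]: "space \<nu> = UNIV"
  using sets_eq_imp_space_eq[OF sets_\<nu>] by simp

lemma sigma_finite_\<nu>: "sigma_finite_measure \<nu>"
proof
  show "\<exists>F. countable F \<and> F \<subseteq> sets \<nu> \<and> \<Union> F = space \<nu> \<and> (\<forall>a\<in>F. emeasure \<nu> a \<noteq> \<infinity>)"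
    using A_cover finite_\<nu> by (intro exI[of _ "range A"]) (auto simp: sets_\<nu> less_top)
qed

text \<open>A Poisson process on \<open>A n\<close> is assembled from a number of points and the law
  of a single point, so \<open>\<nu>\<close> is split there into mass times a probability measure.
  If \<open>A n\<close> is a null set, the choice of \<open>\<mu>\<close> is arbitrary because the
  factor in front is 0.\<close>

lemma normalized_restriction:
  shows "\<exists>\<mu>. prob_space \<mu> \<and> sets \<mu> = sets borel \<and> (\<forall>k\<in>borel_measurable borel.
    ennreal (measure \<nu> (A n)) * (\<integral>\<^sup>+y. k y \<partial>\<mu>) = (\<integral>\<^sup>+y. k y * indicator (A n) y \<partial>\<nu>))"
proof (cases "emeasure \<nu> (A n) = 0")
  case True
  have "(\<integral>\<^sup>+y. k y * indicator (A n) y \<partial>\<nu>) = 0" if "k \<in> borel_measurable borel" for k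
  proof -
    have "AE y in \<nu>. y \<notin> A n" using True by (intro AE_not_in null_setsI) (simp_all add: sets_\<nu>)
    then have "(\<integral>\<^sup>+y. k y * indicator (A n) y \<partial>\<nu>) = (\<integral>\<^sup>+y. 0 \<partial>\<nu>)"
      by (intro nn_integral_cong_AE) (auto elim: eventually_mono)
    then show ?thesis by simp
  qed
  then show ?thesis using True
    by (intro exI[of _ "return borel undefined"]) (simp add: prob_space_return measure_def)
next
  case False
  have A: "A n \<in> sets \<nu>" by (simp add: sets_\<nu>)
  have fin: "emeasure \<nu> (A n) \<noteq> \<infinity>" using finite_\<nu>[of n] by auto
  show ?thesis
  proof (intro exI[of _ "uniform_measure \<nu> (A n)"] conjI ballI)
    show "prob_space (uniform_measure \<nu> (A n))"
      by (rule prob_space_uniform_measure[OF False fin])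
    show "sets (uniform_measure \<nu> (A n)) = sets borel" by (simp add: sets_\<nu>)
    fix k :: "'a \<Rightarrow> ennreal" assume "k \<in> borel_measurable borel"
    then have "k \<in> borel_measurable \<nu>"
      using measurable_cong_sets[OF sets_\<nu> refl, of "borel :: ennreal measure"] by simp
    then have U: "(\<integral>\<^sup>+y. k y \<partial>uniform_measure \<nu> (A n)) = (\<integral>\<^sup>+y. k y * indicator (A n) y \<partial>\<nu>) / emeasure \<nu> (A n)"
      by (rule nn_integral_uniform_measure[OF _ A])
    have E: "ennreal (measure \<nu> (A n)) = emeasure \<nu> (A n)"
      using fin by (simp add: emeasure_eq_ennreal_measure)
    have "a * (b / a) = b" if "a \<noteq> 0" "a \<noteq> \<infinity>" for a b :: ennreal
      using ennreal_mult_divide_eq[of a b] that by (simp add: ennreal_times_divide mult.commute)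
    from this[OF False fin]
    show "ennreal (measure \<nu> (A n)) * (\<integral>\<^sup>+y. k y \<partial>uniform_measure \<nu> (A n)) = (\<integral>\<^sup>+y. k y * indicator (A n) y \<partial>\<nu>)"
      unfolding U E .
  qed
qed

text \<open>The interpolation: \<open>\<alpha>\<close> is a Poisson process of intensity \<open>u \<nu>\<close> on \<open>A n\<close>, while \<open>\<beta>\<close> and \<open>\<gamma>\<close> are
  independent Poisson processes of intensity \<open>(1 - u) \<nu>\<close> on \<open>A n\<close> and \<open>\<nu>\<close> off \<open>A n\<close>. Both
  \<open>\<alpha> \<union> \<beta>\<close> and \<open>\<alpha> \<union> \<gamma>\<close> have law \<open>P\<close>; they are independent for \<open>u = 0\<close> and agree on \<open>A n\<close> for \<open>u = 1\<close>.\<close>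

lemma interpolated_coupling:
  obtains R where "sets R = sets (C \<Otimes>\<^sub>M C)"
    and "distr R C fst = P" and "distr R C snd = P"
    and "\<And>B. B \<in> sets borel \<Longrightarrow> B \<subseteq> A n \<Longrightarrow> AE p in R. fst p \<in> void B \<longleftrightarrow> snd p \<in> void B"
    and "\<And>F G Z good. bmeas C F \<Longrightarrow> bmeas C G \<Longrightarrow> bmeas C Z \<Longrightarrow> (\<And>\<omega>. 0 \<le> Z \<omega>) \<Longrightarrow>
      (AE \<omega> in P. good \<omega>) \<Longrightarrow>
      (\<And>\<omega> \<omega>'. \<omega> \<in> configurations \<Longrightarrow> \<omega>' \<in> configurations \<Longrightarrow> good \<omega> \<Longrightarrow> good \<omega>' \<Longrightarrow>
        (\<integral>\<^sup>+y. ennreal \<bar>diff_op F y \<omega> * diff_op G y \<omega>'\<bar> \<partial>\<nu>) \<le> ennreal (Z \<omega>')) \<Longrightarrow>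
      (\<integral>p. F (fst p) * G (snd p) \<partial>R) - (\<integral>\<omega>. F \<omega> \<partial>P) * (\<integral>\<omega>. G \<omega> \<partial>P) \<le> (\<integral>\<omega>. Z \<omega> \<partial>P)"
proof -
  define l where "l = measure \<nu> (A n)"
  have l: "0 \<le> l" by (simp add: l_def)
  obtain \<mu> where \<mu>: "prob_space \<mu>" "sets \<mu> = sets borel"
    and l_\<mu>: "\<And>k. k \<in> borel_measurable borel \<Longrightarrow> ennreal l * (\<integral>\<^sup>+y. k y \<partial>\<mu>) = (\<integral>\<^sup>+y. k y * indicator (A n) y \<partial>\<nu>)"
    using normalized_restriction[of n] unfolding l_def by blast
  interpret \<mu>: prob_space \<mu> by fact
  interpret P: prob_space P by (rule prob_P)
  have sp\<mu>: "space \<mu> = UNIV" using sets_eq_imp_space_eq[OF \<mu>(2)] by simp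
  \<comment> \<open>A Poisson number of points only produces finite intensities, so the part off
    \<open>A n\<close> is borrowed from \<open>P\<close> through \<open>\<iota>2\<close>. The common
    part starts from the empty configuration.\<close>
  define \<iota>1 where "\<iota>1 = return C {}"
  define \<iota>2 where "\<iota>2 = distr P C (\<lambda>\<omega>. \<omega> - A n)"
  have diff_m: "(\<lambda>\<omega>. \<omega> - A n) \<in> measurable P C"
    using measurable_diff_config[OF A_sets[of n]] measurable_cong_sets[OF sets_P refl, of C] by simp
  have \<iota>1: "prob_space \<iota>1" "sets \<iota>1 = sets C"
    by (simp_all add: \<iota>1_def prob_space_return space_config_space configurations_empty)
  have \<iota>2: "prob_space \<iota>2" "sets \<iota>2 = sets C"
    by (simp_all add: \<iota>2_def P.prob_space_distr diff_m)
  define q1 where "q1 = add_points \<mu> \<iota>1"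
  define q2 where "q2 = add_points \<mu> \<iota>2"
  \<comment> \<open>The rates have the affine form \<open>a + b * u\<close> of
    \<open>poisson_mix_deriv\<close>: slope \<open>l\<close> for the common component,
    \<open>- l\<close> for each of the two private ones.\<close>
  define Q1 where "Q1 u = add_poisson \<mu> \<iota>1 (0 + l * u)" for u
  define Q2 where "Q2 u = add_poisson \<mu> \<iota>2 (l + (- l) * u)" for u
  have rate: "0 \<le> 0 + l * u" "0 \<le> l + (- l) * u" if "u \<in> {0..1}" for u
    using l that mult_left_le[of u l] by auto
  have q: "prob_space (q1 k)" "prob_space (q2 k)" for k
    unfolding q1_def q2_def by (intro prob_add_points \<mu> \<iota>1 \<iota>2)+
  have Q: "prob_space (Q1 u)" "prob_space (Q2 u)" if "u \<in> {0..1}" for u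
    unfolding Q1_def Q2_def using rate[OF that] by (intro prob_add_poisson \<mu> \<iota>1 \<iota>2; simp)+
  have sq[simp]: "sets (q1 k) = sets C" "sets (q2 k) = sets C" for k
    unfolding q1_def q2_def by (simp_all add: sets_add_points[OF \<mu> \<iota>1] sets_add_points[OF \<mu> \<iota>2])
  have sQ[simp]: "sets (Q1 u) = sets C" "sets (Q2 u) = sets C" for u
    unfolding Q1_def Q2_def by (simp_all add: sets_add_poisson[OF \<mu> \<iota>1] sets_add_poisson[OF \<mu> \<iota>2])
  have mixQ: "poisson_mix (0 + l * u) (Q1 u) q1" "poisson_mix (l + (- l) * u) (Q2 u) q2" if "u \<in> {0..1}" for u
    unfolding Q1_def Q2_def q1_def q2_def by (intro poisson_mix_add_poisson \<mu> \<iota>1 \<iota>2 rate that)+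
  have addsq: "adds_pt \<mu> (\<lambda>\<omega> y. insert y \<omega>) (q1 (Suc k)) (q1 k)" "adds_pt \<mu> (\<lambda>\<omega> y. insert y \<omega>) (q2 (Suc k)) (q2 k)" for k
    unfolding q1_def q2_def by (intro adds_add_points \<mu> \<iota>1 \<iota>2)+
  define C3 where "C3 = C \<Otimes>\<^sub>M (C \<Otimes>\<^sub>M C)"
  define N where "N u = Q1 u \<Otimes>\<^sub>M (Q2 u \<Otimes>\<^sub>M Q2 u)" for u
  have sN: "sets (N u) = sets C3" for u
    unfolding N_def C3_def by (intro sets_pair_measure_cong sQ)
  have N: "prob_space (N u)" if "u \<in> {0..1}" for u
    unfolding N_def using Q[OF that] by (intro prob_pair)

  \<comment> \<open>A new point may join the common component or one of the private ones;
    \<open>\<phi>1\<close> alone affects both members of the pair.\<close>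
  define \<phi>1 where "\<phi>1 p y = (insert y (fst p), snd p)" for p :: "'a set \<times> 'a set \<times> 'a set" and y :: 'a
  define \<phi>2 where "\<phi>2 p y = (fst p, insert y (fst (snd p)), snd (snd p))" for p :: "'a set \<times> 'a set \<times> 'a set" and y :: 'a
  define \<phi>3 where "\<phi>3 p y = (fst p, fst (snd p), insert y (snd (snd p)))" for p :: "'a set \<times> 'a set \<times> 'a set" and y :: 'a
  have \<phi>_m: "(\<lambda>p. \<phi>1 (fst p) (snd p)) \<in> measurable (C3 \<Otimes>\<^sub>M \<mu>) C3" "(\<lambda>p. \<phi>2 (fst p) (snd p)) \<in> measurable (C3 \<Otimes>\<^sub>M \<mu>) C3"
    "(\<lambda>p. \<phi>3 (fst p) (snd p)) \<in> measurable (C3 \<Otimes>\<^sub>M \<mu>) C3"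
  proof -
    have eq: "measurable (C3 \<Otimes>\<^sub>M \<mu>) C3 = measurable (C3 \<Otimes>\<^sub>M borel) C3"
      by (intro measurable_cong_sets sets_pair_measure_cong \<mu> refl)
    show "(\<lambda>p. \<phi>1 (fst p) (snd p)) \<in> measurable (C3 \<Otimes>\<^sub>M \<mu>) C3" "(\<lambda>p. \<phi>2 (fst p) (snd p)) \<in> measurable (C3 \<Otimes>\<^sub>M \<mu>) C3"
      "(\<lambda>p. \<phi>3 (fst p) (snd p)) \<in> measurable (C3 \<Otimes>\<^sub>M \<mu>) C3"
      unfolding eq \<phi>1_def \<phi>2_def \<phi>3_def unfolding C3_def by measurable
  qed

  define T where "T \<phi> H p = (\<integral>y. H (\<phi> p y) \<partial>\<mu>)" for \<phi> :: "'a set \<times> 'a set \<times> 'a set \<Rightarrow> 'a \<Rightarrow> 'a set \<times> 'a set \<times> 'a set" and H :: "_ \<Rightarrow> real" and p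
  have bT: "bmeas C3 (T \<phi> H)" if "bmeas C3 H" "(\<lambda>p. \<phi> (fst p) (snd p)) \<in> measurable (C3 \<Otimes>\<^sub>M \<mu>) C3" for H \<phi>
    unfolding T_def by (rule bmeas_integral[OF \<mu>(1)], rule bmeas_compose[OF that])
  have deriv: "((\<lambda>u. \<integral>p. H p \<partial>N u) has_real_derivative
      (\<integral>p. l * (T \<phi>1 H p - H p) + (- l * (T \<phi>2 H p - H p) + (- l * (T \<phi>3 H p - H p) + 0)) \<partial>N u)) (at u within {0..1})"
    if H: "bmeas C3 H" and u: "u \<in> {0..1}" for H u
  proof -
    \<comment> \<open>A product rule by nesting: the last component varies with the point numbers
      \<open>a\<close>, \<open>b\<close> of the other two frozen, then the middle one with
      \<open>a\<close> frozen, finally the first. The derivative found at one stage is the term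
      \<open>D\<close> of the next.\<close>
    have l3: "((\<lambda>u. \<integral>p. H p \<partial>(q1 a \<Otimes>\<^sub>M (q2 b \<Otimes>\<^sub>M Q2 u))) has_real_derivative
      (\<integral>p. - l * (T \<phi>3 H p - H p) + 0 \<partial>(q1 a \<Otimes>\<^sub>M (q2 b \<Otimes>\<^sub>M Q2 u)))) (at u within {0..1})"
      if u: "u \<in> {0..1}" for a b u
      unfolding T_def
    proof (rule poisson_mix_deriv[where L=C3 and q="\<lambda>k u. q1 a \<Otimes>\<^sub>M (q2 b \<Otimes>\<^sub>M q2 k)" and s="\<lambda>u. l + (- l) * u" and a=l])
      show "adds_pt \<mu> \<phi>3 (q1 a \<Otimes>\<^sub>M (q2 b \<Otimes>\<^sub>M q2 (Suc k))) (q1 a \<Otimes>\<^sub>M (q2 b \<Otimes>\<^sub>M q2 k))" for k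
      proof -
        have "adds_pt \<mu> (\<lambda>p y. (fst p, insert y (snd p))) (q2 b \<Otimes>\<^sub>M q2 (Suc k)) (q2 b \<Otimes>\<^sub>M q2 k)"
          by (rule adds_pt_pair_right[OF q(2) q(2) q(2) \<mu>(1) _ addsq(2)]) simp
        from adds_pt_pair_right[OF prob_pair[OF q(2) q(2)] prob_pair[OF q(2) q(2)] q(1) \<mu>(1) _ this]
        show ?thesis
          unfolding \<phi>3_def[abs_def] by (simp cong: sets_pair_measure_cong)
      qed
      show "poisson_mix (l + (- l) * u) (q1 a \<Otimes>\<^sub>M (q2 b \<Otimes>\<^sub>M Q2 u)) (\<lambda>k. q1 a \<Otimes>\<^sub>M (q2 b \<Otimes>\<^sub>M q2 k))" if "u \<in> {0..1}" for u
        by (intro poisson_mix_pair_right mixQ that prob_pair q Q sets_pair_measure_cong refl) simp_all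
    qed (use H u rate in \<open>auto intro!: prob_pair q Q \<mu> bmeas_const sets_pair_measure_cong simp: C3_def\<close>)
    let ?D3 = "\<lambda>p. - l * (T \<phi>3 H p - H p) + 0"
    have D3: "bmeas C3 ?D3"
      by (intro bmeas_add bmeas_mult bmeas_diff bmeas_const bT \<phi>_m H)
    have l2: "((\<lambda>u. \<integral>p. H p \<partial>(q1 a \<Otimes>\<^sub>M (Q2 u \<Otimes>\<^sub>M Q2 u))) has_real_derivative
      (\<integral>p. - l * (T \<phi>2 H p - H p) + ?D3 p \<partial>(q1 a \<Otimes>\<^sub>M (Q2 u \<Otimes>\<^sub>M Q2 u)))) (at u within {0..1})"
      if u: "u \<in> {0..1}" for a u
      unfolding T_def[of \<phi>2]
    proof (rule poisson_mix_deriv[where L=C3 and q="\<lambda>k u. q1 a \<Otimes>\<^sub>M (q2 k \<Otimes>\<^sub>M Q2 u)" and s="\<lambda>u. l + (- l) * u" and a=l])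
      show "adds_pt \<mu> \<phi>2 (q1 a \<Otimes>\<^sub>M (q2 (Suc k) \<Otimes>\<^sub>M Q2 u)) (q1 a \<Otimes>\<^sub>M (q2 k \<Otimes>\<^sub>M Q2 u))" if "u \<in> {0..1}" for k u
      proof -
        have "adds_pt \<mu> (\<lambda>p y. (insert y (fst p), snd p)) (q2 (Suc k) \<Otimes>\<^sub>M Q2 u) (q2 k \<Otimes>\<^sub>M Q2 u)"
          by (rule adds_pt_pair_left[OF q(2) q(2) Q(2)[OF that] \<mu>(1) _ addsq(2)]) simp
        from adds_pt_pair_right[OF prob_pair[OF q(2) Q(2)[OF that]] prob_pair[OF q(2) Q(2)[OF that]] q(1) \<mu>(1) _ this]
        show ?thesis
          unfolding \<phi>2_def[abs_def] by (simp cong: sets_pair_measure_cong)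
      qed
      show "poisson_mix (l + (- l) * u) (q1 a \<Otimes>\<^sub>M (Q2 u \<Otimes>\<^sub>M Q2 u)) (\<lambda>k. q1 a \<Otimes>\<^sub>M (q2 k \<Otimes>\<^sub>M Q2 u))" if "u \<in> {0..1}" for u
        by (intro poisson_mix_pair_right poisson_mix_pair_left mixQ that prob_pair q Q sets_pair_measure_cong refl) simp_all
    qed (use H D3 u rate l3 in \<open>auto intro!: prob_pair q Q \<mu> sets_pair_measure_cong simp: C3_def\<close>)
    let ?D2 = "\<lambda>p. - l * (T \<phi>2 H p - H p) + ?D3 p"
    have D2: "bmeas C3 ?D2"
      by (intro bmeas_add[OF _ D3] bmeas_mult bmeas_diff bmeas_const bT \<phi>_m H)
    show ?thesis
      unfolding T_def[of \<phi>1] N_def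
    proof (rule poisson_mix_deriv[where L=C3 and q="\<lambda>k u. q1 k \<Otimes>\<^sub>M (Q2 u \<Otimes>\<^sub>M Q2 u)" and s="\<lambda>u. 0 + l * u" and a=0])
      show "adds_pt \<mu> \<phi>1 (q1 (Suc k) \<Otimes>\<^sub>M (Q2 u \<Otimes>\<^sub>M Q2 u)) (q1 k \<Otimes>\<^sub>M (Q2 u \<Otimes>\<^sub>M Q2 u))" if "u \<in> {0..1}" for k u
        unfolding \<phi>1_def[abs_def]
        by (rule adds_pt_pair_left[OF q(1) q(1) prob_pair[OF Q(2)[OF that] Q(2)[OF that]] \<mu>(1) _ addsq(1)]) simp
      show "poisson_mix (0 + l * u) (Q1 u \<Otimes>\<^sub>M (Q2 u \<Otimes>\<^sub>M Q2 u)) (\<lambda>k. q1 k \<Otimes>\<^sub>M (Q2 u \<Otimes>\<^sub>M Q2 u))" if "u \<in> {0..1}" for u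
        by (intro poisson_mix_pair_left mixQ that prob_pair q Q) simp_all
    qed (use H D2 u rate l2 in \<open>auto intro!: prob_pair q Q \<mu> sets_pair_measure_cong simp: C3_def\<close>)
  qed
  have rate_void: "l * measure \<mu> B = measure \<nu> (A n \<inter> B)" if B: "B \<in> sets borel" for B
  proof -
    have "ennreal l * emeasure \<mu> B = emeasure \<nu> (A n \<inter> B)"
    proof -
      have "(\<integral>\<^sup>+y. indicator B y * indicator (A n) y \<partial>\<nu>) = (\<integral>\<^sup>+y. indicator (A n \<inter> B) y \<partial>\<nu>)"
        by (intro nn_integral_cong) (simp add: indicator_inter_arith mult.commute)
      also have "\<dots> = emeasure \<nu> (A n \<inter> B)"
        using B by (intro nn_integral_indicator) (simp add: sets_\<nu>)
      finally show ?thesis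
        using l_\<mu>[of "indicator B"] B \<mu>(2) by (simp add: Int_absorb2)
    qed
    then have "enn2real (ennreal l * emeasure \<mu> B) = measure \<nu> (A n \<inter> B)" by (simp add: measure_def)
    then show ?thesis using l by (simp add: enn2real_mult measure_def)
  qed
  have void_\<iota>1: "measure \<iota>1 (void B) = 1" if "B \<in> sets borel" for B
    using void_in_sets[OF that] by (simp add: \<iota>1_def measure_return void_def configurations_empty)
  have void_\<iota>2: "measure \<iota>2 (void B) = exp (- measure \<nu> (B - A n))" if B: "B \<in> sets borel" and fin: "emeasure \<nu> B < \<infinity>" for B
  proof -
    have "(\<lambda>\<omega>. \<omega> - A n) -` void B \<inter> space P = void (B - A n)"
      using sets_eq_imp_space_eq[OF sets_P]
      by (auto simp: void_def space_config_space intro: configurations_subset)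
    moreover have "emeasure \<nu> (B - A n) < \<infinity>"
      using fin B by (intro le_less_trans[OF emeasure_mono[of "B - A n" B \<nu>]]) (auto simp: sets_\<nu>)
    ultimately show ?thesis
      using B void_P[of "B - A n"] by (simp add: \<iota>2_def measure_distr[OF diff_m void_in_sets[OF B]])
  qed
  have void_Q1: "measure (Q1 u) (void B) = exp (- (u * measure \<nu> (A n \<inter> B)))" if "B \<in> sets borel" "u \<in> {0..1}" for B u
    using measure_add_poisson_void[OF \<mu> \<iota>1 that(1) rate(1)[OF that(2)]] rate_void[OF that(1)]
    by (simp add: Q1_def void_\<iota>1[OF that(1)] algebra_simps)
  have void_Q2: "measure (Q2 u) (void B) = exp (- (measure \<nu> (B - A n) + (1 - u) * measure \<nu> (A n \<inter> B)))"
    if B: "B \<in> sets borel" and fin: "emeasure \<nu> B < \<infinity>" and u: "u \<in> {0..1}" for B u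
  proof -
    have "- (l + - l * u) * measure \<mu> B = - ((1 - u) * (l * measure \<mu> B))" by (simp add: algebra_simps)
    then show ?thesis
      using measure_add_poisson_void[OF \<mu> \<iota>2 B rate(2)[OF u]]
      unfolding Q2_def void_\<iota>2[OF B fin] rate_void[OF B] by (simp add: exp_add[symmetric])
  qed
  have split_\<nu>: "measure \<nu> B = measure \<nu> (A n \<inter> B) + measure \<nu> (B - A n)"
    if B: "B \<in> sets borel" and fin: "emeasure \<nu> B < \<infinity>" for B
  proof -
    have "emeasure \<nu> (A n \<inter> B) \<noteq> \<infinity>" "emeasure \<nu> (B - A n) \<noteq> \<infinity>"
      using fin B emeasure_mono[of "A n \<inter> B" B \<nu>] emeasure_mono[of "B - A n" B \<nu>] by (auto simp: sets_\<nu> top_unique)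
    then have "measure \<nu> ((A n \<inter> B) \<union> (B - A n)) = measure \<nu> (A n \<inter> B) + measure \<nu> (B - A n)"
      using B by (intro measure_Union) (auto simp: sets_\<nu>)
    moreover have "(A n \<inter> B) \<union> (B - A n) = B" by auto
    ultimately show ?thesis by simp
  qed
  have fin_bounded: "emeasure \<nu> B < \<infinity>" if "B \<subseteq> A m" for B m
    using that finite_\<nu>[of m] by (intro le_less_trans[OF emeasure_mono[of B "A m" \<nu>]]) (auto simp: sets_\<nu>)
  have Q2_0: "Q2 0 = P"
  proof (rule measure_eqI_void)
    show "measure (Q2 0) (void B) = measure P (void B)" if "B \<in> sets borel" "B \<subseteq> A m" for B m
      using that fin_bounded[OF that(2)] void_Q2[of B 0] split_\<nu>[of B] void_P[of B] by simp
  qed (simp_all add: Q prob_P sets_P)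

  define U1 where "U1 p = fst p \<union> fst (snd p)" for p :: "'a set \<times> 'a set \<times> 'a set"
  define U2 where "U2 p = fst p \<union> snd (snd p)" for p :: "'a set \<times> 'a set \<times> 'a set"
  have U_C3: "U1 \<in> measurable C3 C" "U2 \<in> measurable C3 C"
    unfolding U1_def[abs_def] U2_def[abs_def] C3_def by measurable
  then have U_N: "U1 \<in> measurable (N u) C" "U2 \<in> measurable (N u) C" for u
    by (simp_all add: measurable_cong_sets[OF sN refl])
  have spQ: "space (Q1 u) = configurations" "space (Q2 u) = configurations" for u
    using sets_eq_imp_space_eq[OF sQ(1)] sets_eq_imp_space_eq[OF sQ(2)] by (simp_all add: space_config_space)
  have spN: "space (N u) = configurations \<times> configurations \<times> configurations" for u
    by (simp add: N_def space_pair_measure spQ)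
  have measure_N: "measure (N u) (X \<times> Y \<times> W) = measure (Q1 u) X * (measure (Q2 u) Y * measure (Q2 u) W)"
    if "X \<in> sets C" "Y \<in> sets C" "W \<in> sets C" "u \<in> {0..1}" for X Y W u
    unfolding N_def using that Q[OF that(4)] by (simp add: measure_pair_Times prob_pair)
  have full: "measure (Q1 u) configurations = 1" "measure (Q2 u) configurations = 1" "configurations \<in> sets C" if "u \<in> {0..1}" for u
    using prob_space.prob_space[OF Q(1)[OF that]] prob_space.prob_space[OF Q(2)[OF that]] sets.top[of C]
    by (simp_all add: spQ space_config_space)
  \<comment> \<open>On \<open>A n\<close> the intensities \<open>u \<nu>\<close> of the common part
    and \<open>(1 - u) \<nu>\<close> of a private part add up to \<open>\<nu>\<close>, so the void
    probabilities of each union do not depend on \<open>u\<close>.\<close>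
  have marginal: "distr (N u) C U1 = P" "distr (N u) C U2 = P" if u: "u \<in> {0..1}" for u
  proof -
    have void_prod: "measure (Q1 u) (void B) * measure (Q2 u) (void B) = measure P (void B)"
      if "B \<in> sets borel" "B \<subseteq> A m" for B m
      unfolding void_Q1[OF that(1) u] void_Q2[OF that(1) fin_bounded[OF that(2)] u]
      using void_P[OF that(1) fin_bounded[OF that(2)]] split_\<nu>[OF that(1) fin_bounded[OF that(2)]]
      by (simp add: exp_add[symmetric] algebra_simps)
    show "distr (N u) C U1 = P"
    proof (rule measure_eqI_void)
      fix B m assume B: "B \<in> sets borel" "B \<subseteq> A m"
      have "U1 -` void B \<inter> space (N u) = void B \<times> void B \<times> configurations"
        by (auto simp: spN void_def U1_def intro: configurations_union)
      then show "measure (distr (N u) C U1) (void B) = measure P (void B)"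
        using B u measure_N[OF void_in_sets[OF B(1)] void_in_sets[OF B(1)] full(3)[OF u] u]
        by (simp add: measure_distr[OF U_N(1) void_in_sets] full[OF u] void_prod[OF B])
    qed (simp_all add: prob_P sets_P prob_space.prob_space_distr[OF N[OF u] U_N(1)])
    show "distr (N u) C U2 = P"
    proof (rule measure_eqI_void)
      fix B m assume B: "B \<in> sets borel" "B \<subseteq> A m"
      have "U2 -` void B \<inter> space (N u) = void B \<times> configurations \<times> void B"
        by (auto simp: spN void_def U2_def intro: configurations_union)
      then show "measure (distr (N u) C U2) (void B) = measure P (void B)"
        using B u measure_N[OF void_in_sets[OF B(1)] full(3)[OF u] void_in_sets[OF B(1)] u]
        by (simp add: measure_distr[OF U_N(2) void_in_sets] full[OF u] void_prod[OF B])
    qed (simp_all add: prob_P sets_P prob_space.prob_space_distr[OF N[OF u] U_N(2)])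
  qed

  define R where "R = distr (N 1) (C \<Otimes>\<^sub>M C) (\<lambda>p. (U1 p, U2 p))"
  have UU: "(\<lambda>p. (U1 p, U2 p)) \<in> measurable (N 1) (C \<Otimes>\<^sub>M C)"
    by (intro measurable_Pair U_N)
  show ?thesis
  proof (rule that[of R])
    show sR: "sets R = sets (C \<Otimes>\<^sub>M C)" by (simp add: R_def)
    show "distr R C fst = P" "distr R C snd = P"
      using marginal[of 1] by (simp_all add: R_def distr_distr[OF _ UU] comp_def)
    show "AE p in R. fst p \<in> void B \<longleftrightarrow> snd p \<in> void B" if B: "B \<in> sets borel" "B \<subseteq> A n" for B
    proof -
      interpret N1: prob_space "N 1" by (rule N) simp
      \<comment> \<open>At u = 1 the private components have rate 0 and almost surely leave
        \<open>A n\<close> empty, so all points seen there are common.\<close>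
      have "measure (N 1) (configurations \<times> void (A n) \<times> void (A n)) = 1"
        using measure_N[OF full(3) void_in_sets[OF A_sets] void_in_sets[OF A_sets], of 1 1 n n]
          void_Q2[OF A_sets finite_\<nu>, of 1 n] full[of 1] by simp
      then have "AE p in N 1. p \<in> configurations \<times> void (A n) \<times> void (A n)"
        by (rule N1.AE_prob_1)
      then have "AE p in N 1. U1 p \<in> void B \<longleftrightarrow> U2 p \<in> void B"
      proof eventually_elim
        case (elim p)
        then have "fst (snd p) \<inter> B = {}" "snd (snd p) \<inter> B = {}" "fst (snd p) \<in> configurations"
          "snd (snd p) \<in> configurations" "fst p \<in> configurations"
          using B(2) by (auto simp: void_def mem_Times_iff)
        then show ?case
          by (auto simp: U1_def U2_def void_def Int_Un_distrib2 intro: configurations_union)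
      qed
      moreover have "{p \<in> space (C \<Otimes>\<^sub>M C). fst p \<in> void B \<longleftrightarrow> snd p \<in> void B} \<in> sets (C \<Otimes>\<^sub>M C)"
        using void_in_sets[OF B(1)] by measurable
      ultimately show ?thesis
        unfolding R_def by (subst AE_distr_iff[OF UU]) simp_all
    qed
    fix F G Z :: "'a set \<Rightarrow> real" and good
    assume F: "bmeas C F" and G: "bmeas C G" and Z: "bmeas C Z" "\<And>\<omega>. 0 \<le> Z \<omega>"
      and good: "AE \<omega> in P. good \<omega>"
      and bound: "\<And>\<omega> \<omega>'. \<omega> \<in> configurations \<Longrightarrow> \<omega>' \<in> configurations \<Longrightarrow> good \<omega> \<Longrightarrow> good \<omega>' \<Longrightarrow>
        (\<integral>\<^sup>+y. ennreal \<bar>diff_op F y \<omega> * diff_op G y \<omega>'\<bar> \<partial>\<nu>) \<le> ennreal (Z \<omega>')"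
    define H where "H p = F (U1 p) * G (U2 p)" for p
    have H: "bmeas C3 H"
      unfolding H_def[abs_def] by (intro bmeas_mult bmeas_compose[OF F U_C3(1)] bmeas_compose[OF G U_C3(2)])
    define E where "E p = l * (T \<phi>1 H p - H p) + (- l * (T \<phi>2 H p - H p) + (- l * (T \<phi>3 H p - H p) + 0))" for p
    have E: "bmeas C3 E"
      unfolding E_def by (intro bmeas_add bmeas_mult bmeas_diff bmeas_const bT \<phi>_m H)
    \<comment> \<open>The mean value theorem does the work of integrating over \<open>u\<close>: the
      bound on the derivative is the same at every \<open>u\<close>, so a single intermediate
      \<open>\<xi>\<close> is enough.\<close>
    have "\<exists>\<xi>\<in>{0..1}. (\<integral>p. H p \<partial>N 1) - (\<integral>p. H p \<partial>N 0) = (\<integral>p. E p \<partial>N \<xi>) * (1 - 0)"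
    proof (rule mvt_very_simple)
      fix u :: real assume "0 \<le> u" "u \<le> 1"
      then show "((\<lambda>u. \<integral>p. H p \<partial>N u) has_derivative (\<lambda>h. (\<integral>p. E p \<partial>N u) * h)) (at u within {0..1})"
        using deriv[OF H, of u] unfolding has_field_derivative_def E_def by simp
    qed simp
    then obtain \<xi> where \<xi>: "\<xi> \<in> {0..1}" "(\<integral>p. H p \<partial>N 1) - (\<integral>p. H p \<partial>N 0) = (\<integral>p. E p \<partial>N \<xi>)"
      by auto
    have H1: "(\<integral>p. H p \<partial>N 1) = (\<integral>p. F (fst p) * G (snd p) \<partial>R)"
    proof -
      have "(\<lambda>p. F (fst p) * G (snd p)) \<in> borel_measurable (C \<Otimes>\<^sub>M C)"
        using bmeas_measurable[OF F] bmeas_measurable[OF G] by measurable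
      then show ?thesis
        unfolding R_def by (subst integral_distr[OF UU]) (simp_all add: H_def[abs_def])
    qed
    \<comment> \<open>At u = 0 the common part is empty and the two private parts are independent
      copies of \<open>P\<close>.\<close>
    have H0: "(\<integral>p. H p \<partial>N 0) = (\<integral>\<omega>. F \<omega> \<partial>P) * (\<integral>\<omega>. G \<omega> \<partial>P)"
    proof -
      have Q10: "Q1 0 = return C {}"
        using add_poisson_0[OF \<mu> \<iota>1] by (simp add: Q1_def \<iota>1_def)
      have bH: "bmeas (return C {} \<Otimes>\<^sub>M (P \<Otimes>\<^sub>M P)) H"
        using H by (subst bmeas_cong_sets[OF sets_pair_measure_cong[OF sets_return sets_pair_measure_cong[OF sets_P sets_P]]]) (simp add: C3_def)
      have g: "bmeas C (\<lambda>x. \<integral>y. H (x, y) \<partial>(P \<Otimes>\<^sub>M P))"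
      proof (rule bmeas_integral[OF prob_pair[OF prob_P prob_P]])
        show "bmeas (C \<Otimes>\<^sub>M (P \<Otimes>\<^sub>M P)) (\<lambda>p. H (fst p, snd p))"
          using H by (subst bmeas_cong_sets[OF sets_pair_measure_cong[OF refl sets_pair_measure_cong[OF sets_P sets_P]]]) (simp add: C3_def)
      qed
      have "(\<integral>p. H p \<partial>N 0) = (\<integral>x. \<integral>y. H (x, y) \<partial>(P \<Otimes>\<^sub>M P) \<partial>return C {})"
        unfolding N_def Q10 Q2_0
        by (rule bmeas_integral_fst[OF _ prob_pair[OF prob_P prob_P] bH])
          (simp add: prob_space_return space_config_space configurations_empty)
      also have "\<dots> = (\<integral>y. H ({}, y) \<partial>(P \<Otimes>\<^sub>M P))"
        by (rule integral_return[OF _ bmeas_measurable[OF g]]) (simp add: space_config_space configurations_empty)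
      also have "\<dots> = (\<integral>y. F (fst y) * G (snd y) \<partial>(P \<Otimes>\<^sub>M P))"
        by (simp add: H_def U1_def U2_def)
      also have "\<dots> = (\<integral>\<omega>. \<integral>\<omega>'. F \<omega> * G \<omega>' \<partial>P \<partial>P)"
      proof -
        have "bmeas (P \<Otimes>\<^sub>M P) (\<lambda>y. F (fst y) * G (snd y))"
          using F G bmeas_cong_sets[OF sets_P]
          by (intro bmeas_mult bmeas_compose[OF _ measurable_fst] bmeas_compose[OF _ measurable_snd]) simp_all
        from bmeas_integral_fst[OF prob_P prob_P this] show ?thesis by simp
      qed
      finally show ?thesis by simp
    qed
    have E_le: "E p \<le> Z (U2 p)" if p: "p \<in> space (N \<xi>)" and gd: "good (U1 p)" "good (U2 p)" for p
    proof -
      let ?\<omega> = "U1 p" and ?\<omega>' = "U2 p"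
      have conf: "?\<omega> \<in> configurations" "?\<omega>' \<in> configurations"
        using measurable_space[OF U_N(1) p] measurable_space[OF U_N(2) p] by (simp_all add: space_config_space)
      have ins: "(\<lambda>y. insert y \<omega>) \<in> measurable \<mu> C" if "\<omega> \<in> configurations" for \<omega>
        using that measurable_cong_sets[OF \<mu>(2) refl, of C]
        by (simp add: measurable_insert_config space_config_space)
      let ?k = "\<lambda>y. diff_op F y ?\<omega> * diff_op G y ?\<omega>'"
      have bF: "bmeas \<mu> (\<lambda>y. F (insert y ?\<omega>))" and bG: "bmeas \<mu> (\<lambda>y. G (insert y ?\<omega>'))"
        using bmeas_compose[OF F ins[OF conf(1)]] bmeas_compose[OF G ins[OF conf(2)]] .
      note int = bmeas_integrable[OF \<mu>(1)]
      have bk: "bmeas \<mu> ?k"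
        unfolding diff_op_def by (simp, intro bmeas_mult bmeas_diff bF bG bmeas_const)
      have T1: "T \<phi>1 H p = (\<integral>y. F (insert y ?\<omega>) * G (insert y ?\<omega>') \<partial>\<mu>)"
        by (simp add: T_def H_def \<phi>1_def U1_def U2_def)
      have T2: "T \<phi>2 H p = (\<integral>y. F (insert y ?\<omega>) * G ?\<omega>' \<partial>\<mu>)"
        by (simp add: T_def H_def \<phi>2_def U1_def U2_def)
      have T3: "T \<phi>3 H p = (\<integral>y. F ?\<omega> * G (insert y ?\<omega>') \<partial>\<mu>)"
        by (simp add: T_def H_def \<phi>3_def U1_def U2_def)
      \<comment> \<open>A common point moves both arguments, a private one a single argument. With
        rates \<open>l\<close>, \<open>- l\<close>, \<open>- l\<close> the terms combine to
        \<open>l\<close> times \<open>T \<phi>1 H - T \<phi>2 H - T \<phi>3 H + H\<close>, which is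
        the average of a product of two increments.\<close>
      have "(\<integral>y. ?k y \<partial>\<mu>) = (\<integral>y. F (insert y ?\<omega>) * G (insert y ?\<omega>') - F (insert y ?\<omega>) * G ?\<omega>' - (F ?\<omega> * G (insert y ?\<omega>') - F ?\<omega> * G ?\<omega>') \<partial>\<mu>)"
        by (simp add: diff_op_def algebra_simps)
      also have "\<dots> = T \<phi>1 H p - T \<phi>2 H p - (T \<phi>3 H p - H p)"
      proof -
        have i: "integrable \<mu> (\<lambda>y. F (insert y ?\<omega>) * G (insert y ?\<omega>'))" "integrable \<mu> (\<lambda>y. F (insert y ?\<omega>) * G ?\<omega>')"
          "integrable \<mu> (\<lambda>y. F ?\<omega> * G (insert y ?\<omega>'))" "integrable \<mu> (\<lambda>y. F ?\<omega> * G ?\<omega>')"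
          by (intro int bmeas_mult bmeas_const bF bG)+
        note idiff = Bochner_Integration.integral_diff and ddiff = Bochner_Integration.integrable_diff
        show ?thesis
          unfolding T1 T2 T3 idiff[OF ddiff[OF i(1,2)] ddiff[OF i(3,4)]] idiff[OF i(1,2)] idiff[OF i(3,4)]
          by (simp add: H_def \<mu>.prob_space)
      qed
      finally have k_eq: "(\<integral>y. ?k y \<partial>\<mu>) = T \<phi>1 H p - T \<phi>2 H p - (T \<phi>3 H p - H p)" .
      have "E p = l * (\<integral>y. ?k y \<partial>\<mu>)"
        unfolding k_eq E_def by (simp add: algebra_simps)
      also have "\<dots> \<le> l * (\<integral>y. \<bar>?k y\<bar> \<partial>\<mu>)"
        using l int[OF bk] by (intro mult_left_mono integral_mono) auto
      also have "\<dots> \<le> Z ?\<omega>'"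
      proof -
        have kb: "?k \<in> borel_measurable borel"
          using bmeas_measurable[OF bk] measurable_cong_sets[OF \<mu>(2) refl, of "borel :: real measure"] by simp
        have "ennreal (l * (\<integral>y. \<bar>?k y\<bar> \<partial>\<mu>)) = ennreal l * (\<integral>\<^sup>+y. ennreal \<bar>?k y\<bar> \<partial>\<mu>)"
          using l int[OF bk] by (simp add: ennreal_mult nn_integral_eq_integral)
        also have "\<dots> = (\<integral>\<^sup>+y. ennreal \<bar>?k y\<bar> * indicator (A n) y \<partial>\<nu>)"
          using kb by (intro l_\<mu>) simp
        \<comment> \<open>Passing from \<open>A n\<close> to the whole space makes the bound
          independent of \<open>n\<close>.\<close>
        also have "\<dots> \<le> (\<integral>\<^sup>+y. ennreal \<bar>?k y\<bar> \<partial>\<nu>)"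
          by (intro nn_integral_mono) (simp add: indicator_def)
        also have "\<dots> \<le> ennreal (Z ?\<omega>')" by (rule bound[OF conf gd])
        finally show ?thesis using Z(2) by (simp add: ennreal_le_iff)
      qed
      finally show ?thesis .
    qed
    \<comment> \<open>The exceptional set is null for \<open>P\<close>, hence null for each member
      of the pair separately. This is what accommodates the essential supremum.\<close>
    have good_N: "AE p in N \<xi>. good (U1 p)" "AE p in N \<xi>. good (U2 p)"
      by (rule AE_distrD[OF U_N(1)[of \<xi>], of good], simp only: marginal[OF \<xi>(1)] good)
        (rule AE_distrD[OF U_N(2)[of \<xi>], of good], simp only: marginal[OF \<xi>(1)] good)
    have "(\<integral>p. E p \<partial>N \<xi>) \<le> (\<integral>p. Z (U2 p) \<partial>N \<xi>)"
    proof (rule integral_mono_AE)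
      show "integrable (N \<xi>) E"
        using E bmeas_cong_sets[OF sN] by (intro bmeas_integrable[OF N[OF \<xi>(1)]]) simp
      show "integrable (N \<xi>) (\<lambda>p. Z (U2 p))"
        by (intro bmeas_integrable[OF N[OF \<xi>(1)]] bmeas_compose[OF Z(1) U_N(2)])
      show "AE p in N \<xi>. E p \<le> Z (U2 p)"
        using good_N AE_space[of "N \<xi>"] by eventually_elim (rule E_le)
    qed
    also have "\<dots> = (\<integral>\<omega>. Z \<omega> \<partial>distr (N \<xi>) C U2)"
      by (rule integral_distr[OF U_N(2) bmeas_measurable[OF Z(1)], symmetric])
    also have "\<dots> = (\<integral>\<omega>. Z \<omega> \<partial>P)" by (simp add: marginal[OF \<xi>(1)])
    finally show "(\<integral>p. F (fst p) * G (snd p) \<partial>R) - (\<integral>\<omega>. F \<omega> \<partial>P) * (\<integral>\<omega>. G \<omega> \<partial>P) \<le> (\<integral>\<omega>. Z \<omega> \<partial>P)"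
      using \<xi>(2) by (simp add: H1 H0)
  qed
qed

text \<open>In the couplings of \<open>interpolated_coupling\<close> the second copy matches the
  first on \<open>A n\<close> only. As \<open>n\<close> grows, the values of \<open>G\<close> at the
  two copies merge in L1 by \<open>coupling_L1_limit\<close>, and boundedness of \<open>F\<close>
  carries this over to the product, so the mixed expectation tends to that of
  \<open>F * G\<close>.\<close>

lemma covariance_le:
  assumes F: "bmeas C F" and G: "bmeas C G" and Z: "bmeas C Z" "\<And>\<omega>. 0 \<le> Z \<omega>"
    and good: "AE \<omega> in P. good \<omega>"
    and bound: "\<And>\<omega> \<omega>'. \<omega> \<in> configurations \<Longrightarrow> \<omega>' \<in> configurations \<Longrightarrow> good \<omega> \<Longrightarrow> good \<omega>' \<Longrightarrow>
        (\<integral>\<^sup>+y. ennreal \<bar>diff_op F y \<omega> * diff_op G y \<omega>'\<bar> \<partial>\<nu>) \<le> ennreal (Z \<omega>')"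
  shows "(\<integral>\<omega>. F \<omega> * G \<omega> \<partial>P) - (\<integral>\<omega>. F \<omega> \<partial>P) * (\<integral>\<omega>. G \<omega> \<partial>P) \<le> (\<integral>\<omega>. Z \<omega> \<partial>P)"
proof -
  interpret P: prob_space P by (rule prob_P)
  define coupling where "coupling n R \<longleftrightarrow> sets R = sets (C \<Otimes>\<^sub>M C) \<and> distr R C fst = P \<and> distr R C snd = P \<and>
     (\<forall>B\<in>sets borel. B \<subseteq> A n \<longrightarrow> (AE p in R. fst p \<in> void B \<longleftrightarrow> snd p \<in> void B)) \<and>
     (\<integral>p. F (fst p) * G (snd p) \<partial>R) - (\<integral>\<omega>. F \<omega> \<partial>P) * (\<integral>\<omega>. G \<omega> \<partial>P) \<le> (\<integral>\<omega>. Z \<omega> \<partial>P)" for n R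
  have "\<exists>R. coupling n R" for n
  proof (rule interpolated_coupling[of n])
    fix R assume R: "sets R = sets (C \<Otimes>\<^sub>M C)" "distr R C fst = P" "distr R C snd = P"
      "\<And>B. B \<in> sets borel \<Longrightarrow> B \<subseteq> A n \<Longrightarrow> AE p in R. fst p \<in> void B \<longleftrightarrow> snd p \<in> void B"
      and le: "\<And>F G Z good. bmeas C F \<Longrightarrow> bmeas C G \<Longrightarrow> bmeas C Z \<Longrightarrow> (\<And>\<omega>. 0 \<le> Z \<omega>) \<Longrightarrow>
      (AE \<omega> in P. good \<omega>) \<Longrightarrow>
      (\<And>\<omega> \<omega>'. \<omega> \<in> configurations \<Longrightarrow> \<omega>' \<in> configurations \<Longrightarrow> good \<omega> \<Longrightarrow> good \<omega>' \<Longrightarrow>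
        (\<integral>\<^sup>+y. ennreal \<bar>diff_op F y \<omega> * diff_op G y \<omega>'\<bar> \<partial>\<nu>) \<le> ennreal (Z \<omega>')) \<Longrightarrow>
      (\<integral>p. F (fst p) * G (snd p) \<partial>R) - (\<integral>\<omega>. F \<omega> \<partial>P) * (\<integral>\<omega>. G \<omega> \<partial>P) \<le> (\<integral>\<omega>. Z \<omega> \<partial>P)"
    show ?thesis
      unfolding coupling_def using R by (intro exI[of _ R] conjI ballI impI le[OF F G Z good bound]) simp_all
  qed
  then have "\<forall>n. \<exists>R. coupling n R" ..
  from choice[OF this] obtain R where "\<forall>n. coupling n (R n)" ..
  then have R: "\<And>n. sets (R n) = sets (C \<Otimes>\<^sub>M C)" "\<And>n. distr (R n) C fst = P" "\<And>n. distr (R n) C snd = P"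
      "\<And>n B. B \<in> sets borel \<Longrightarrow> B \<subseteq> A n \<Longrightarrow> AE p in R n. fst p \<in> void B \<longleftrightarrow> snd p \<in> void B"
    and le: "\<And>n. (\<integral>p. F (fst p) * G (snd p) \<partial>R n) - (\<integral>\<omega>. F \<omega> \<partial>P) * (\<integral>\<omega>. G \<omega> \<partial>P) \<le> (\<integral>\<omega>. Z \<omega> \<partial>P)"
    unfolding coupling_def by simp_all
  obtain M where M: "0 \<le> M" "\<And>\<omega>. \<bar>F \<omega>\<bar> \<le> M" using F by (rule bmeasE) blast
  obtain c where c: "\<And>\<omega>. \<bar>G \<omega>\<bar> \<le> c" using G by (rule bmeasE) blast
  have mfs: "fst \<in> measurable (R n) C" "snd \<in> measurable (R n) C" for n
    using measurable_cong_sets[OF R(1) refl, of n C] by simp_all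
  have prob_R: "prob_space (R n)" for n
    by (rule prob_space_distrD[OF mfs(1)]) (simp add: R(2) prob_P)
  have bP: "bmeas P f \<longleftrightarrow> bmeas C f" for f by (rule bmeas_cong_sets[OF sets_P])
  have bc: "bmeas C (\<lambda>\<omega>. G \<omega> + c)" by (intro bmeas_add G bmeas_const)
  \<comment> \<open>\<open>coupling_L1_limit\<close> is about non-negative functions; adding
    \<open>c\<close> arranges this and cancels in the differences.\<close>
  have lim: "(\<lambda>n. \<integral>p. \<bar>(G (fst p) + c) - (G (snd p) + c)\<bar> \<partial>R n) \<longlonglongrightarrow> 0"
  proof (rule coupling_L1_limit[OF prob_P sets_P R(1-3)])
    show "AE p in R n. fst p \<in> void B \<longleftrightarrow> snd p \<in> void B" if "m \<le> n" "B \<in> sets borel" "B \<subseteq> A m" for m n B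
      using that incseqD[OF A_incseq that(1)] by (intro R(4)) auto
    show "(\<lambda>\<omega>. G \<omega> + c) \<in> borel_measurable P" "integrable P (\<lambda>\<omega>. G \<omega> + c)"
      using bc by (auto simp: bP intro!: bmeas_measurable bmeas_integrable prob_P)
    show "0 \<le> G \<omega> + c" for \<omega> using c[of \<omega>] by linarith
  qed
  have diff: "\<bar>(\<integral>\<omega>. F \<omega> * G \<omega> \<partial>P) - (\<integral>p. F (fst p) * G (snd p) \<partial>R n)\<bar> \<le> M * (\<integral>p. \<bar>(G (fst p) + c) - (G (snd p) + c)\<bar> \<partial>R n)" for n
  proof -
    have bR: "bmeas (R n) (\<lambda>p. F (fst p))" "bmeas (R n) (\<lambda>p. G (fst p))" "bmeas (R n) (\<lambda>p. G (snd p))"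
      by (rule bmeas_compose[OF F mfs(1)], rule bmeas_compose[OF G mfs(1)], rule bmeas_compose[OF G mfs(2)])
    note int = bmeas_integrable[OF prob_R]
    have "(\<integral>\<omega>. F \<omega> * G \<omega> \<partial>P) = (\<integral>p. F (fst p) * G (fst p) \<partial>R n)"
      by (subst R(2)[of n, symmetric], rule integral_distr[OF mfs(1) bmeas_measurable[OF bmeas_mult[OF F G]]])
    then have "(\<integral>\<omega>. F \<omega> * G \<omega> \<partial>P) - (\<integral>p. F (fst p) * G (snd p) \<partial>R n) = (\<integral>p. F (fst p) * (G (fst p) - G (snd p)) \<partial>R n)"
      using int[OF bmeas_mult[OF bR(1,2)]] int[OF bmeas_mult[OF bR(1,3)]] by (simp add: right_diff_distrib)
    also have "\<bar>\<dots>\<bar> \<le> (\<integral>p. \<bar>F (fst p) * (G (fst p) - G (snd p))\<bar> \<partial>R n)" by (rule integral_abs_bound)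
    also have "\<dots> \<le> (\<integral>p. M * \<bar>(G (fst p) + c) - (G (snd p) + c)\<bar> \<partial>R n)"
    proof (rule integral_mono)
      show "integrable (R n) (\<lambda>p. \<bar>F (fst p) * (G (fst p) - G (snd p))\<bar>)"
        by (rule integrable_abs[OF int[OF bmeas_mult[OF bR(1) bmeas_diff[OF bR(2,3)]]]])
      show "integrable (R n) (\<lambda>p. M * \<bar>(G (fst p) + c) - (G (snd p) + c)\<bar>)"
        using int[OF bmeas_diff[OF bR(2,3)]] by simp
    qed (use M in \<open>simp add: abs_mult mult_right_mono\<close>)
    finally show ?thesis by simp
  qed
  have "(\<lambda>n. M * (\<integral>p. \<bar>(G (fst p) + c) - (G (snd p) + c)\<bar> \<partial>R n)) \<longlonglongrightarrow> M * 0"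
    by (intro tendsto_mult tendsto_const lim)
  then have lim0: "(\<lambda>n. M * (\<integral>p. \<bar>(G (fst p) + c) - (G (snd p) + c)\<bar> \<partial>R n)) \<longlonglongrightarrow> 0" by simp
  have "(\<integral>\<omega>. F \<omega> * G \<omega> \<partial>P) - (\<integral>\<omega>. F \<omega> \<partial>P) * (\<integral>\<omega>. G \<omega> \<partial>P) - (\<integral>\<omega>. Z \<omega> \<partial>P) \<le> 0"
  proof (rule LIMSEQ_le_const[OF lim0], intro exI allI impI)
    fix n
    show "(\<integral>\<omega>. F \<omega> * G \<omega> \<partial>P) - (\<integral>\<omega>. F \<omega> \<partial>P) * (\<integral>\<omega>. G \<omega> \<partial>P) - (\<integral>\<omega>. Z \<omega> \<partial>P) \<le> M * (\<integral>p. \<bar>(G (fst p) + c) - (G (snd p) + c)\<bar> \<partial>R n)"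
      using diff[of n] le[of n] by linarith
  qed
  then show ?thesis by simp
qed

end

section \<open>Exponential moments\<close>

lemma abs_exp_minus_one_le: "\<bar>exp z - 1\<bar> \<le> \<bar>z\<bar> * exp \<bar>z\<bar>" for z :: real
proof (cases "0 \<le> z")
  case True
  have "(1 - z) * exp z \<le> exp (- z) * exp z"
    using exp_ge_add_one_self[of "- z"] by (intro mult_right_mono) auto
  also have "\<dots> = 1" by (simp add: exp_add[symmetric])
  finally show ?thesis using True by (simp add: algebra_simps)
next
  case False
  then have "1 - exp z \<le> \<bar>z\<bar> * 1" using exp_ge_add_one_self[of z] by linarith
  also have "\<dots> \<le> \<bar>z\<bar> * exp \<bar>z\<bar>" by (intro mult_left_mono) auto
  finally show ?thesis using False by simp
qed

text \<open>The weight \<open>Y\<close> lets the lemma serve twice: \<open>Y = 1\<close>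
  differentiates the Laplace transform, and \<open>Y = X\<close> differentiates its derivative,
  which gives the continuity that the fundamental theorem of calculus asks for.\<close>

lemma exp_moment_deriv:
  assumes M: "prob_space M" and X: "bmeas M X" and Y: "bmeas M Y"
  shows "((\<lambda>s. \<integral>x. Y x * exp (s * X x) \<partial>M) has_real_derivative (\<integral>x. Y x * X x * exp (s * X x) \<partial>M)) (at s)"
  unfolding DERIV_def tendsto_at_iff_sequentially comp_def
proof (intro allI impI)
  interpret prob_space M by fact
  obtain B where B: "0 \<le> B" "\<And>x. \<bar>X x\<bar> \<le> B" using X by (rule bmeasE) blast
  obtain D where D: "0 \<le> D" "\<And>x. \<bar>Y x\<bar> \<le> D" using Y by (rule bmeasE) blast
  note [measurable] = bmeas_measurable[OF X] bmeas_measurable[OF Y]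
  have exp_le: "exp (s * X x) \<le> exp (\<bar>s\<bar> * B)" for s x
  proof -
    have "s * X x \<le> \<bar>s\<bar> * \<bar>X x\<bar>" by (metis abs_ge_self abs_mult)
    also have "\<dots> \<le> \<bar>s\<bar> * B" by (intro mult_left_mono B) simp
    finally show ?thesis by simp
  qed
  have int: "integrable M (\<lambda>x. Y x * exp (s * X x))" for s
  proof (rule integrable_const_bound[of _ "D * exp (\<bar>s\<bar> * B)"])
    show "AE x in M. norm (Y x * exp (s * X x)) \<le> D * exp (\<bar>s\<bar> * B)"
      using D exp_le by (intro AE_I2) (simp add: abs_mult mult_mono)
  qed measurable
  fix h :: "nat \<Rightarrow> real" assume h0: "\<forall>i. h i \<in> UNIV - {0}" and h: "h \<longlonglongrightarrow> 0"
  obtain K where K: "\<And>i. \<bar>h i\<bar> \<le> K"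
    using convergent_imp_Bseq[OF convergentI[OF h]] by (auto simp: Bseq_def)
  have eq: "((\<integral>x. Y x * exp ((s + h i) * X x) \<partial>M) - (\<integral>x. Y x * exp (s * X x) \<partial>M)) / h i
      = (\<integral>x. Y x * exp (s * X x) * ((exp (h i * X x) - 1) / h i) \<partial>M)" for i
  proof -
    have "((\<integral>x. Y x * exp ((s + h i) * X x) \<partial>M) - (\<integral>x. Y x * exp (s * X x) \<partial>M)) / h i
        = (\<integral>x. (Y x * exp ((s + h i) * X x) - Y x * exp (s * X x)) / h i \<partial>M)"
      using int[of "s + h i"] int[of s] by simp
    also have "\<dots> = (\<integral>x. Y x * exp (s * X x) * ((exp (h i * X x) - 1) / h i) \<partial>M)"
      by (intro Bochner_Integration.integral_cong refl) (simp add: exp_add algebra_simps)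
    finally show ?thesis .
  qed
  show "(\<lambda>i. ((\<integral>x. Y x * exp ((s + h i) * X x) \<partial>M) - (\<integral>x. Y x * exp (s * X x) \<partial>M)) / h i)
      \<longlonglongrightarrow> (\<integral>x. Y x * X x * exp (s * X x) \<partial>M)"
    unfolding eq
  proof (rule integral_dominated_convergence[where w="\<lambda>_. D * exp (\<bar>s\<bar> * B) * (B * exp (K * B))"])
    show "AE x in M. (\<lambda>i. Y x * exp (s * X x) * ((exp (h i * X x) - 1) / h i)) \<longlonglongrightarrow> Y x * X x * exp (s * X x)"
    proof (intro AE_I2)
      fix x
      have "((\<lambda>s. exp (s * X x)) has_real_derivative X x) (at 0)"
        by (auto intro!: derivative_eq_intros)
      then have "(\<lambda>i. (exp (h i * X x) - 1) / h i) \<longlonglongrightarrow> X x"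
        using h0 h unfolding DERIV_def tendsto_at_iff_sequentially comp_def by simp
      then have "(\<lambda>i. Y x * exp (s * X x) * ((exp (h i * X x) - 1) / h i)) \<longlonglongrightarrow> Y x * exp (s * X x) * X x"
        by (intro tendsto_mult tendsto_const)
      then show "(\<lambda>i. Y x * exp (s * X x) * ((exp (h i * X x) - 1) / h i)) \<longlonglongrightarrow> Y x * X x * exp (s * X x)"
        by (simp add: mult_ac)
    qed
    show "AE x in M. norm (Y x * exp (s * X x) * ((exp (h i * X x) - 1) / h i)) \<le> D * exp (\<bar>s\<bar> * B) * (B * exp (K * B))" for i
    proof (intro AE_I2)
      fix x
      have hi: "h i \<noteq> 0" using h0 by auto
      have hx: "\<bar>h i * X x\<bar> \<le> K * B"
        using K[of i] B(2)[of x] B(1) by (simp add: abs_mult mult_mono')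
      have "\<bar>exp (h i * X x) - 1\<bar> \<le> \<bar>h i * X x\<bar> * exp \<bar>h i * X x\<bar>" by (rule abs_exp_minus_one_le)
      also have "\<dots> \<le> (\<bar>h i\<bar> * B) * exp (K * B)"
        using B hx by (intro mult_mono) (auto simp: abs_mult mult_left_mono)
      finally have "\<bar>(exp (h i * X x) - 1) / h i\<bar> \<le> B * exp (K * B)"
        using hi by (simp add: abs_divide divide_le_eq mult_ac)
      moreover have "\<bar>Y x * exp (s * X x)\<bar> \<le> D * exp (\<bar>s\<bar> * B)"
        using D exp_le by (simp add: abs_mult mult_mono)
      ultimately show "norm (Y x * exp (s * X x) * ((exp (h i * X x) - 1) / h i)) \<le> D * exp (\<bar>s\<bar> * B) * (B * exp (K * B))"
        unfolding real_norm_def abs_mult[of "Y x * exp (s * X x)"] by (intro mult_mono) (auto simp: D)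
    qed
  qed measurable
qed

section \<open>The exponential ratio and the logarithm of the Laplace transform\<close>

lemma exp_ratio_nonneg: "0 \<le> t \<Longrightarrow> 0 \<le> k \<Longrightarrow> 0 \<le> exp_ratio t k"
  by (simp add: exp_ratio_def)

lemma exp_ratio_mono: "s \<le> t \<Longrightarrow> 0 \<le> k \<Longrightarrow> exp_ratio s k \<le> exp_ratio t k"
  by (auto simp: exp_ratio_def divide_right_mono mult_right_mono)

lemma exp_ratio_ge: "0 \<le> k \<Longrightarrow> t \<le> exp_ratio t k"
proof -
  assume "0 \<le> k"
  moreover have "t * k \<le> exp (t * k) - 1" using exp_ge_add_one_self[of "t * k"] by linarith
  ultimately show ?thesis by (auto simp: exp_ratio_def pos_le_divide_eq)
qed

text \<open>The slope \<open>(exp (s * d) - 1) / d\<close> increases in \<open>d\<close>. For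
  \<open>0 < d\<close> this is the chord bound for the convex function \<open>exp\<close> on
  \<open>[0, s * k]\<close>; for negative \<open>d\<close> the slope is at most \<open>s\<close>,
  which the ratio dominates.\<close>

lemma exp_increment_le:
  assumes s: "0 \<le> s" and k: "0 \<le> k" and d: "d \<le> k"
  shows "\<bar>exp (s * d) - 1\<bar> \<le> exp_ratio s k * \<bar>d\<bar>"
proof (cases "d \<le> 0")
  case True
  have "\<bar>exp (s * d) - 1\<bar> = 1 - exp (s * d)" using True s by (simp add: mult_nonneg_nonpos)
  also have "\<dots> \<le> s * \<bar>d\<bar>"
  proof -
    have "1 - exp (s * d) \<le> - (s * d)" using exp_ge_add_one_self[of "s * d"] by linarith
    then show ?thesis using True by simp
  qed
  also have "\<dots> \<le> exp_ratio s k * \<bar>d\<bar>" using exp_ratio_ge[OF k] by (intro mult_right_mono) auto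
  finally show ?thesis .
next
  case False
  then have "0 < d" "0 < k" using d by auto
  have "exp ((1 - d / k) *\<^sub>R 0 + (d / k) *\<^sub>R (s * k)) \<le> (1 - d / k) * exp 0 + (d / k) * exp (s * k)"
    using \<open>0 < d\<close> \<open>0 < k\<close> d by (intro convex_onD[OF exp_convex]) auto
  then have "exp (s * d) - 1 \<le> (d / k) * (exp (s * k) - 1)"
    using \<open>0 < k\<close> by (simp add: algebra_simps)
  then show ?thesis using \<open>0 < d\<close> \<open>0 < k\<close> s by (simp add: exp_ratio_def mult_ac)
qed

text \<open>Herbst's argument: \<open>mgf\<close> bounds the logarithmic derivative
  \<open>L' / L\<close> by \<open>h\<close>, and integrating from 0, where \<open>ln L\<close>
  vanishes, bounds \<open>ln (L t)\<close>. Where \<open>h\<close> is infinite, \<open>mgf\<close>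
  asks for nothing.\<close>

lemma log_laplace_le:
  assumes M: "prob_space M" and X: "bmeas M X" and t: "0 < t"
    and mgf: "\<And>s c. 0 < s \<Longrightarrow> s \<le> t \<Longrightarrow> 0 \<le> c \<Longrightarrow> h s = ennreal c \<Longrightarrow>
      (\<integral>x. X x * exp (s * X x) \<partial>M) \<le> c * (\<integral>x. exp (s * X x) \<partial>M)"
    and h: "(\<integral>\<^sup>+ s\<in>{0..t}. h s \<partial>lborel) \<le> ennreal c" and c: "0 \<le> c"
  shows "(\<integral>x. exp (t * X x) \<partial>M) \<le> exp c"
proof -
  interpret prob_space M by fact
  define L where "L s = (\<integral>x. exp (s * X x) \<partial>M)" for s
  define L' where "L' s = (\<integral>x. X x * exp (s * X x) \<partial>M)" for s
  obtain B where B: "\<And>x. \<bar>X x\<bar> \<le> B" using X by (rule bmeasE) blast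
  have dL: "(L has_real_derivative L' s) (at s)" for s
    using exp_moment_deriv[OF M X bmeas_const[of M 1], of s] by (simp add: L_def[abs_def] L'_def)
  have dL': "(L' has_real_derivative (\<integral>x. X x * X x * exp (s * X x) \<partial>M)) (at s)" for s
    using exp_moment_deriv[OF M X X, of s] by (simp add: L'_def[abs_def])
  have L_pos: "0 < L s" for s
  proof -
    have "exp (- \<bar>s\<bar> * B) \<le> exp (s * X x)" for x
    proof -
      have "- (s * X x) \<le> \<bar>s\<bar> * \<bar>X x\<bar>" by (metis abs_ge_minus_self abs_mult)
      also have "\<dots> \<le> \<bar>s\<bar> * B" by (intro mult_left_mono B) simp
      finally show ?thesis by simp
    qed
    moreover have "integrable M (\<lambda>x. exp (s * X x))"
    proof (rule integrable_const_bound[of _ "exp (\<bar>s\<bar> * B)"])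
      show "AE x in M. norm (exp (s * X x)) \<le> exp (\<bar>s\<bar> * B)"
      proof (intro AE_I2)
        fix x
        have "s * X x \<le> \<bar>s\<bar> * \<bar>X x\<bar>" by (metis abs_ge_self abs_mult)
        also have "\<dots> \<le> \<bar>s\<bar> * B" by (intro mult_left_mono B) simp
        finally show "norm (exp (s * X x)) \<le> exp (\<bar>s\<bar> * B)" by simp
      qed
    qed (use bmeas_measurable[OF X] in measurable)
    ultimately have "(\<integral>x. exp (- \<bar>s\<bar> * B) \<partial>M) \<le> L s"
      unfolding L_def by (intro integral_mono) auto
    then have "exp (- \<bar>s\<bar> * B) \<le> L s" by (simp add: prob_space)
    then show ?thesis by (rule less_le_trans[OF exp_gt_zero])
  qed
  define f where "f s = L' s / L s" for s
  have f_deriv: "((\<lambda>s. ln (L s)) has_real_derivative f s) (at s)" for s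
    using DERIV_chain2[OF DERIV_ln[OF L_pos] dL, of s] by (simp add: f_def field_simps)
  have f_cont: "isCont f s" for s
    unfolding f_def using DERIV_isCont[OF dL] DERIV_isCont[OF dL'] L_pos[of s] by (intro isCont_divide) auto
  have f_le: "ennreal (f s) \<le> h s" if s: "0 < s" "s \<le> t" for s
  proof (cases "h s")
    case (real r)
    then have "L' s \<le> r * L s" using mgf[OF s, of r] by (simp add: L_def L'_def)
    then have "f s \<le> r" using L_pos[of s] by (simp add: f_def pos_divide_le_eq)
    then show ?thesis using real by (simp add: ennreal_leI)
  qed simp
  have FTC: "has_bochner_integral lborel (\<lambda>s. f s * indicator {0..t} s) (ln (L t) - ln (L 0))"
    by (rule has_bochner_integral_FTC_Icc_real) (use t f_deriv f_cont in auto)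
  have "ln (L t) - ln (L 0) = (\<integral>s. f s * indicator {0..t} s \<partial>lborel)"
    using FTC by (simp add: has_bochner_integral_iff)
  \<comment> \<open>\<open>h\<close> takes values in \<open>ennreal\<close>, so it is the positive
    part of \<open>f\<close> that is compared with it. At \<open>s = 0\<close> no bound is
    available, but that is a null set.\<close>
  also have "\<dots> \<le> (\<integral>s. max 0 (f s * indicator {0..t} s) \<partial>lborel)"
    using FTC by (intro integral_mono) (auto simp: has_bochner_integral_iff)
  also have "\<dots> \<le> c"
  proof -
    have "ennreal (\<integral>s. max 0 (f s * indicator {0..t} s) \<partial>lborel) = (\<integral>\<^sup>+s. ennreal (max 0 (f s * indicator {0..t} s)) \<partial>lborel)"
      using FTC by (intro nn_integral_eq_integral[symmetric]) (auto simp: has_bochner_integral_iff)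
    also have "\<dots> \<le> (\<integral>\<^sup>+ s\<in>{0..t}. h s \<partial>lborel)"
    proof (rule nn_integral_mono_AE)
      have "AE s in lborel. s \<noteq> (0::real)" by (rule AE_lborel_singleton)
      then show "AE s in lborel. ennreal (max 0 (f s * indicator {0..t} s)) \<le> h s * indicator {0..t} s"
        by eventually_elim (use f_le in \<open>auto simp: indicator_def max_def\<close>)
    qed
    also note h
    finally show ?thesis using c by (simp add: ennreal_le_iff)
  qed
  finally have "ln (L t) \<le> c" by (simp add: L_def prob_space)
  then have "exp (ln (L t)) \<le> exp c" by simp
  then show ?thesis unfolding exp_ln[OF L_pos] unfolding L_def .
qed

context poisson_process
begin

lemma space_P: "space P = configurations"
  using sets_eq_imp_space_eq[OF sets_P] by (simp add: space_config_space)

lemma measurable_P: "measurable P N = measurable C N"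
  by (rule measurable_cong_sets[OF sets_P refl])

lemma measurable_diff_op:
  assumes F: "F \<in> borel_measurable C"
  shows "(\<lambda>p. diff_op F (snd p) (fst p)) \<in> borel_measurable (C \<Otimes>\<^sub>M \<nu>)"
proof -
  have eq: "borel_measurable (C \<Otimes>\<^sub>M \<nu>) = borel_measurable (C \<Otimes>\<^sub>M borel)"
    by (intro measurable_cong_sets sets_pair_measure_cong sets_\<nu> refl)
  have ins: "(\<lambda>p. insert (snd p) (fst p)) \<in> measurable (C \<Otimes>\<^sub>M borel) C" by measurable
  show ?thesis
    unfolding diff_op_def eq Un_insert_right sup_bot_right
    by (intro borel_measurable_diff measurable_compose[OF ins F] measurable_compose[OF measurable_fst F])
qed

lemma meas_diff_op_at:
  assumes F: "F \<in> borel_measurable C" and \<omega>: "\<omega> \<in> configurations"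
  shows "(\<lambda>y. diff_op F y \<omega>) \<in> borel_measurable \<nu>"
proof -
  have "(\<lambda>y. (\<omega>, y)) \<in> measurable \<nu> (C \<Otimes>\<^sub>M \<nu>)"
    using \<omega> by (intro measurable_Pair1') (simp add: space_config_space)
  from measurable_compose[OF this measurable_diff_op[OF F]] show ?thesis by simp
qed

end

section \<open>Deviation bounds for Poisson functionals\<close>

text \<open>Truncation is monotone and 1-Lipschitz: it shrinks absolute increments and keeps every
  non-negative upper bound on signed ones, so both conditions on the gradient survive.\<close>

definition clip :: "real \<Rightarrow> real \<Rightarrow> real" where
  "clip m x = max (- m) (min m x)"

lemma abs_clip_le: "0 \<le> m \<Longrightarrow> \<bar>clip m x\<bar> \<le> m"
  and abs_clip_le_abs: "0 \<le> m \<Longrightarrow> \<bar>clip m x\<bar> \<le> \<bar>x\<bar>"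
  and clip_eq: "\<bar>x\<bar> \<le> m \<Longrightarrow> clip m x = x"
  and clip_diff_abs_le: "\<bar>clip m x - clip m y\<bar> \<le> \<bar>x - y\<bar>"
  and clip_diff_le: "0 \<le> k \<Longrightarrow> x - y \<le> k \<Longrightarrow> clip m x - clip m y \<le> k"
  by (auto simp: clip_def max_def min_def abs_if split: if_splits)

lemma clip_measurable[measurable]: "clip m \<in> borel_measurable borel"
  unfolding clip_def by measurable

lemma clip_tendsto: "(\<lambda>n. clip (real n) x) \<longlonglongrightarrow> x"
proof (rule tendsto_eventually)
  obtain N :: nat where "\<bar>x\<bar> \<le> real N" using real_arch_simple by blast
  then show "\<forall>\<^sub>F n in sequentially. clip (real n) x = x"
    unfolding eventually_sequentially by (intro exI[of _ N]) (auto intro: clip_eq)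
qed

context poisson_process
begin

lemma bmeas_clip: "F \<in> borel_measurable C \<Longrightarrow> bmeas C (\<lambda>\<omega>. clip (real n) (F \<omega>))"
  by (rule bmeasI[of _ _ "real n"]) (auto intro: abs_clip_le)

lemma diff_op_clip:
  shows "\<bar>diff_op (\<lambda>\<omega>. clip m (F \<omega>) - c) y \<omega>\<bar> \<le> \<bar>diff_op F y \<omega>\<bar>"
    and "0 \<le> k \<Longrightarrow> diff_op F y \<omega> \<le> k \<Longrightarrow> diff_op (\<lambda>\<omega>. clip m (F \<omega>) - c) y \<omega> \<le> k"
  using clip_diff_abs_le[of m "F (\<omega> \<union> {y})" "F \<omega>"] clip_diff_le[of k "F (\<omega> \<union> {y})" "F \<omega>" m]
  by (simp_all add: diff_op_def)

text \<open>AM-GM turns the mixed product of gradients at two configurations into the two squared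
  gradients, each of which is controlled by the supremum.\<close>

lemma mixed_gradient_le:
  assumes f: "f \<in> borel_measurable \<nu>" "g \<in> borel_measurable \<nu>" and r: "r \<in> borel_measurable \<nu>" "\<And>y. 0 \<le> r y"
    and e: "0 \<le> e" and c: "0 \<le> c"
    and le: "\<And>y. \<bar>k y\<bar> \<le> e * (r y * \<bar>f y\<bar> * \<bar>g y\<bar>)"
    and f_le: "(\<integral>\<^sup>+y. ennreal (r y * \<bar>f y\<bar>\<^sup>2) \<partial>\<nu>) \<le> ennreal c"
    and g_le: "(\<integral>\<^sup>+y. ennreal (r y * \<bar>g y\<bar>\<^sup>2) \<partial>\<nu>) \<le> ennreal c"
  shows "(\<integral>\<^sup>+y. ennreal \<bar>k y\<bar> \<partial>\<nu>) \<le> ennreal (c * e)"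
proof -
  have "(\<integral>\<^sup>+y. ennreal \<bar>k y\<bar> \<partial>\<nu>) \<le> (\<integral>\<^sup>+y. ennreal (e / 2) * (ennreal (r y * \<bar>f y\<bar>\<^sup>2) + ennreal (r y * \<bar>g y\<bar>\<^sup>2)) \<partial>\<nu>)"
  proof (rule nn_integral_mono)
    fix y
    have "\<bar>k y\<bar> \<le> e * (r y * \<bar>f y\<bar> * \<bar>g y\<bar>)" by (rule le)
    also have "\<dots> = e / 2 * (r y * (2 * \<bar>f y\<bar> * \<bar>g y\<bar>))" by simp
    also have "\<dots> \<le> e / 2 * (r y * (\<bar>f y\<bar>\<^sup>2 + \<bar>g y\<bar>\<^sup>2))"
      using e r(2) sum_squares_bound[of "\<bar>f y\<bar>" "\<bar>g y\<bar>"] by (intro mult_left_mono) auto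
    finally have "ennreal \<bar>k y\<bar> \<le> ennreal (e / 2 * (r y * \<bar>f y\<bar>\<^sup>2 + r y * \<bar>g y\<bar>\<^sup>2))"
      by (intro ennreal_leI) (simp add: algebra_simps)
    also have "\<dots> = ennreal (e / 2) * (ennreal (r y * \<bar>f y\<bar>\<^sup>2) + ennreal (r y * \<bar>g y\<bar>\<^sup>2))"
      using e r(2)[of y] by (subst ennreal_mult) (auto simp: ennreal_plus)
    finally show "ennreal \<bar>k y\<bar> \<le> ennreal (e / 2) * (ennreal (r y * \<bar>f y\<bar>\<^sup>2) + ennreal (r y * \<bar>g y\<bar>\<^sup>2))" .
  qed
  also have "\<dots> = ennreal (e / 2) * ((\<integral>\<^sup>+y. ennreal (r y * \<bar>f y\<bar>\<^sup>2) \<partial>\<nu>) + (\<integral>\<^sup>+y. ennreal (r y * \<bar>g y\<bar>\<^sup>2) \<partial>\<nu>))"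
    using f r by (simp add: nn_integral_cmult nn_integral_add)
  also have "\<dots> \<le> ennreal (e / 2) * (ennreal c + ennreal c)"
    by (intro mult_left_mono add_mono f_le g_le) simp
  also have "\<dots> = ennreal (c * e)"
    using c e by (simp add: ennreal_plus[symmetric] ennreal_mult[symmetric] mult.commute del: ennreal_plus)
  finally show ?thesis .
qed

lemma exp_covariance_le:
  assumes X: "bmeas C X" and mean: "(\<integral>\<omega>. X \<omega> \<partial>P) = 0" and s: "0 < s" and c: "0 \<le> c"
    and K: "K \<in> borel_measurable borel" "\<And>y. 0 \<le> K y"
    and bound: "\<And>y \<omega>. \<omega> \<in> configurations \<Longrightarrow> diff_op X y \<omega> \<le> K y"
    and grad: "AE \<omega> in P. (\<integral>\<^sup>+y. ennreal (exp_ratio s (K y) * \<bar>diff_op X y \<omega>\<bar>\<^sup>2) \<partial>\<nu>) \<le> ennreal c"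
  shows "(\<integral>\<omega>. X \<omega> * exp (s * X \<omega>) \<partial>P) \<le> c * (\<integral>\<omega>. exp (s * X \<omega>) \<partial>P)"
proof -
  obtain B where B: "0 \<le> B" "\<And>\<omega>. \<bar>X \<omega>\<bar> \<le> B" using X by (rule bmeasE) blast
  have e: "bmeas C (\<lambda>\<omega>. exp (s * X \<omega>))"
  proof (rule bmeasI[of _ _ "exp (s * B)"])
    show "\<bar>exp (s * X \<omega>)\<bar> \<le> exp (s * B)" for \<omega> using B(2)[of \<omega>] s by simp
  qed (use bmeas_measurable[OF X] in measurable)
  have r: "(\<lambda>y. exp_ratio s (K y)) \<in> borel_measurable \<nu>"
  proof -
    have "(\<lambda>y. exp_ratio s (K y)) \<in> borel_measurable borel"
      unfolding exp_ratio_def using K(1) by measurable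
    then show ?thesis using measurable_cong_sets[OF sets_\<nu> refl, of "borel :: real measure"] by simp
  qed
  have "(\<integral>\<omega>. X \<omega> * exp (s * X \<omega>) \<partial>P) - (\<integral>\<omega>. X \<omega> \<partial>P) * (\<integral>\<omega>. exp (s * X \<omega>) \<partial>P) \<le> (\<integral>\<omega>. c * exp (s * X \<omega>) \<partial>P)"
  proof (rule covariance_le[OF X e _ _ grad])
    show "bmeas C (\<lambda>\<omega>. c * exp (s * X \<omega>))" by (intro bmeas_mult bmeas_const e)
    show "0 \<le> c * exp (s * X \<omega>)" for \<omega> using c by simp
    fix \<omega> \<omega>' assume \<omega>: "\<omega> \<in> configurations" "\<omega>' \<in> configurations"
      and le: "(\<integral>\<^sup>+y. ennreal (exp_ratio s (K y) * \<bar>diff_op X y \<omega>\<bar>\<^sup>2) \<partial>\<nu>) \<le> ennreal c"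
        "(\<integral>\<^sup>+y. ennreal (exp_ratio s (K y) * \<bar>diff_op X y \<omega>'\<bar>\<^sup>2) \<partial>\<nu>) \<le> ennreal c"
    show "(\<integral>\<^sup>+y. ennreal \<bar>diff_op X y \<omega> * diff_op (\<lambda>\<omega>. exp (s * X \<omega>)) y \<omega>'\<bar> \<partial>\<nu>) \<le> ennreal (c * exp (s * X \<omega>'))"
    proof (rule mixed_gradient_le[where r="\<lambda>y. exp_ratio s (K y)" and f="\<lambda>y. diff_op X y \<omega>" and g="\<lambda>y. diff_op X y \<omega>'"])
      fix y
      \<comment> \<open>The exponential factors out at the second configuration and leaves the
        integral over \<open>y\<close>. The majorant \<open>Z\<close> thus depends on
        \<open>\<omega>'\<close> alone, and its mean is again an expectation under
        \<open>P\<close>.\<close>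
      have "diff_op (\<lambda>\<omega>. exp (s * X \<omega>)) y \<omega>' = exp (s * X \<omega>') * (exp (s * diff_op X y \<omega>') - 1)"
        by (simp add: diff_op_def right_diff_distrib exp_add[symmetric])
      then have "\<bar>diff_op X y \<omega> * diff_op (\<lambda>\<omega>. exp (s * X \<omega>)) y \<omega>'\<bar> = exp (s * X \<omega>') * (\<bar>exp (s * diff_op X y \<omega>') - 1\<bar> * \<bar>diff_op X y \<omega>\<bar>)"
        by (simp add: abs_mult)
      also have "\<dots> \<le> exp (s * X \<omega>') * ((exp_ratio s (K y) * \<bar>diff_op X y \<omega>'\<bar>) * \<bar>diff_op X y \<omega>\<bar>)"
        using exp_increment_le[OF _ K(2) bound[OF \<omega>(2)], of s] s by (intro mult_left_mono mult_right_mono) auto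
      finally show "\<bar>diff_op X y \<omega> * diff_op (\<lambda>\<omega>. exp (s * X \<omega>)) y \<omega>'\<bar> \<le> exp (s * X \<omega>') * (exp_ratio s (K y) * \<bar>diff_op X y \<omega>\<bar> * \<bar>diff_op X y \<omega>'\<bar>)"
        by (simp add: mult_ac)
    qed (use s c K r \<omega> le exp_ratio_nonneg meas_diff_op_at[OF bmeas_measurable[OF X]] in auto)
  qed
  then show ?thesis by (simp add: mean)
qed

lemma variance_le:
  assumes X: "bmeas C X" and c: "0 \<le> c"
    and grad: "AE \<omega> in P. (\<integral>\<^sup>+y. ennreal (\<bar>diff_op X y \<omega>\<bar>\<^sup>2) \<partial>\<nu>) \<le> ennreal c"
  shows "(\<integral>\<omega>. X \<omega> * X \<omega> \<partial>P) - (\<integral>\<omega>. X \<omega> \<partial>P) * (\<integral>\<omega>. X \<omega> \<partial>P) \<le> c"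
proof -
  interpret P: prob_space P by (rule prob_P)
  have "(\<integral>\<omega>. X \<omega> * X \<omega> \<partial>P) - (\<integral>\<omega>. X \<omega> \<partial>P) * (\<integral>\<omega>. X \<omega> \<partial>P) \<le> (\<integral>\<omega>. c \<partial>P)"
  proof (rule covariance_le[OF X X bmeas_const c grad])
    fix \<omega> \<omega>' assume \<omega>: "\<omega> \<in> configurations" "\<omega>' \<in> configurations"
      and le: "(\<integral>\<^sup>+y. ennreal (\<bar>diff_op X y \<omega>\<bar>\<^sup>2) \<partial>\<nu>) \<le> ennreal c" "(\<integral>\<^sup>+y. ennreal (\<bar>diff_op X y \<omega>'\<bar>\<^sup>2) \<partial>\<nu>) \<le> ennreal c"
    have "(\<integral>\<^sup>+y. ennreal \<bar>diff_op X y \<omega> * diff_op X y \<omega>'\<bar> \<partial>\<nu>) \<le> ennreal (c * 1)"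
      by (rule mixed_gradient_le[where r="\<lambda>y. 1" and f="\<lambda>y. diff_op X y \<omega>" and g="\<lambda>y. diff_op X y \<omega>'"])
        (use c \<omega> le meas_diff_op_at[OF bmeas_measurable[OF X]] in \<open>auto simp: abs_mult\<close>)
    then show "(\<integral>\<^sup>+y. ennreal \<bar>diff_op X y \<omega> * diff_op X y \<omega>'\<bar> \<partial>\<nu>) \<le> ennreal c" by simp
  qed
  then show ?thesis by (simp add: P.prob_space)
qed

lemma grad_clip_le:
  assumes r: "\<And>y. 0 \<le> r y"
  shows "(\<integral>\<^sup>+y. ennreal (r y * \<bar>diff_op (\<lambda>\<omega>. clip m (F \<omega>) - a) y \<omega>\<bar>\<^sup>2) \<partial>\<nu>) \<le> (\<integral>\<^sup>+y. ennreal (r y * \<bar>diff_op F y \<omega>\<bar>\<^sup>2) \<partial>\<nu>)"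
  by (intro nn_integral_mono ennreal_leI mult_left_mono power_mono diff_op_clip r) auto

text \<open>The Poincare inequality bounds the variances of the truncations; since the truncations agree
  with \<open>F\<close> on a fixed set of probability at least \<open>1/2\<close>, their means stay bounded as well.\<close>

lemma integrable_of_gradient:
  assumes F: "F \<in> borel_measurable C" and c: "0 \<le> c"
    and grad: "AE \<omega> in P. (\<integral>\<^sup>+y. ennreal (\<bar>diff_op F y \<omega>\<bar>\<^sup>2) \<partial>\<nu>) \<le> ennreal c"
  shows "integrable P F"
proof -
  interpret P: prob_space P by (rule prob_P)
  have F'[measurable]: "F \<in> borel_measurable P" using F by (simp add: measurable_P)
  define G where "G n \<omega> = clip (real n) (F \<omega>)" for n \<omega>
  have G: "bmeas C (G n)" for n unfolding G_def by (rule bmeas_clip[OF F])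
  have bP: "bmeas P f \<longleftrightarrow> bmeas C f" for f by (rule bmeas_cong_sets[OF sets_P])
  note int = bmeas_integrable[OF prob_P]
  define e where "e n = (\<integral>\<omega>. G n \<omega> \<partial>P)" for n
  have var: "(\<integral>\<omega>. G n \<omega> * G n \<omega> \<partial>P) - e n * e n \<le> c" for n
    unfolding e_def
  proof (rule variance_le[OF G c])
    show "AE \<omega> in P. (\<integral>\<^sup>+y. ennreal (\<bar>diff_op (G n) y \<omega>\<bar>\<^sup>2) \<partial>\<nu>) \<le> ennreal c"
      using grad
    proof eventually_elim
      case (elim \<omega>)
      then show ?case
        using grad_clip_le[of "\<lambda>_. 1" "real n" F 0 \<omega>] by (simp add: G_def[abs_def])
    qed
  qed
  obtain k :: nat where k: "1 / 2 \<le> measure P {\<omega>\<in>space P. \<bar>F \<omega>\<bar> \<le> real k}"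
  proof -
    have "(\<lambda>k. measure P {\<omega>\<in>space P. \<bar>F \<omega>\<bar> \<le> real k}) \<longlonglongrightarrow> measure P (\<Union>k. {\<omega>\<in>space P. \<bar>F \<omega>\<bar> \<le> real k})"
      by (rule P.finite_Lim_measure_incseq) (auto simp: incseq_def)
    moreover have "(\<Union>k. {\<omega>\<in>space P. \<bar>F \<omega>\<bar> \<le> real k}) = space P"
      using real_arch_simple by auto
    ultimately have "(\<lambda>k. measure P {\<omega>\<in>space P. \<bar>F \<omega>\<bar> \<le> real k}) \<longlonglongrightarrow> 1" by (simp add: P.prob_space)
    then have "\<forall>\<^sub>F k in sequentially. 1 / 2 < measure P {\<omega>\<in>space P. \<bar>F \<omega>\<bar> \<le> real k}"
      by (rule order_tendstoD) simp
    then show ?thesis using that by (auto simp: eventually_sequentially intro: less_imp_le)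
  qed
  \<comment> \<open>Chebyshev's inequality: otherwise \<open>G n\<close> would be at distance at
    least \<open>2 * c + 1\<close> from its mean with probability at least 1/2, so its variance
    would be at least \<open>(2 * c + 1)\<^sup>2 / 2\<close>, which exceeds
    \<open>c\<close>.\<close>
  have e_le: "\<bar>e n\<bar> \<le> real k + (2 * c + 1)" if n: "k \<le> n" for n
  proof (rule ccontr)
    assume "\<not> \<bar>e n\<bar> \<le> real k + (2 * c + 1)"
    then have big: "2 * c + 1 < \<bar>e n\<bar> - real k" by simp
    have "(\<integral>\<omega>. (G n \<omega> - e n) * (G n \<omega> - e n) \<partial>P) = (\<integral>\<omega>. G n \<omega> * G n \<omega> - 2 * e n * G n \<omega> + e n * e n \<partial>P)"
      by (intro Bochner_Integration.integral_cong) (auto simp: algebra_simps)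
    also have "\<dots> = (\<integral>\<omega>. G n \<omega> * G n \<omega> \<partial>P) - e n * e n"
      using int[of "\<lambda>\<omega>. G n \<omega> * G n \<omega>"] int[of "G n"] bmeas_mult[OF G G] G
      by (simp add: bP P.prob_space e_def)
    finally have v: "(\<integral>\<omega>. (G n \<omega> - e n) * (G n \<omega> - e n) \<partial>P) \<le> c" using var[of n] by simp
    have "(\<integral>\<omega>. (2 * c + 1) * (2 * c + 1) * indicator {\<omega>\<in>space P. \<bar>F \<omega>\<bar> \<le> real k} \<omega> \<partial>P) \<le> (\<integral>\<omega>. (G n \<omega> - e n) * (G n \<omega> - e n) \<partial>P)"
    proof (rule integral_mono)
      show "integrable P (\<lambda>\<omega>. (G n \<omega> - e n) * (G n \<omega> - e n))"
        by (intro int, unfold bP) (intro bmeas_mult bmeas_diff G bmeas_const)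
      show "integrable P (\<lambda>\<omega>. (2 * c + 1) * (2 * c + 1) * indicator {\<omega>\<in>space P. \<bar>F \<omega>\<bar> \<le> real k} \<omega>)"
        by (intro integrable_mult_right integrable_real_indicator) (auto simp: P.emeasure_eq_measure)
      fix \<omega>
      show "(2 * c + 1) * (2 * c + 1) * indicator {\<omega>\<in>space P. \<bar>F \<omega>\<bar> \<le> real k} \<omega> \<le> (G n \<omega> - e n) * (G n \<omega> - e n)"
      proof (cases "\<omega> \<in> space P \<and> \<bar>F \<omega>\<bar> \<le> real k")
        case True
        then have "G n \<omega> = F \<omega>" using n by (simp add: G_def clip_eq)
        with True big have "2 * c + 1 \<le> \<bar>G n \<omega> - e n\<bar>" by linarith
        then have "(2 * c + 1) * (2 * c + 1) \<le> \<bar>G n \<omega> - e n\<bar> * \<bar>G n \<omega> - e n\<bar>"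
          using c by (intro mult_mono) auto
        with True show ?thesis by simp
      next
        case False
        then have "indicator {\<omega>\<in>space P. \<bar>F \<omega>\<bar> \<le> real k} \<omega> = (0::real)" by (auto simp: indicator_def)
        then show ?thesis by simp
      qed
    qed
    also note v
    finally have "(2 * c + 1) * (2 * c + 1) * measure P {\<omega>\<in>space P. \<bar>F \<omega>\<bar> \<le> real k} \<le> c" by (simp add: Int_absorb2)
    moreover have "(2 * c + 1) * (2 * c + 1) * (1 / 2) \<le> (2 * c + 1) * (2 * c + 1) * measure P {\<omega>\<in>space P. \<bar>F \<omega>\<bar> \<le> real k}"
      using k c by (intro mult_left_mono) auto
    moreover have "c < (2 * c + 1) * (2 * c + 1) * (1 / 2)"
    proof -
      have "0 \<le> c * (c * 2)" using c by simp
      then have "0 < c + (1 / 2 + c * (c * 2))" using c by linarith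
      then show ?thesis by (simp add: algebra_simps)
    qed
    ultimately show False by linarith
  qed
  define b where "b = c + (real k + (2 * c + 1)) * (real k + (2 * c + 1)) + 1"
  have second: "(\<integral>\<^sup>+\<omega>. ennreal \<bar>G n \<omega>\<bar> \<partial>P) \<le> ennreal b" if n: "k \<le> n" for n
  proof -
    have i: "integrable P (\<lambda>\<omega>. G n \<omega> * G n \<omega>)" "integrable P (\<lambda>\<omega>. \<bar>G n \<omega>\<bar>)"
      using int[of "\<lambda>\<omega>. G n \<omega> * G n \<omega>"] int[of "G n"] bmeas_mult[OF G G] G by (simp_all add: bP)
    have "(\<integral>\<omega>. \<bar>G n \<omega>\<bar> \<partial>P) \<le> (\<integral>\<omega>. G n \<omega> * G n \<omega> + 1 \<partial>P)"
    proof (rule integral_mono)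
      show "\<bar>G n \<omega>\<bar> \<le> G n \<omega> * G n \<omega> + 1" for \<omega>
      proof -
        have "0 \<le> (\<bar>G n \<omega>\<bar> - 1) * (\<bar>G n \<omega>\<bar> - 1)" by (rule zero_le_square)
        then show ?thesis by (simp add: algebra_simps)
      qed
    qed (use i in auto)
    also have "\<dots> = (\<integral>\<omega>. G n \<omega> * G n \<omega> \<partial>P) + 1" using i by (simp add: P.prob_space)
    also have "\<dots> \<le> c + e n * e n + 1" using var[of n] by simp
    also have "e n * e n \<le> (real k + (2 * c + 1)) * (real k + (2 * c + 1))"
      using mult_mono[OF e_le[OF n] e_le[OF n]] c by simp
    finally show ?thesis using i(2) by (subst nn_integral_eq_integral) (auto simp: b_def intro!: ennreal_leI)
  qed
  have "(\<integral>\<^sup>+\<omega>. ennreal \<bar>F \<omega>\<bar> \<partial>P) = (\<integral>\<^sup>+\<omega>. liminf (\<lambda>n. ennreal \<bar>G n \<omega>\<bar>) \<partial>P)"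
  proof (rule nn_integral_cong)
    fix \<omega>
    have "(\<lambda>n. ennreal \<bar>G n \<omega>\<bar>) \<longlonglongrightarrow> ennreal \<bar>F \<omega>\<bar>"
      unfolding G_def by (intro tendsto_ennrealI tendsto_rabs clip_tendsto)
    then show "ennreal \<bar>F \<omega>\<bar> = liminf (\<lambda>n. ennreal \<bar>G n \<omega>\<bar>)"
      by (intro lim_imp_Liminf[symmetric]) simp_all
  qed
  also have "\<dots> \<le> liminf (\<lambda>n. \<integral>\<^sup>+\<omega>. ennreal \<bar>G n \<omega>\<bar> \<partial>P)"
    by (rule nn_integral_liminf) (simp add: G_def)
  also have "\<dots> \<le> limsup (\<lambda>n. \<integral>\<^sup>+\<omega>. ennreal \<bar>G n \<omega>\<bar> \<partial>P)"
    by (rule Liminf_le_Limsup) simp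
  also have "\<dots> \<le> ennreal b"
    by (rule Limsup_bounded) (use second in \<open>auto simp: eventually_sequentially\<close>)
  finally have "(\<integral>\<^sup>+\<omega>. ennreal \<bar>F \<omega>\<bar> \<partial>P) < \<infinity>" by (rule le_less_trans) simp
  then show ?thesis by (intro integrableI_bounded) auto
qed

text \<open>Truncations of \<open>F\<close>, each centred at its own mean, satisfy the hypotheses of
  \<open>log_laplace_le\<close> with the same \<open>h\<close>. Integrability of \<open>F\<close>
  makes the means converge by dominated convergence, and Fatou's lemma passes the bound to the
  limit.\<close>

lemma laplace_le:
  assumes F: "F \<in> borel_measurable C" "integrable P F"
    and K: "K \<in> borel_measurable borel" "\<And>y. 0 \<le> K y"
    and bound: "\<And>y \<omega>. \<omega> \<in> configurations \<Longrightarrow> diff_op F y \<omega> \<le> K y"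
    and t: "0 < t"
    and grad: "\<And>s. 0 < s \<Longrightarrow> s \<le> t \<Longrightarrow> AE \<omega> in P. (\<integral>\<^sup>+y. ennreal (exp_ratio s (K y) * \<bar>diff_op F y \<omega>\<bar>\<^sup>2) \<partial>\<nu>) \<le> h s"
    and h: "(\<integral>\<^sup>+ s\<in>{0..t}. h s \<partial>lborel) \<le> ennreal c" and c: "0 \<le> c"
  shows "(\<integral>\<^sup>+\<omega>. ennreal (exp (t * (F \<omega> - (\<integral>\<omega>. F \<omega> \<partial>P)))) \<partial>P) \<le> ennreal (exp c)"
proof -
  interpret P: prob_space P by (rule prob_P)
  have [measurable]: "F \<in> borel_measurable P" using F by (simp add: measurable_P)
  have bP: "bmeas P f \<longleftrightarrow> bmeas C f" for f by (rule bmeas_cong_sets[OF sets_P])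
  define e where "e n = (\<integral>\<omega>. clip (real n) (F \<omega>) \<partial>P)" for n
  define X where "X n \<omega> = clip (real n) (F \<omega>) - e n" for n \<omega>
  have X: "bmeas C (X n)" for n
    unfolding X_def by (intro bmeas_diff bmeas_clip F bmeas_const)
  have mean: "(\<integral>\<omega>. X n \<omega> \<partial>P) = 0" for n
  proof -
    have "integrable P (\<lambda>\<omega>. clip (real n) (F \<omega>))"
      using bmeas_clip[OF F(1)] by (intro bmeas_integrable prob_P) (simp add: bP)
    then show ?thesis by (simp add: X_def e_def P.prob_space)
  qed
  have e_lim: "e \<longlonglongrightarrow> (\<integral>\<omega>. F \<omega> \<partial>P)"
    unfolding e_def
    by (rule integral_dominated_convergence[where w="\<lambda>\<omega>. \<bar>F \<omega>\<bar>"])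
      (use F(2) in \<open>auto intro!: clip_tendsto abs_clip_le_abs\<close>)
  have le: "(\<integral>\<^sup>+\<omega>. ennreal (exp (t * X n \<omega>)) \<partial>P) \<le> ennreal (exp c)" for n
  proof -
    have "(\<integral>\<omega>. exp (t * X n \<omega>) \<partial>P) \<le> exp c"
    proof (rule log_laplace_le[OF prob_P _ t _ h c])
      show "bmeas P (X n)" by (simp add: bP X)
      fix s d assume s: "0 < s" "s \<le> t" and d: "0 \<le> d" "h s = ennreal d"
      show "(\<integral>\<omega>. X n \<omega> * exp (s * X n \<omega>) \<partial>P) \<le> d * (\<integral>\<omega>. exp (s * X n \<omega>) \<partial>P)"
      proof (rule exp_covariance_le[OF X mean s(1) d(1) K])
        show "diff_op (X n) y \<omega> \<le> K y" if "\<omega> \<in> configurations" for y \<omega>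
          unfolding X_def by (intro diff_op_clip(2) K bound that)
        show "AE \<omega> in P. (\<integral>\<^sup>+y. ennreal (exp_ratio s (K y) * \<bar>diff_op (X n) y \<omega>\<bar>\<^sup>2) \<partial>\<nu>) \<le> ennreal d"
          using grad[OF s]
        proof eventually_elim
          case (elim \<omega>)
          have "(\<integral>\<^sup>+y. ennreal (exp_ratio s (K y) * \<bar>diff_op (X n) y \<omega>\<bar>\<^sup>2) \<partial>\<nu>) \<le> (\<integral>\<^sup>+y. ennreal (exp_ratio s (K y) * \<bar>diff_op F y \<omega>\<bar>\<^sup>2) \<partial>\<nu>)"
            unfolding X_def using s K(2) by (intro grad_clip_le exp_ratio_nonneg) auto
          with elim d(2) show ?case by simp
        qed
      qed
    qed
    moreover have "integrable P (\<lambda>\<omega>. exp (t * X n \<omega>))"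
    proof -
      obtain B where B: "\<And>\<omega>. \<bar>X n \<omega>\<bar> \<le> B" using X[of n] by (rule bmeasE) blast
      have "bmeas C (\<lambda>\<omega>. exp (t * X n \<omega>))"
      proof (rule bmeasI[of _ _ "exp (t * B)"])
        show "\<bar>exp (t * X n \<omega>)\<bar> \<le> exp (t * B)" for \<omega> using B[of \<omega>] t by simp
      qed (use bmeas_measurable[OF X] in measurable)
      then show ?thesis by (intro bmeas_integrable prob_P) (simp add: bP)
    qed
    ultimately show ?thesis by (simp add: nn_integral_eq_integral ennreal_leI)
  qed
  have "(\<integral>\<^sup>+\<omega>. ennreal (exp (t * (F \<omega> - (\<integral>\<omega>. F \<omega> \<partial>P)))) \<partial>P) = (\<integral>\<^sup>+\<omega>. liminf (\<lambda>n. ennreal (exp (t * X n \<omega>))) \<partial>P)"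
  proof (rule nn_integral_cong)
    fix \<omega>
    have "(\<lambda>n. ennreal (exp (t * X n \<omega>))) \<longlonglongrightarrow> ennreal (exp (t * (F \<omega> - (\<integral>\<omega>. F \<omega> \<partial>P))))"
      unfolding X_def by (intro tendsto_ennrealI tendsto_exp tendsto_mult tendsto_diff tendsto_const clip_tendsto e_lim)
    then show "ennreal (exp (t * (F \<omega> - (\<integral>\<omega>. F \<omega> \<partial>P)))) = liminf (\<lambda>n. ennreal (exp (t * X n \<omega>)))"
      by (intro lim_imp_Liminf[symmetric]) simp_all
  qed
  also have "\<dots> \<le> liminf (\<lambda>n. \<integral>\<^sup>+\<omega>. ennreal (exp (t * X n \<omega>)) \<partial>P)"
    by (rule nn_integral_liminf) (simp add: X_def)
  also have "\<dots> \<le> limsup (\<lambda>n. \<integral>\<^sup>+\<omega>. ennreal (exp (t * X n \<omega>)) \<partial>P)"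
    by (rule Liminf_le_Limsup) simp
  also have "\<dots> \<le> ennreal (exp c)"
    by (rule Limsup_bounded) (simp add: le)
  finally show ?thesis .
qed

text \<open>\<open>h\<close> may be any majorant of the weighted gradient: the lemma is applied both
  with the deviation function and with a linear function of \<open>s\<close>.\<close>

lemma chernoff_bound:
  assumes F: "F \<in> borel_measurable C"
    and K: "K \<in> borel_measurable borel" "\<And>y. 0 \<le> K y"
    and bound: "\<And>y \<omega>. \<omega> \<in> configurations \<Longrightarrow> diff_op F y \<omega> \<le> K y"
    and t: "0 < t"
    and grad: "\<And>s. 0 < s \<Longrightarrow> s \<le> t \<Longrightarrow> AE \<omega> in P. (\<integral>\<^sup>+y. ennreal (exp_ratio s (K y) * \<bar>diff_op F y \<omega>\<bar>\<^sup>2) \<partial>\<nu>) \<le> h s"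
  shows "emeasure P {\<omega>\<in>space P. F \<omega> - (\<integral>\<omega>. F \<omega> \<partial>P) \<ge> x} \<le>
    exp_ereal (enn2ereal (\<integral>\<^sup>+ s\<in>{0..t}. h s \<partial>lborel) - ereal (t * x))"
proof (cases "\<integral>\<^sup>+ s\<in>{0..t}. h s \<partial>lborel")
  case top
  then show ?thesis by (simp add: exp_ereal_def)
next
  case (real c)
  have [measurable]: "F \<in> borel_measurable P" using F by (simp add: measurable_P)
  \<comment> \<open>A finite integral forces \<open>h\<close> to be finite at some
    \<open>s > 0\<close>. Since \<open>exp_ratio s k \<ge> s\<close>, the unweighted gradient is
    then bounded by \<open>h s / s\<close>, and \<open>F\<close> is integrable.\<close>
  have "\<exists>s. 0 < s \<and> s \<le> t \<and> h s \<noteq> \<infinity>"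
  proof (rule ccontr)
    assume "\<nexists>s. 0 < s \<and> s \<le> t \<and> h s \<noteq> \<infinity>"
    then have "(\<integral>\<^sup>+ s\<in>{0<..t}. \<infinity> \<partial>lborel) \<le> (\<integral>\<^sup>+ s\<in>{0..t}. h s \<partial>lborel)"
      by (intro nn_integral_mono) (auto simp: indicator_def)
    moreover have "(\<integral>\<^sup>+ s\<in>{0<..t}. \<infinity> \<partial>lborel) = (\<infinity>::ennreal)"
    proof -
      have "(\<integral>\<^sup>+ s\<in>{0<..t}. \<infinity> \<partial>lborel) = \<infinity> * emeasure lborel {0<..t}"
        by (rule nn_integral_cmult_indicator) simp
      then show ?thesis using t by (simp add: ennreal_top_mult)
    qed
    ultimately show False using real by (simp add: top_unique)
  qed
  then obtain s d where s: "0 < s" "s \<le> t" and d: "0 \<le> d" "h s = ennreal d"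
    by (metis ennreal_cases infinity_ennreal_def)
  have int: "integrable P F"
  proof (rule integrable_of_gradient[OF F, of "d / s"])
    show "AE \<omega> in P. (\<integral>\<^sup>+y. ennreal (\<bar>diff_op F y \<omega>\<bar>\<^sup>2) \<partial>\<nu>) \<le> ennreal (d / s)"
      using grad[OF s] AE_space[of P]
    proof eventually_elim
      case (elim \<omega>)
      have m: "(\<lambda>y. diff_op F y \<omega>) \<in> borel_measurable \<nu>"
        using elim(2) by (intro meas_diff_op_at F) (simp add: space_P)
      have "ennreal s * (\<integral>\<^sup>+y. ennreal (\<bar>diff_op F y \<omega>\<bar>\<^sup>2) \<partial>\<nu>) = (\<integral>\<^sup>+y. ennreal (s * \<bar>diff_op F y \<omega>\<bar>\<^sup>2) \<partial>\<nu>)"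
        using s m by (simp add: ennreal_mult nn_integral_cmult)
      also have "\<dots> \<le> (\<integral>\<^sup>+y. ennreal (exp_ratio s (K y) * \<bar>diff_op F y \<omega>\<bar>\<^sup>2) \<partial>\<nu>)"
        by (intro nn_integral_mono ennreal_leI mult_right_mono exp_ratio_ge K) simp
      also have "\<dots> \<le> ennreal d" using elim(1) d by simp
      finally have "ennreal (1 / s) * (ennreal s * (\<integral>\<^sup>+y. ennreal (\<bar>diff_op F y \<omega>\<bar>\<^sup>2) \<partial>\<nu>)) \<le> ennreal (1 / s) * ennreal d"
        by (intro mult_left_mono) auto
      then show ?case
        using s d by (simp add: mult.assoc[symmetric] ennreal_mult[symmetric])
    qed
  qed (use s d in auto)
  have "emeasure P {\<omega>\<in>space P. F \<omega> - (\<integral>\<omega>. F \<omega> \<partial>P) \<ge> x}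
      \<le> ennreal (exp (- t * x)) * (\<integral>\<^sup>+\<omega>. ennreal (exp (t * (F \<omega> - (\<integral>\<omega>. F \<omega> \<partial>P)))) * indicator (space P) \<omega> \<partial>P)"
    by (rule Chernoff_ineq_nn_integral_ge[OF t]) measurable
  also have "(\<integral>\<^sup>+\<omega>. ennreal (exp (t * (F \<omega> - (\<integral>\<omega>. F \<omega> \<partial>P)))) * indicator (space P) \<omega> \<partial>P) = (\<integral>\<^sup>+\<omega>. ennreal (exp (t * (F \<omega> - (\<integral>\<omega>. F \<omega> \<partial>P)))) \<partial>P)"
    by (intro nn_integral_cong) simp
  also have "\<dots> \<le> ennreal (exp c)"
    using real by (intro laplace_le[OF F int K bound t grad]) auto
  finally have "emeasure P {\<omega>\<in>space P. F \<omega> - (\<integral>\<omega>. F \<omega> \<partial>P) \<ge> x} \<le> ennreal (exp (- t * x)) * ennreal (exp c)"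
    by (simp add: mult_left_mono)
  also have "\<dots> = ennreal (exp (c - t * x))"
    by (simp add: ennreal_mult[symmetric] exp_add[symmetric])
  finally show ?thesis using real by (simp add: exp_ereal_def enn2ereal_ennreal)
qed

end

section \<open>The optimised bounds\<close>

lemma le_exp_ereal_iff: "0 < r \<Longrightarrow> ennreal r \<le> exp_ereal z \<longleftrightarrow> ereal (ln r) \<le> z"
  by (cases z) (auto simp: exp_ereal_def ennreal_le_iff ln_le_cancel_iff[symmetric] simp del: ln_le_cancel_iff)

text \<open>For \<open>p = r > 0\<close> each hypothesis reads \<open>ln r \<le> f i\<close>, and
  lower bounds pass to the infimum; \<open>p = 0\<close> is trivial.\<close>

lemma le_exp_ereal_INF:
  assumes p: "p < \<infinity>" and le: "\<And>i. i \<in> I \<Longrightarrow> p \<le> exp_ereal (f i)"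
  shows "p \<le> exp_ereal (INF i\<in>I. f i)"
proof (cases p)
  case (real r)
  show ?thesis
  proof (cases "r = 0")
    case False
    with real have "0 < r" by simp
    then show ?thesis using le real by (simp add: le_exp_ereal_iff INF_greatest)
  qed (use real in simp)
qed (use p in simp)

lemma exp_ereal_mono: "z \<le> w \<Longrightarrow> exp_ereal z \<le> exp_ereal w"
  by (cases z; cases w) (auto simp: exp_ereal_def ennreal_leI)

lemma exp_ereal_nonneg_ge_1: "0 \<le> z \<Longrightarrow> 1 \<le> exp_ereal z"
  using exp_ereal_mono[of 0 z] by (simp add: exp_ereal_def zero_ereal_def)

lemma borel_measurable_mono_ennreal:
  fixes h :: "real \<Rightarrow> ennreal"
  assumes "mono h"
  shows "h \<in> borel_measurable borel"
proof (rule borel_measurableI_ge)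
  fix c
  have "is_interval {x. c \<le> h x}"
    unfolding is_interval_1 using monoD[OF assms] by (blast intro: order_trans)
  from real_interval_borel_measurable[OF this]
  show "{x \<in> space borel. c \<le> h x} \<in> sets borel" by simp
qed

section \<open>The left inverse, Young's inequality and left limits\<close>

lemma left_inv_mono: "y \<le> x \<Longrightarrow> left_inv h y \<le> left_inv h x"
  unfolding left_inv_def by (intro INF_superset_mono) (auto intro: order_trans ennreal_leI)

lemma left_inv_le: "0 < s \<Longrightarrow> ennreal y \<le> h s \<Longrightarrow> left_inv h y \<le> ennreal s"
  unfolding left_inv_def by (intro INF_lower) auto

text \<open>Young's inequality: the regions below the graph of \<open>h\<close> and to the left of it are
  disjoint parts of the rectangle \<open>[0, T] \<times> [0, x]\<close>.\<close>

lemma young_left_inv: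
  assumes h: "mono h" and T: "0 \<le> T" "left_inv h x = ennreal T" and x: "0 \<le> x"
  shows "(\<integral>\<^sup>+ s\<in>{0..x}. left_inv h s \<partial>lborel) + (\<integral>\<^sup>+ s\<in>{0..T}. h s \<partial>lborel) \<le> ennreal (T * x)"
proof -
  have h_meas[measurable]: "h \<in> borel_measurable borel" by (rule borel_measurable_mono_ennreal[OF h])
  \<comment> \<open>\<open>?lo\<close> collects the points of the rectangle above the graph of
    \<open>h\<close>, \<open>?up\<close> those on or below it. The end point \<open>T\<close> is
    left out because \<open>h\<close> may jump above \<open>x\<close> there, and 0 because the
    infimum in \<open>left_inv\<close> runs over positive arguments.\<close>
  let ?R = "\<lambda>s y. indicator {0<..<T} s * indicator {0..x} y :: ennreal"
  let ?lo = "\<lambda>s y. ?R s y * (if h s < ennreal y then 1 else 0)"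
  let ?up = "\<lambda>s y. ?R s y * (if h s < ennreal y then 0 else 1)"
  have m[measurable]: "(\<lambda>p. ?lo (fst p) (snd p)) \<in> borel_measurable (borel \<Otimes>\<^sub>M borel)"
     "(\<lambda>p. ?up (fst p) (snd p)) \<in> borel_measurable (borel \<Otimes>\<^sub>M borel)"
    by measurable
  have left: "(\<integral>\<^sup>+ y\<in>{0..x}. left_inv h y \<partial>lborel) \<le> (\<integral>\<^sup>+ y. \<integral>\<^sup>+ s. ?lo s y \<partial>lborel \<partial>lborel)"
  proof (rule nn_integral_mono)
    fix y
    show "left_inv h y * indicator {0..x} y \<le> (\<integral>\<^sup>+ s. ?lo s y \<partial>lborel)"
    proof (cases "y \<in> {0..x}")
      case True
      then have le: "left_inv h y \<le> ennreal T" using left_inv_mono[of y x h] T by simp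
      then obtain r where r: "0 \<le> r" "left_inv h y = ennreal r"
        by (cases "left_inv h y") (auto simp: top_unique)
      with le T have "r \<le> T" by simp
      have "left_inv h y = (\<integral>\<^sup>+ s. indicator {0<..<r} s \<partial>lborel)" using r by simp
      also have "\<dots> \<le> (\<integral>\<^sup>+ s. ?lo s y \<partial>lborel)"
      proof (rule nn_integral_mono)
        fix s
        have "h s < ennreal y" if "0 < s" "s < r"
        proof (rule ccontr)
          assume "\<not> h s < ennreal y"
          then have "ennreal r \<le> ennreal s" using left_inv_le[OF that(1), of y h] r by simp
          then show False using that by simp
        qed
        then show "indicator {0<..<r} s \<le> ?lo s y"
          using True \<open>r \<le> T\<close> by (auto simp: indicator_def)
      qed
      finally show ?thesis using True by simp
    qed simp
  qed
  have "(\<integral>\<^sup>+ s\<in>{0..T}. h s \<partial>lborel) \<le> (\<integral>\<^sup>+ s. \<integral>\<^sup>+ y. ?up s y \<partial>lborel \<partial>lborel)"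
  proof (rule nn_integral_mono_AE)
    have "AE s in lborel. s \<noteq> (0::real)" "AE s in lborel. s \<noteq> T" by (rule AE_lborel_singleton)+
    then show "AE s in lborel. h s * indicator {0..T} s \<le> (\<integral>\<^sup>+ y. ?up s y \<partial>lborel)"
    proof eventually_elim
      case (elim s)
      show ?case
      proof (cases "s \<in> {0..T}")
        case True
        with elim have s: "0 < s" "s < T" by auto
        have lt: "h s < ennreal x"
        proof (rule ccontr)
          assume "\<not> h s < ennreal x"
          then have "ennreal T \<le> ennreal s" using left_inv_le[OF s(1), of x h] T by simp
          then show False using s by simp
        qed
        then obtain r where r: "0 \<le> r" "h s = ennreal r" by (cases "h s") auto
        with lt x have "r < x" by (simp add: ennreal_less_iff)
        have "h s = (\<integral>\<^sup>+ y. indicator {0..r} y \<partial>lborel)" using r by simp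
        also have "\<dots> \<le> (\<integral>\<^sup>+ y. ?up s y \<partial>lborel)"
          using s r \<open>r < x\<close> by (intro nn_integral_mono) (auto simp: indicator_def ennreal_less_iff)
        finally show ?thesis using True by simp
      qed simp
    qed
  qed
  also have "\<dots> = (\<integral>\<^sup>+ y. \<integral>\<^sup>+ s. ?up s y \<partial>lborel \<partial>lborel)"
    by (rule lborel_pair.Fubini'[symmetric]) (simp add: case_prod_beta')
  finally have "(\<integral>\<^sup>+ y\<in>{0..x}. left_inv h y \<partial>lborel) + (\<integral>\<^sup>+ s\<in>{0..T}. h s \<partial>lborel)
      \<le> (\<integral>\<^sup>+ y. \<integral>\<^sup>+ s. ?lo s y \<partial>lborel \<partial>lborel) + (\<integral>\<^sup>+ y. \<integral>\<^sup>+ s. ?up s y \<partial>lborel \<partial>lborel)"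
    by (intro add_mono left)
  also have "\<dots> = (\<integral>\<^sup>+ y. (\<integral>\<^sup>+ s. ?lo s y \<partial>lborel) + (\<integral>\<^sup>+ s. ?up s y \<partial>lborel) \<partial>lborel)"
    by (rule nn_integral_add[symmetric]) measurable
  also have "\<dots> = (\<integral>\<^sup>+ y. \<integral>\<^sup>+ s. ?R s y \<partial>lborel \<partial>lborel)"
  proof (rule nn_integral_cong)
    fix y
    have "(\<integral>\<^sup>+ s. ?lo s y \<partial>lborel) + (\<integral>\<^sup>+ s. ?up s y \<partial>lborel) = (\<integral>\<^sup>+ s. ?lo s y + ?up s y \<partial>lborel)"
      by (rule nn_integral_add[symmetric]) measurable
    also have "\<dots> = (\<integral>\<^sup>+ s. ?R s y \<partial>lborel)" by (intro nn_integral_cong) simp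
    finally show "(\<integral>\<^sup>+ s. ?lo s y \<partial>lborel) + (\<integral>\<^sup>+ s. ?up s y \<partial>lborel) = (\<integral>\<^sup>+ s. ?R s y \<partial>lborel)" .
  qed
  also have "\<dots> = (\<integral>\<^sup>+ y. ennreal T * indicator {0..x} y \<partial>lborel)"
    using T by (intro nn_integral_cong) (simp add: nn_integral_multc)
  also have "\<dots> = ennreal (T * x)"
    using T x by (simp add: nn_integral_cmult ennreal_mult)
  finally show ?thesis .
qed

text \<open>By monotonicity the left limit is the supremum of \<open>h\<close> over
  \<open>(0, t0)\<close>, so a value below it is exceeded somewhere. The order topology of the
  extended reals treats finite and infinite \<open>t0\<close> alike.\<close>

lemma less_left_lim_witness:
  assumes h: "mono h" and t0: "0 < t0" and less: "c < left_lim h t0"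
  shows "\<exists>t>0. c < h t"
proof (rule ccontr)
  assume "\<not> (\<exists>t>0. c < h t)"
  then have le: "h t \<le> c" if "0 < t" for t using that by (meson not_le)
  let ?f = "\<lambda>s. h (real_of_ereal s)"
  let ?L = "SUP s\<in>{0<..<t0}. ?f s"
  have real: "0 < real_of_ereal s" if "0 < s" "s < t0" for s
    using that by (cases s) auto
  have mono: "?f s \<le> ?f s'" if "0 < s" "s \<le> s'" "s' < t0" for s s'
    using that by (intro monoD[OF h]) (cases s; cases s'; auto)
  have lim: "(?f \<longlongrightarrow> ?L) (at_left t0)"
  proof (rule order_tendstoI)
    fix a assume "a < ?L"
    then obtain s where s: "0 < s" "s < t0" "a < ?f s" by (auto simp: less_SUP_iff)
    have "a < ?f s'" if "s < s'" "s' < t0" for s'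
      using mono[of s s'] s that by (auto intro: less_le_trans)
    then show "\<forall>\<^sub>F s in at_left t0. a < ?f s"
      unfolding eventually_at_left[OF t0] using s by blast
  next
    fix a assume "?L < a"
    then have "?f s < a" if "0 < s" "s < t0" for s
      using that by (intro le_less_trans[OF SUP_upper[of s "{0<..<t0}" ?f]]) auto
    then show "\<forall>\<^sub>F s in at_left t0. ?f s < a"
      unfolding eventually_at_left[OF t0] using t0 by blast
  qed
  \<comment> \<open>\<open>Lim\<close> is a definite description, and limits are unique only along a
    non-trivial filter.\<close>
  have "at_left t0 \<noteq> bot"
  proof
    assume "at_left t0 = bot"
    then have "\<forall>\<^sub>F s in at_left t0. False" by simp
    then obtain b where "b < t0" "\<forall>y>b. y < t0 \<longrightarrow> False"
      unfolding eventually_at_left[OF t0] by blast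
    then show False using dense[of b t0] by blast
  qed
  then have "left_lim h t0 = ?L"
    unfolding left_lim_def by (intro tendsto_Lim lim)
  moreover have "?L \<le> c" by (intro SUP_least le real) auto
  ultimately show False using less by simp
qed

section \<open>The three deviation bounds, for both readings of the supremum\<close>

theorem proposition2p3:
  fixes \<nu> :: "'a::metric_space measure"
    and P :: "'a set measure"
    and F :: "'a set \<Rightarrow> real"
    and K :: "'a \<Rightarrow> real"
    and S :: "('a set \<Rightarrow> ennreal) \<Rightarrow> ennreal"
  assumes sigma_compact: "\<exists>C::nat \<Rightarrow> 'a set. (\<forall>n. compact (C n)) \<and> (\<Union>n. C n) = UNIV"
    and radon: "radon_measure \<nu>"
    and diffuse: "diffuse_measure \<nu>"
    and poisson: "poisson_measure \<nu> P"
    and F_meas: "F \<in> borel_measurable config_space"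
    and K_meas: "K \<in> borel_measurable borel"
    and K_nonneg: "\<And>y. 0 \<le> K y"
    and bound: "\<And>y \<omega>. \<omega> \<in> configurations \<Longrightarrow> diff_op F y \<omega> \<le> K y"
    and sup: "S = (\<lambda>G. SUP \<omega>\<in>configurations. G \<omega>) \<or> S = esssup P"
  defines "h \<equiv> dev_fun S \<nu> K F"
    and "tail \<equiv> (\<lambda>x. emeasure P {\<omega>\<in>space P. F \<omega> - (\<integral>\<omega>'. F \<omega>' \<partial>P) \<ge> x})"
  shows
    "(\<forall>x>0. tail x \<le>
        exp_ereal (INF t\<in>{0<..}. enn2ereal (\<integral>\<^sup>+ s\<in>{0..t}. h s \<partial>lborel) - ereal (t * x)))
   \<and> (\<forall>t0>0. (\<forall>t. 0 \<le> t \<and> ereal t < t0 \<longrightarrow> h t < \<infinity>) \<longrightarrow>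
        (\<forall>x. 0 < x \<and> ennreal x < left_lim h t0 \<longrightarrow>
          tail x \<le> exp_ereal (- enn2ereal (\<integral>\<^sup>+ s\<in>{0..x}. left_inv h s \<partial>lborel))))
   \<and> ((\<forall>y. K y = 0) \<longrightarrow>
        (\<forall>x>0. tail x \<le>
          exp_ereal (- (ereal (x\<^sup>2) /
            (2 * enn2ereal (S (\<lambda>\<omega>. \<integral>\<^sup>+ y. ennreal (\<bar>diff_op F y \<omega>\<bar>\<^sup>2) \<partial>\<nu>)))))))"
proof -
  obtain D :: "nat \<Rightarrow> 'a set" where D: "\<And>n. compact (D n)" "(\<Union>n. D n) = UNIV"
    using sigma_compact by blast
  define A where "A n = (\<Union>i\<le>n. D i)" for n
  have A_compact: "compact (A n)" for n unfolding A_def by (intro compact_UN) (auto simp: D)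
  interpret P: prob_space P using poisson by (simp add: poisson_measure_def)
  interpret poisson_process A \<nu> P
  proof
    show "compact (A n)" for n by (rule A_compact)
    show "incseq A" by (force simp: incseq_def A_def)
    show "(\<Union>n. A n) = UNIV"
    proof -
      have "D n \<subseteq> A n" for n by (auto simp: A_def)
      then show ?thesis using D(2) by (metis UN_mono top.extremum_uniqueI subset_refl)
    qed
    show "sets \<nu> = sets borel" "emeasure \<nu> (A n) < \<infinity>" for n
      using radon A_compact by (auto simp: radon_measure_def)
    show "sets P = sets config_space" using poisson by (simp add: poisson_measure_def)
    fix B :: "'a set" assume B: "B \<in> sets borel" "emeasure \<nu> B < \<infinity>"
    have "space P = configurations"
      using sets_eq_imp_space_eq[of P config_space] poisson by (simp add: poisson_measure_def space_config_space)
    then have "void B = {\<omega>\<in>space P. emeasure (dirac_sum \<omega>) B = of_nat 0}"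
      using B by (auto simp: void_def emeasure_dirac_sum emeasure_count_space_eq_0)
    moreover have "measure P {\<omega>\<in>space P. emeasure (dirac_sum \<omega>) B = of_nat 0} = exp (- measure \<nu> B) * measure \<nu> B ^ 0 / fact 0"
      using poisson B unfolding poisson_measure_def by blast
    ultimately show "measure P (void B) = exp (- measure \<nu> B)" by simp
  qed
  interpret sigma_finite_measure \<nu> by (rule sigma_finite_\<nu>)

  define J where "J t \<omega> = (\<integral>\<^sup>+ y. ennreal (exp_ratio t (K y) * \<bar>diff_op F y \<omega>\<bar>\<^sup>2) \<partial>\<nu>)" for t \<omega>
  have h_eq: "h t = S (J t)" for t by (simp add: h_def dev_fun_def J_def[abs_def])
  \<comment> \<open>Almost sure domination by \<open>S G\<close>, together with monotonicity of
    \<open>h\<close>, is what the argument takes from the supremum, so both readings are served by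
    one proof.\<close>
  have S_AE: "AE \<omega> in P. G \<omega> \<le> S G" for G
    using sup
  proof
    assume S: "S = (\<lambda>G. SUP \<omega>\<in>configurations. G \<omega>)"
    show ?thesis unfolding S by (intro AE_I2 SUP_upper) (simp add: space_P)
  next
    assume S: "S = esssup P"
    show ?thesis unfolding S by (rule esssup_AE)
  qed
  \<comment> \<open>Measurability of the gradient integral is what makes \<open>h\<close> monotone
    when \<open>S\<close> is the essential supremum.\<close>
  have J_meas: "J t \<in> borel_measurable P" for t
  proof -
    have "(\<lambda>y. exp_ratio t (K y)) \<in> borel_measurable borel"
      unfolding exp_ratio_def using K_meas by measurable
    then have r: "(\<lambda>y. exp_ratio t (K y)) \<in> borel_measurable \<nu>"
      using measurable_cong_sets[OF sets_\<nu> refl, of "borel :: real measure"] by simp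
    have "(\<lambda>p. ennreal (exp_ratio t (K (snd p)) * \<bar>diff_op F (snd p) (fst p)\<bar>\<^sup>2)) \<in> borel_measurable (config_space \<Otimes>\<^sub>M \<nu>)"
      using measurable_compose[OF measurable_snd r] measurable_diff_op[OF F_meas] by measurable
    then have "J t \<in> borel_measurable config_space"
      unfolding J_def by (intro borel_measurable_nn_integral) (simp add: case_prod_beta')
    then show ?thesis by (simp add: measurable_P)
  qed
  have h_mono: "mono h"
  proof (rule monoI)
    fix s t :: real assume "s \<le> t"
    then have J_mono: "J s \<omega> \<le> J t \<omega>" for \<omega>
      unfolding J_def by (intro nn_integral_mono ennreal_leI mult_right_mono exp_ratio_mono K_nonneg) auto
    show "h s \<le> h t"
      unfolding h_eq using sup
    proof
      assume S: "S = (\<lambda>G. SUP \<omega>\<in>configurations. G \<omega>)"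
      show "S (J s) \<le> S (J t)" unfolding S by (intro SUP_mono') (rule J_mono)
    next
      assume S: "S = esssup P"
      show "S (J s) \<le> S (J t)" unfolding S by (rule esssup_mono[OF J_meas J_mono])
    qed
  qed
  have chernoff: "tail x \<le> exp_ereal (enn2ereal (\<integral>\<^sup>+ s\<in>{0..t}. h s \<partial>lborel) - ereal (t * x))" if "0 < t" for t x
    unfolding tail_def
  proof (rule chernoff_bound[OF F_meas K_meas K_nonneg bound that])
    show "AE \<omega> in P. (\<integral>\<^sup>+ y. ennreal (exp_ratio s (K y) * \<bar>diff_op F y \<omega>\<bar>\<^sup>2) \<partial>\<nu>) \<le> h s" for s
      using S_AE[of "J s"] by (simp add: h_eq J_def)
  qed
  have tail_le_1: "tail x \<le> 1" for x
    unfolding tail_def by (rule P.emeasure_le_1)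

  have part1: "tail x \<le> exp_ereal (INF t\<in>{0<..}. enn2ereal (\<integral>\<^sup>+ s\<in>{0..t}. h s \<partial>lborel) - ereal (t * x))" for x
    using tail_le_1[of x] by (intro le_exp_ereal_INF chernoff) (auto intro: le_less_trans)

  have part2: "tail x \<le> exp_ereal (- enn2ereal (\<integral>\<^sup>+ s\<in>{0..x}. left_inv h s \<partial>lborel))"
    if t0: "0 < t0" and x: "0 < x" "ennreal x < left_lim h t0" for t0 x
  proof -
    \<comment> \<open>Below the left limit \<open>h\<close> exceeds \<open>x\<close> somewhere, so
      \<open>T = left_inv h x\<close> is finite. At \<open>T\<close> the difference
      \<open>h - x\<close> changes sign, so it is the best Chernoff parameter, and Young's
      inequality bounds the exponent there.\<close>
    obtain t1 where t1: "0 < t1" "ennreal x < h t1"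
      using less_left_lim_witness[OF h_mono t0 x(2)] by blast
    then have "left_inv h x \<le> ennreal t1" by (intro left_inv_le) auto
    then obtain T where T: "0 \<le> T" "left_inv h x = ennreal T"
      by (cases "left_inv h x") (auto simp: top_unique)
    let ?A = "\<integral>\<^sup>+ s\<in>{0..x}. left_inv h s \<partial>lborel" and ?B = "\<integral>\<^sup>+ s\<in>{0..T}. h s \<partial>lborel"
    have young: "?A + ?B \<le> ennreal (T * x)"
      by (rule young_left_inv[OF h_mono T]) (use x in simp)
    then obtain a b where ab: "0 \<le> a" "?A = ennreal a" "0 \<le> b" "?B = ennreal b"
      by (cases ?A; cases ?B) (auto simp: top_unique)
    with young T x have le: "a + b \<le> T * x" by (simp add: ennreal_plus[symmetric] ennreal_le_iff del: ennreal_plus)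
    show ?thesis
    proof (cases "T = 0")
      \<comment> \<open>\<open>T = 0\<close> is not admissible in the Chernoff bound, but then
        Young's inequality makes the integral of \<open>left_inv h\<close> vanish and the claim is
        that a probability is at most 1.\<close>
      case True
      then have "a = 0" using le ab by simp
      then have "1 \<le> exp_ereal (- enn2ereal ?A)" using ab by (intro exp_ereal_nonneg_ge_1) (simp add: zero_ennreal.rep_eq)
      then show ?thesis using tail_le_1[of x] by (rule order_trans[rotated])
    next
      case False
      then have "tail x \<le> exp_ereal (enn2ereal ?B - ereal (T * x))" using T by (intro chernoff) simp
      also have "\<dots> \<le> exp_ereal (- enn2ereal ?A)"
        using le ab by (intro exp_ereal_mono) (simp add: enn2ereal_ennreal)
      finally show ?thesis .
    qed
  qed

  have part3: "tail x \<le> exp_ereal (- (ereal (x\<^sup>2) / (2 * enn2ereal (S (\<lambda>\<omega>. \<integral>\<^sup>+ y. ennreal (\<bar>diff_op F y \<omega>\<bar>\<^sup>2) \<partial>\<nu>)))))"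
    (is "_ \<le> exp_ereal (- (_ / (2 * enn2ereal ?a)))")
    if K0: "\<And>y. K y = 0" and x: "0 < x" for x
  proof (cases ?a)
    \<comment> \<open>Division by an infinite supremum makes the exponent 0.\<close>
    case top
    then show ?thesis using tail_le_1[of x] exp_ereal_nonneg_ge_1[of 0] by (auto intro: order_trans)
  next
    case (real a)
    \<comment> \<open>For \<open>K = 0\<close> the ratio is \<open>s\<close>, so
      \<open>a * s\<close> dominates the weighted gradient and serves as \<open>h\<close> in
      \<open>chernoff_bound\<close>; its integral over \<open>[0, t]\<close> is
      \<open>a * t\<^sup>2 / 2\<close>.\<close>
    have bd: "tail x \<le> ennreal (exp (a * t\<^sup>2 / 2 - t * x))" if t: "0 < t" for t
    proof -
      have "tail x \<le> exp_ereal (enn2ereal (\<integral>\<^sup>+ s\<in>{0..t}. ennreal (a * s) \<partial>lborel) - ereal (t * x))"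
        unfolding tail_def
      proof (rule chernoff_bound[OF F_meas K_meas K_nonneg bound t])
        fix s :: real assume s: "0 < s"
        show "AE \<omega> in P. (\<integral>\<^sup>+ y. ennreal (exp_ratio s (K y) * \<bar>diff_op F y \<omega>\<bar>\<^sup>2) \<partial>\<nu>) \<le> ennreal (a * s)"
          using S_AE[of "\<lambda>\<omega>. \<integral>\<^sup>+ y. ennreal (\<bar>diff_op F y \<omega>\<bar>\<^sup>2) \<partial>\<nu>"] AE_space[of P]
        proof eventually_elim
          case (elim \<omega>)
          have "(\<lambda>y. diff_op F y \<omega>) \<in> borel_measurable \<nu>"
            using elim(2) by (intro meas_diff_op_at F_meas) (simp add: space_P)
          then have "(\<integral>\<^sup>+ y. ennreal (exp_ratio s (K y) * \<bar>diff_op F y \<omega>\<bar>\<^sup>2) \<partial>\<nu>) = ennreal s * (\<integral>\<^sup>+ y. ennreal (\<bar>diff_op F y \<omega>\<bar>\<^sup>2) \<partial>\<nu>)"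
            using s by (simp add: exp_ratio_def K0 ennreal_mult nn_integral_cmult)
          also have "\<dots> \<le> ennreal s * ennreal a" using elim(1) real by (intro mult_left_mono) auto
          finally show ?case using s real by (simp add: ennreal_mult mult.commute)
        qed
      qed
      also have "(\<integral>\<^sup>+ s\<in>{0..t}. ennreal (a * s) \<partial>lborel) = ennreal (a * t\<^sup>2 / 2 - a * 0\<^sup>2 / 2)"
        using t real by (intro nn_integral_FTC_Icc) (auto intro!: derivative_eq_intros)
      finally show ?thesis using real by (simp add: exp_ereal_def enn2ereal_ennreal)
    qed
    show ?thesis
    proof (cases "a = 0")
      \<comment> \<open>The claimed exponent is \<open>-\<infinity>\<close>, so the tail has to
        vanish. Here \<open>bd\<close> reads \<open>tail x \<le> exp (- (t * x))\<close> for every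
        \<open>t > 0\<close>; a tail \<open>r > 0\<close> is refuted by a \<open>t\<close> with
        \<open>t * x\<close> larger than \<open>- ln r\<close>.\<close>
      case True
      have "tail x = 0"
      proof (cases "tail x")
        case (real r)
        have "r \<le> 0"
        proof (rule ccontr)
          assume "\<not> r \<le> 0"
          then have r: "0 < r" by simp
          define t where "t = (\<bar>ln r\<bar> + 1) / x"
          have t: "0 < t" "t * x = \<bar>ln r\<bar> + 1" using x by (auto simp: t_def)
          have "r \<le> exp (- (t * x))" using bd[OF t(1)] real True by (simp add: ennreal_le_iff)
          then have "ln r \<le> - (t * x)" using r by (metis exp_gt_zero ln_exp ln_le_cancel_iff)
          then show False using t(2) by linarith
        qed
        then show ?thesis using real by simp
      next
        case top
        then show ?thesis using tail_le_1[of x] by (simp add: top_unique)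
      qed
      then show ?thesis by simp
    next
      case False
      with real have a: "0 < a" by simp
      \<comment> \<open>\<open>t = x / a\<close> minimises
        \<open>a * t\<^sup>2 / 2 - t * x\<close>.\<close>
      have "a * (x / a)\<^sup>2 / 2 - x / a * x = - (x\<^sup>2 / (2 * a))"
        using a by (simp add: field_simps power2_eq_square)
      then have "tail x \<le> ennreal (exp (- (x\<^sup>2 / (2 * a))))"
        using bd[of "x / a"] a x by simp
      then show ?thesis using real a by (simp add: exp_ereal_def enn2ereal_ennreal)
    qed
  qed
  show ?thesis using part1 part2 part3 by blast
qed

end
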